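(* Let $X\subset\mathbb{P}_2$ be an irreducible plane curve of degree $d$ and let $\alpha=sd-r\ge0$ with integers $s\ge0$, $0\le r<d$. If $s\ge d-2$, all complete linear systems of degree $\alpha$ on $X$ have the same dimension $\alpha-p$, where $p=(d-1)(d-2)/2$. If $s\le d-3$, put $r(\alpha)=s(s+3)/2-r$ if $r\le s+1$, and $r(\alpha)=(s-1)(s+2)/2$ if $r\ge s+1$. Then every linear system of degree $\alpha$ on $X$ has dimension at most $r(\alpha)$. Suppose that a group of points $Y$ belongs to a linear system of degree $\alpha$ and dimension $r(\alpha)$. Then: (i) if $r\le s$, $Y$ is the residual of a group of $r$ points in the intersection of $X$ with a curve of degree $s$; (ii) if $r\ge s+2$, $Y$ contains the intersection of $X$ with a curve of degree $s-1$; (iii) if $r=s+1$, either $Y$ is the residual of a group of $r$ points in the intersection of $X$ with a curve of degree $s$, or $Y$ contains the intersection of $X$ with a curve of degree $s-1$.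
   Context: $k$ is an algebraically closed field of characteristic $0$. "Irreducible" curve means that its homogeneous ideal is prime. A group of points on $X$ is a closed subscheme of pure dimension $0$ (possibly empty, not necessarily reduced); a "group of $r$ points" is one of degree $r$. All groups of points considered are locally principal on $X$ and are identified with effective Cartier divisors. $\mathcal{O}_X(Y)$ is the invertible sheaf associated with $Y$; the complete linear system $|Y|$ is the set of groups of points linearly equivalent to $Y$, of dimension $h^0(\mathcal{O}_X(Y))-1$; a linear system of degree $\alpha$ is a linear subsystem of a complete linear system $|Y|$ with $\deg Y=\alpha$. The curves of degree $s$ or $s-1$ with which $X$ is intersected do not contain $X$. Residual: for groups of points $Y,Y''\subset Z$, $Y$ is the residual of $Y''$ in $Z$ if the multiplication map $I_Y\to\operatorname{Hom}(I_{Y''},I_Z)$ is an isomorphism, i.e. $I_Y=(I_Z:I_{Y''})$, where $I_V$ denotes the saturated homogeneous ideal of $V$ in $k[X_0,X_1,X_2]$. *)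

theory Defs
  imports "HOL-Algebra.Algebra" "HOL-Algebra.Algebraic_Closure_Type"
    "HOL-Computational_Algebra.Computational_Algebra"
begin

section \<open>The homogeneous coordinate ring of the projective plane\<close>

text \<open>
  The ring $k[X_0,X_1,X_2]$ is the type of iterated polynomials $k[X_0][X_1][X_2]$: the
  coefficient of $X_0^i X_1^j X_2^l$ in \<open>f\<close> is \<open>coeff (coeff (coeff f l) j) i\<close>.
\<close>

type_synonym 'k poly3 = "'k poly poly poly"
type_synonym 'k point = "'k \<times> 'k \<times> 'k"

definition form :: "nat \<Rightarrow> 'k::field poly3 \<Rightarrow> bool" where
  "form n f \<longleftrightarrow> (\<forall>i j l. coeff (coeff (coeff f l) j) i \<noteq> 0 \<longrightarrow> i + j + l = n)"

definition eval3 :: "'k::field poly3 \<Rightarrow> 'k point \<Rightarrow> 'k" where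
  "eval3 f = (\<lambda>(x0, x1, x2). poly (poly (poly f [:[:x2:]:]) [:x1:]) x0)"

definition const3 :: "'k::field \<Rightarrow> 'k poly3" where
  "const3 c = [:[:[:c:]:]:]"

abbreviation poly3_ring :: "'k::field poly3 ring" where
  "poly3_ring \<equiv> ring_of_type_algebra"

text \<open>The point of the projective plane with homogeneous coordinates \<open>p \<noteq> (0, 0, 0)\<close>, as a line.\<close>

definition proj_point :: "'k::field point \<Rightarrow> 'k point set" where
  "proj_point = (\<lambda>(x0, x1, x2). range (\<lambda>c. (c * x0, c * x1, c * x2)))"

section \<open>Closed subschemes of the projective plane\<close>

text \<open>A closed subscheme \<open>V\<close> is represented throughout by its saturated homogeneous ideal $I_V$;
  in particular \<open>V \<subseteq> W\<close> is the reverse inclusion of ideals, and the empty scheme is \<open>UNIV\<close>.\<close>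

definition homogeneous_ideal :: "'k::field poly3 set \<Rightarrow> bool" where
  "homogeneous_ideal I \<longleftrightarrow> ideal I poly3_ring \<and> I = Idl\<^bsub>poly3_ring\<^esub> {f \<in> I. \<exists>n. form n f}"

definition saturation :: "'k::field poly3 set \<Rightarrow> 'k poly3 set" where
  "saturation I = {f. \<exists>n. \<forall>g. form n g \<longrightarrow> f * g \<in> I}"

definition closed_subscheme :: "'k::field poly3 set \<Rightarrow> bool" where
  "closed_subscheme I \<longleftrightarrow> homogeneous_ideal I \<and> saturation I = I"

definition support :: "'k::field poly3 set \<Rightarrow> 'k point set set" where
  "support I = {proj_point p | p. p \<noteq> (0, 0, 0) \<and> (\<forall>f \<in> I. eval3 f p = 0)}"

definition hilbert_function :: "'k::field poly3 set \<Rightarrow> nat \<Rightarrow> int" where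
  "hilbert_function I n =
     int (ring.dim poly3_ring (range const3) {f :: 'k poly3. form n f})
     - int (ring.dim poly3_ring (range const3) {f \<in> I. form n f})"

text \<open>The degree of a zero-dimensional (or empty) scheme is the value of its Hilbert polynomial.\<close>

definition has_degree :: "'k::field poly3 set \<Rightarrow> nat \<Rightarrow> bool" where
  "has_degree I m \<longleftrightarrow> (\<forall>\<^sub>F n in sequentially. hilbert_function I n = int m)"

section \<open>Irreducible plane curves\<close>

definition irreducible_plane_curve :: "nat \<Rightarrow> 'k::field poly3 \<Rightarrow> bool" where
  "irreducible_plane_curve d F \<longleftrightarrow>
     F \<noteq> 0 \<and> form d F \<and> primeideal (PIdl\<^bsub>poly3_ring\<^esub> F) poly3_ring"

definition points :: "'k::field poly3 \<Rightarrow> 'k point set" where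
  "points F = {p. p \<noteq> (0, 0, 0) \<and> eval3 F p = 0}"

text \<open>A curve of degree \<open>s\<close>, given by an equation \<open>G\<close>, that does not contain \<open>F = 0\<close>
  (so that \<open>G \<noteq> 0\<close>).\<close>

definition cutting_curve :: "'k::field poly3 \<Rightarrow> nat \<Rightarrow> 'k poly3 \<Rightarrow> bool" where
  "cutting_curve F s G \<longleftrightarrow> form s G \<and> \<not> F dvd G"

definition curve_intersection :: "'k::field poly3 \<Rightarrow> 'k poly3 \<Rightarrow> 'k poly3 set" where
  "curve_intersection F G = saturation (Idl\<^bsub>poly3_ring\<^esub> {F, G})"

subsection \<open>Rational functions and local rings\<close>

text \<open>
  The local ring of the plane at the generic point of the curve \<open>F = 0\<close>, as a subring of
  $k(X_0,X_1,X_2)$, and its maximal ideal. The residue field is the function field of the curve,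
  which contains all its local rings.
\<close>

definition generic_ring :: "'k::field poly3 \<Rightarrow> 'k poly3 fract ring" where
  "generic_ring F = ring_of_type_algebra
     \<lparr>carrier := {Fract g h | g h n. form n g \<and> form n h \<and> \<not> F dvd h}\<rparr>"

definition generic_maximal_ideal :: "'k::field poly3 \<Rightarrow> 'k poly3 fract set" where
  "generic_maximal_ideal F =
     {Fract g h | g h n. form n g \<and> form n h \<and> \<not> F dvd h \<and> F dvd g}"

definition function_field :: "'k::field poly3 \<Rightarrow> 'k poly3 fract set ring" where
  "function_field F = generic_ring F Quot generic_maximal_ideal F"

definition rat_fun :: "'k::field poly3 \<Rightarrow> 'k poly3 \<Rightarrow> 'k poly3 \<Rightarrow> 'k poly3 fract set" where
  "rat_fun F g h = generic_maximal_ideal F +>\<^bsub>generic_ring F\<^esub> Fract g h"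

definition constants :: "'k::field poly3 \<Rightarrow> 'k poly3 fract set set" where
  "constants F = range (\<lambda>c. rat_fun F (const3 c) 1)"

text \<open>The stalk at \<open>p\<close> of the ideal sheaf of \<open>Y\<close> on the curve. For the empty scheme
  \<open>Y = UNIV\<close> it is the local ring of the curve at \<open>p\<close>.\<close>

definition ideal_stalk ::
    "'k::field poly3 \<Rightarrow> 'k poly3 set \<Rightarrow> 'k point \<Rightarrow> 'k poly3 fract set set" where
  "ideal_stalk F Y p =
     {rat_fun F g h | g h n. g \<in> Y \<and> form n g \<and> form n h \<and> eval3 h p \<noteq> 0}"

definition local_ring ::
    "'k::field poly3 \<Rightarrow> 'k point \<Rightarrow> 'k poly3 fract set ring" where
  "local_ring F p = (function_field F)\<lparr>carrier := ideal_stalk F UNIV p\<rparr>"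

section \<open>Groups of points and linear systems\<close>

text \<open>Finite support expresses dimension zero (the ground field will be algebraically closed).
  It excludes the curve itself, so that local generators are automatically non-zero-divisors.\<close>

definition group_of_points :: "'k::field poly3 \<Rightarrow> 'k poly3 set \<Rightarrow> bool" where
  "group_of_points F Y \<longleftrightarrow>
     closed_subscheme Y \<and> F \<in> Y \<and> finite (support Y) \<and>
     (\<forall>p \<in> points F. principalideal (ideal_stalk F Y p) (local_ring F p))"

definition residual :: "'k::field poly3 set \<Rightarrow> 'k poly3 set \<Rightarrow> 'k poly3 set \<Rightarrow> bool" where
  "residual Y Y'' Z \<longleftrightarrow> Z \<subseteq> Y \<and> Z \<subseteq> Y'' \<and> Y = {f. \<forall>g \<in> Y''. f * g \<in> Z}"

text \<open>The global sections of $\mathcal{O}_X(Y)$, the inverse of the ideal sheaf of \<open>Y\<close>.\<close>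

definition global_sections ::
    "'k::field poly3 \<Rightarrow> 'k poly3 set \<Rightarrow> 'k poly3 fract set set" where
  "global_sections F Y = {f \<in> carrier (function_field F).
     \<forall>p \<in> points F. f <#\<^bsub>function_field F\<^esub> ideal_stalk F Y p \<subseteq> carrier (local_ring F p)}"

text \<open>\<open>Y' = Y + div f\<close> as Cartier divisors. If \<open>f\<close> is a section of $\mathcal{O}_X(Y)$, then
  \<open>Y'\<close> is its scheme of zeros.\<close>

definition differ_by_div ::
    "'k::field poly3 \<Rightarrow> 'k poly3 set \<Rightarrow> 'k poly3 fract set \<Rightarrow> 'k poly3 set \<Rightarrow> bool" where
  "differ_by_div F Y f Y' \<longleftrightarrow>
     (\<forall>p \<in> points F. ideal_stalk F Y' p = f <#\<^bsub>function_field F\<^esub> ideal_stalk F Y p)"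

definition linearly_equivalent ::
    "'k::field poly3 \<Rightarrow> 'k poly3 set \<Rightarrow> 'k poly3 set \<Rightarrow> bool" where
  "linearly_equivalent F Y Y' \<longleftrightarrow>
     (\<exists>f \<in> carrier (function_field F) - {\<zero>\<^bsub>function_field F\<^esub>}. differ_by_div F Y f Y')"

definition complete_linear_system ::
    "'k::field poly3 \<Rightarrow> 'k poly3 set \<Rightarrow> 'k poly3 set set" where
  "complete_linear_system F Y = {Y'. group_of_points F Y' \<and> linearly_equivalent F Y Y'}"

text \<open>\<open>L\<close> is the linear subsystem of \<open>|Y|\<close> cut out by the subspace \<open>V\<close> of the global sections of
  $\mathcal{O}_X(Y)$; the locale predicate \<open>subalgebra\<close> of the library says that \<open>V\<close> is a
  vector subspace.\<close>

definition linear_subsystem ::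
    "'k::field poly3 \<Rightarrow> 'k poly3 set \<Rightarrow> 'k poly3 fract set set \<Rightarrow> 'k poly3 set set \<Rightarrow> bool" where
  "linear_subsystem F Y V L \<longleftrightarrow>
     subalgebra (constants F) V (function_field F) \<and> V \<subseteq> global_sections F Y \<and>
     L = {Y' \<in> complete_linear_system F Y. \<exists>f \<in> V - {\<zero>\<^bsub>function_field F\<^esub>}. differ_by_div F Y f Y'}"

definition linear_system ::
    "'k::field poly3 \<Rightarrow> nat \<Rightarrow> 'k poly3 fract set set \<Rightarrow> 'k poly3 set set \<Rightarrow> bool" where
  "linear_system F \<alpha> V L \<longleftrightarrow>
     (\<exists>Y. group_of_points F Y \<and> has_degree Y \<alpha> \<and> linear_subsystem F Y V L)"

definition complete_linear_system_of_degree ::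
    "'k::field poly3 \<Rightarrow> nat \<Rightarrow> 'k poly3 fract set set \<Rightarrow> 'k poly3 set set \<Rightarrow> bool" where
  "complete_linear_system_of_degree F \<alpha> V L \<longleftrightarrow>
     (\<exists>Y. group_of_points F Y \<and> has_degree Y \<alpha> \<and>
          V = global_sections F Y \<and> L = complete_linear_system F Y)"

text \<open>The projective dimension \<open>dim V - 1\<close> of the linear system cut out by \<open>V\<close>; the relation
  includes the assertion that \<open>V\<close> is finite-dimensional.\<close>

definition linear_system_dim :: "'k::field poly3 \<Rightarrow> 'k poly3 fract set set \<Rightarrow> int \<Rightarrow> bool" where
  "linear_system_dim F V n \<longleftrightarrow>
     (\<exists>m. ring.dimension (function_field F) m (constants F) V \<and> n = int m - 1)"

definition max_dim :: "nat \<Rightarrow> nat \<Rightarrow> int" where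
  "max_dim s r =
     (if r \<le> s + 1 then int s * (int s + 3) div 2 - int r
      else (int s - 1) * (int s + 2) div 2)"

definition residual_in_section ::
    "'k::field poly3 \<Rightarrow> nat \<Rightarrow> nat \<Rightarrow> 'k poly3 set \<Rightarrow> bool" where
  "residual_in_section F s r Y \<longleftrightarrow>
     (\<exists>G Y''. cutting_curve F s G \<and> group_of_points F Y'' \<and> has_degree Y'' r \<and>
              residual Y Y'' (curve_intersection F G))"

definition contains_section :: "'k::field poly3 \<Rightarrow> nat \<Rightarrow> 'k poly3 set \<Rightarrow> bool" where
  "contains_section F t Y \<longleftrightarrow> (\<exists>G. cutting_curve F t G \<and> Y \<subseteq> curve_intersection F G)"

end

theory Submission
  imports Defs
begin

text \<open>
  Let \<open>S = R/(F)\<close> and let \<open>H n\<close> be the dimension of the degree \<open>n\<close> part of \<open>I/(F)\<close>, where \<open>I\<close> is the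
  ideal of a group of points \<open>Y\<close> of degree \<open>\<alpha>\<close>. Linkage by a form \<open>h\<close> of degree \<open>m\<close> in \<open>I\<close> identifies the
  sections of \<open>O(Y)\<close> with the quotients \<open>g/h\<close>, \<open>g\<close> in the degree \<open>m\<close> part of \<open>((F, h) : I)/(F)\<close>, and
  the Riemann-Roch theorem \<open>h\<^sup>0(O(Y)) = \<alpha> + 1 - p + H (d - 3)\<close> follows from an elementary duality
  inequality applied to \<open>I\<close> and to \<open>(F, h) : I\<close>.

  Let \<open>x, y\<close> be general linear forms. The difference \<open>H n - H (n - 1)\<close> is nondecreasing with limit \<open>d\<close>,
  and once it is positive it increases strictly until it reaches \<open>d\<close>: if it does not
  increase at \<open>n\<close>, the \<open>k[x, y]\<close>-submodule of \<open>S\<close> generated by the degree \<open>n - 1\<close> part of \<open>I/(F)\<close> is stable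
  under \<open>S\<close>, hence has rank \<open>d\<close>, because \<open>S\<close> is a domain. The bound is then a count of lattice points,
  and a group of points attaining it either lies on a curve of degree \<open>s\<close> or has all its sections
  divisible by one fixed section of degree \<open>1 - s\<close>.
\<close>

section \<open>Dimensions modulo a subspace\<close>

text \<open>The curve may be singular, so divisors and differentials give way to graded algebra on
  saturated ideals. The number d - 3 enters through the socle degree d + 2N - 3: pairing I in degree
  i with the linked ideal in degree d - 3 + m - i gives one inequality, and exchanging the two
  ideals gives the opposite one as soon as their degrees are known to be complementary. That
  complementarity is the obstacle. It is proved by counting only for an h that generates I along its
  support, since then I and (F, h) : I have no common zero; it passes to any other form of I by
  multiplication with h. The two branches of r(\<alpha>) come from the size of H (d - 2) - H (d -
  3). If it is at least d - s, the differences climb to d within s steps, and comparison with the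
  limit leaves at most s(s+1)/2 sections. If it is smaller, the differences descend to 0 before
  degree s, H (d - 3) is bounded by a triangular number, and at most (s+1)(s+2)/2 - r sections
  remain. The larger count is the bound; equality forces a section of degree 1 - s in the first case
  and H s > 0 in the second.\<close>

locale lin_space = vector_space scale
  for scale :: "'a::field \<Rightarrow> 'b::ab_group_add \<Rightarrow> 'b"
begin

text \<open>The ambient polynomial ring is infinite-dimensional, while \<open>dim\<close> is always
  a natural number; finiteness is therefore carried by each subset, as containment in the span of a
  finite set.\<close>

definition fin_dim :: "'b set \<Rightarrow> bool" where
  "fin_dim V \<longleftrightarrow> (\<exists>B. finite B \<and> V \<subseteq> span B)"

lemma fin_dim_subset: "fin_dim W \<Longrightarrow> V \<subseteq> W \<Longrightarrow> fin_dim V"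
  unfolding fin_dim_def by blast

lemma fin_dim_basis:
  assumes "fin_dim V" "independent A" "A \<subseteq> V"
  shows "finite A"
proof -
  obtain B where B: "finite B" "V \<subseteq> span B" using assms(1) unfolding fin_dim_def by blast
  then show ?thesis using independent_span_bound[of B A] assms by auto
qed

lemma dim_mono_fin_dim:
  assumes "fin_dim W" "V \<subseteq> W"
  shows "dim V \<le> dim W"
proof -
  obtain B where B: "B \<subseteq> W" "independent B" "W \<subseteq> span B" "card B = dim W"
    using basis_exists by blast
  have "finite B" using fin_dim_basis[OF assms(1) B(2,1)] .
  then show ?thesis using dim_le_card[of V B] B assms(2) by auto
qed

lemma subspace_eq_of_dim_le:
  assumes "subspace V" "fin_dim W" "V \<subseteq> W" "dim W \<le> dim V"
  shows "V = W"
proof (rule ccontr)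
  assume "V \<noteq> W"
  then obtain w where w: "w \<in> W" "w \<notin> V" using assms(3) by blast
  obtain B where B: "B \<subseteq> V" "independent B" "V \<subseteq> span B" "card B = dim V"
    using basis_exists by blast
  have sB: "span B = V" using B assms(1) span_minimal by blast
  have ind: "independent (insert w B)" using B w sB by (simp add: independent_insertI)
  have sub: "insert w B \<subseteq> W" using B w assms(3) by auto
  have fin: "finite (insert w B)" using fin_dim_basis[OF assms(2) ind sub] .
  have "card (insert w B) = dim (insert w B)" using dim_eq_card_independent[OF ind] by simp
  also have "\<dots> \<le> dim W" by (rule dim_mono_fin_dim[OF assms(2) sub])
  finally have "card (insert w B) \<le> card B" using assms(4) B(4) by simp
  moreover have "w \<notin> B" using w(2) B(1) by blast
  ultimately show False using fin by simp
qed

lemma fin_dim_image: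
  assumes "Vector_Spaces.linear scale scale f" "fin_dim V"
  shows "fin_dim (f ` V)"
proof -
  interpret l: Vector_Spaces.linear scale scale f by fact
  obtain B where "finite B" "V \<subseteq> span B" using assms(2) unfolding fin_dim_def by blast
  then have "finite (f ` B)" "f ` V \<subseteq> span (f ` B)" using l.span_image[of B] by auto
  then show ?thesis unfolding fin_dim_def by blast
qed

text \<open>A basis of the kernel inside V is extended to a basis of V; f is injective on the span
  of the added vectors, so their images form a basis of the image of V.\<close>

lemma rank_nullity:
  assumes lin: "Vector_Spaces.linear scale scale f" and V: "subspace V" "fin_dim V"
  shows "dim V = dim (f ` V) + dim {v \<in> V. f v = 0}"
proof -
  interpret l: Vector_Spaces.linear scale scale f by fact
  let ?K = "{v \<in> V. f v = 0}"
  have K: "subspace ?K" using V(1) unfolding subspace_def by (auto simp: l.add l.scale)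
  obtain A where A: "A \<subseteq> ?K" "independent A" "?K \<subseteq> span A" "card A = dim ?K"
    using basis_exists by blast
  obtain B where B: "A \<subseteq> B" "B \<subseteq> V" "independent B" "V \<subseteq> span B"
    using maximal_independent_subset_extend[of A V] A by blast
  have finB: "finite B" using fin_dim_basis[OF V(2) B(3,2)] .
  have spB: "span B = V" using B V(1) span_minimal by blast
  have spA: "span A = ?K" using A K span_minimal by blast
  have inj: "v = 0" if "v \<in> span (B - A)" "f v = 0" for v
  proof -
    have "v \<in> V" using that(1) spB span_mono[of "B - A" B] by blast
    then have "v \<in> span A" using that spA by blast
    moreover have "span A \<inter> span (B - A) = {0}"
    proof -
      have "independent (A \<union> (B - A))" using B by (simp add: Un_absorb1)
      have "x = 0" if x: "x \<in> span A" "x \<in> span (B - A)" for x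
      proof -
        have r1: "representation B x = representation A x"
          using representation_extend[OF B(3) x(1) B(1)] .
        have r2: "representation B x = representation (B - A) x"
          using representation_extend[OF B(3) x(2)] by blast
        have "representation B x b = 0" for b
          using representation_ne_zero[of A x b] representation_ne_zero[of "B - A" x b] r1 r2
          by (metis DiffD2)
        moreover have "x \<in> span B" using x(1) span_mono[OF B(1)] by blast
        ultimately show ?thesis using sum_representation_eq[OF B(3) \<open>x \<in> span B\<close> finB]
          by (metis (no_types, lifting) order_refl scale_zero_left sum.neutral)
      qed
      then show ?thesis by (auto simp: span_zero)
    qed
    ultimately show ?thesis using that(1) by blast
  qed
  have injon: "inj_on f (span (B - A))"
    using l.inj_on_iff_eq_0[OF subspace_span] inj by blast
  have ind: "independent (f ` (B - A))"
    using l.independent_inj_on_image[OF _ injon] independent_mono[OF B(3)] by blast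
  have sp: "f ` V \<subseteq> span (f ` (B - A))"
  proof -
    have "f ` B \<subseteq> insert 0 (f ` (B - A))" using A(1) by auto
    then have "span (f ` B) \<subseteq> span (f ` (B - A))"
      by (metis span_insert_0 span_mono)
    then show ?thesis using l.span_image[of B] spB by auto
  qed
  have "dim (f ` V) = card (f ` (B - A))"
    by (rule dim_unique[OF _ sp ind refl]) (use B in auto)
  also have "\<dots> = card (B - A)"
    by (rule card_image) (meson inj_on_subset injon span_superset)
  also have "\<dots> = card B - card A" using finB B(1) by (simp add: card_Diff_subset finite_subset)
  finally have "dim (f ` V) = card B - card A" .
  moreover have "card B = dim V" using B basis_card_eq_dim by blast
  moreover have "card A \<le> card B" using finB B(1) card_mono by blast
  ultimately show ?thesis using A by simp
qed

text \<open>Extend a basis of P to the whole space, kill the vectors in P and fix the others. The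
  image of this endomorphism models the quotient by P inside the same type, so quotient dimensions
  need no new carrier.\<close>

lemma exists_projection:
  assumes P: "subspace P"
  shows "\<exists>p. Vector_Spaces.linear scale scale p \<and> (\<forall>v. v - p v \<in> P) \<and> (\<forall>v\<in>P. p v = 0)"
proof -
  interpret vp: vector_space_pair scale scale by unfold_locales
  obtain C where C: "C \<subseteq> P" "independent C" "P \<subseteq> span C" "card C = dim P"
    using basis_exists by blast
  have spC: "span C = P" using C P span_minimal by blast
  define E where "E = extend_basis C"
  have E: "independent E" "span E = UNIV" "C \<subseteq> E"
    using C(2) independent_extend_basis extend_basis_superset by (auto simp: E_def)
  define p where "p = vp.construct E (\<lambda>b. if b \<in> C then 0 else b)"
  have lin: "Vector_Spaces.linear scale scale p"
    unfolding p_def by (rule vp.linear_construct[OF E(1)])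
  interpret l: Vector_Spaces.linear scale scale p by (rule lin)
  have pb: "p b = (if b \<in> C then 0 else b)" if "b \<in> E" for b
    unfolding p_def using vp.construct_basis[OF E(1) that] by simp
  have zero: "p v = 0" if "v \<in> P" for v
  proof -
    have "v \<in> span C" using that spC by simp
    then show ?thesis by (rule l.eq_0_on_span[rotated]) (use pb E in auto)
  qed
  have sub: "subspace {v. v - p v \<in> P}"
    using P unfolding subspace_def
    by (auto simp: l.add l.scale) (metis add_diff_add, metis scale_right_diff_distrib)
  have "span E \<subseteq> {v. v - p v \<in> P}"
    by (rule span_minimal[OF _ sub]) (use pb C(1) subspace_0[OF P] in auto)
  then have "v - p v \<in> P" for v using E(2) by auto
  then show ?thesis using lin zero by blast
qed

definition proj :: "'b set \<Rightarrow> 'b \<Rightarrow> 'b" where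
  "proj P = (SOME p. Vector_Spaces.linear scale scale p \<and> (\<forall>v. v - p v \<in> P) \<and> (\<forall>v\<in>P. p v = 0))"

lemma
  assumes P: "subspace P"
  shows linear_proj: "Vector_Spaces.linear scale scale (proj P)"
    and diff_proj: "v - proj P v \<in> P"
    and proj_eq_iff: "proj P v = proj P w \<longleftrightarrow> v - w \<in> P"
proof -
  have *: "Vector_Spaces.linear scale scale (proj P) \<and> (\<forall>v. v - proj P v \<in> P) \<and> (\<forall>v\<in>P. proj P v = 0)"
    unfolding proj_def by (rule someI_ex[OF exists_projection[OF P]])
  then show "Vector_Spaces.linear scale scale (proj P)" and d: "v - proj P v \<in> P" for v by blast+
  interpret l: Vector_Spaces.linear scale scale "proj P" using * by blast
  show "proj P v = proj P w \<longleftrightarrow> v - w \<in> P"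
  proof
    assume eq: "proj P v = proj P w"
    have "v - w = (v - proj P v) - (w - proj P w)" using eq by simp
    then show "v - w \<in> P" using d subspace_diff[OF P] by metis
  next
    assume "v - w \<in> P"
    then have "proj P (v - w) = 0" using * by blast
    then show "proj P v = proj P w" by (simp add: l.diff)
  qed
qed

text \<open>The dimension of the image of \<open>V\<close> in the quotient by \<open>P\<close>.\<close>

definition qdim :: "'b set \<Rightarrow> 'b set \<Rightarrow> nat" where
  "qdim P V = dim (proj P ` V)"

lemma dim_eq_qdim:
  assumes "subspace P" "subspace V" "fin_dim V"
  shows "dim V = qdim P V + dim (V \<inter> P)"
proof -
  interpret l: Vector_Spaces.linear scale scale "proj P" by (rule linear_proj[OF assms(1)])
  have "proj P v = 0 \<longleftrightarrow> v \<in> P" for v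
    using proj_eq_iff[OF assms(1), of v 0] l.zero by simp
  then have "{v \<in> V. proj P v = 0} = V \<inter> P" by auto
  then show ?thesis
    unfolding qdim_def using rank_nullity[OF linear_proj[OF assms(1)] assms(2,3)] by simp
qed

lemma proj_image_mono:
  assumes "subspace P" "\<And>v. v \<in> V \<Longrightarrow> \<exists>w\<in>W. v - w \<in> P"
  shows "proj P ` V \<subseteq> proj P ` W"
proof
  fix y assume "y \<in> proj P ` V"
  then obtain v where v: "v \<in> V" "y = proj P v" by blast
  then obtain w where "w \<in> W" "v - w \<in> P" using assms(2) by blast
  then show "y \<in> proj P ` W" using v proj_eq_iff[OF assms(1), of v w] by blast
qed

lemma qdim_mono:
  assumes "subspace P" "fin_dim W" "\<And>v. v \<in> V \<Longrightarrow> \<exists>w\<in>W. v - w \<in> P"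
  shows "qdim P V \<le> qdim P W"
  unfolding qdim_def
  using dim_mono_fin_dim[OF fin_dim_image[OF linear_proj[OF assms(1)] assms(2)]]
    proj_image_mono[of P V W] assms by blast

lemma qdim_cong:
  assumes "subspace P" "\<And>v. v \<in> V \<Longrightarrow> \<exists>w\<in>W. v - w \<in> P" "\<And>w. w \<in> W \<Longrightarrow> \<exists>v\<in>V. w - v \<in> P"
  shows "qdim P V = qdim P W"
  proof -
  have "proj P ` V = proj P ` W"
    using proj_image_mono[OF assms(1,2)] proj_image_mono[OF assms(1,3)] by (rule subset_antisym)
  then show ?thesis unfolding qdim_def by simp
qed

lemma subspace_proj_image: "subspace P \<Longrightarrow> subspace V \<Longrightarrow> subspace (proj P ` V)"
  using linear_proj[of P] module_hom.subspace_image[of scale scale "proj P" V]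
  by (simp add: Vector_Spaces.linear_def)

lemma qdim_eq_imp:
  assumes P: "subspace P" and V: "subspace V" and W: "fin_dim W"
    and sub: "\<And>v. v \<in> V \<Longrightarrow> \<exists>w\<in>W. v - w \<in> P" and le: "qdim P W \<le> qdim P V" and w: "w \<in> W"
  shows "\<exists>v\<in>V. w - v \<in> P"
proof -
  have "proj P ` V = proj P ` W"
    using subspace_eq_of_dim_le[OF subspace_proj_image[OF P V] fin_dim_image[OF linear_proj[OF P] W]
        proj_image_mono[OF P sub]] le unfolding qdim_def by auto
  then obtain v where "v \<in> V" "proj P w = proj P v" using w by blast
  then show ?thesis using proj_eq_iff[OF P] by blast
qed

lemma fin_dim_sums:
  assumes "fin_dim A" "fin_dim B"
  shows "fin_dim {a + b |a b. a \<in> A \<and> b \<in> B}"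
proof -
  obtain S T where "finite S" "A \<subseteq> span S" "finite T" "B \<subseteq> span T"
    using assms unfolding fin_dim_def by blast
  moreover from this have "{a + b |a b. a \<in> A \<and> b \<in> B} \<subseteq> span (S \<union> T)"
    using span_mono[of S "S \<union> T"] span_mono[of T "S \<union> T"] by (auto intro!: span_add)
  ultimately show ?thesis unfolding fin_dim_def by (meson finite_UnI)
qed

lemma dim_sums:
  assumes A: "subspace A" "fin_dim A" and B: "subspace B" "fin_dim B"
  shows "dim {a + b |a b. a \<in> A \<and> b \<in> B} + dim (A \<inter> B) = dim A + dim B"
proof -
  let ?S = "{a + b |a b. a \<in> A \<and> b \<in> B}"
  have "B \<subseteq> ?S" using subspace_0[OF A(1)] by force
  then have "dim ?S = qdim B ?S + dim B"
    using dim_eq_qdim[OF B(1) subspace_sums[OF A(1) B(1)] fin_dim_sums[OF A(2) B(2)]]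
    by (simp add: Int_absorb1)
  moreover have "qdim B ?S = qdim B A"
  proof (rule qdim_cong[OF B(1)])
    show "\<exists>w\<in>A. v - w \<in> B" if v: "v \<in> ?S" for v
    proof -
      obtain a b where "v = a + b" "a \<in> A" "b \<in> B" using v by blast
      then show ?thesis by (intro bexI[of _ a]) simp_all
    qed
    show "\<exists>v\<in>?S. w - v \<in> B" if "w \<in> A" for w
      using that subspace_0[OF B(1)] by (intro bexI[of _ w]) force+
  qed
  ultimately show ?thesis using dim_eq_qdim[OF B(1) A] by simp
qed

lemma proj_image_sums:
  assumes P: "subspace P"
  shows "proj P ` {a + b |a b. a \<in> A \<and> b \<in> B} = {a + b |a b. a \<in> proj P ` A \<and> b \<in> proj P ` B}"
    (is "?L = ?R")
proof -
  interpret l: Vector_Spaces.linear scale scale "proj P" by (rule linear_proj[OF P])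
  have "y \<in> ?R" if "y \<in> ?L" for y
  proof -
    obtain a b where "y = proj P (a + b)" "a \<in> A" "b \<in> B" using \<open>y \<in> ?L\<close> by blast
    then show ?thesis using l.add[of a b] by blast
  qed
  moreover have "y \<in> ?L" if "y \<in> ?R" for y
  proof -
    obtain a b where "y = proj P a + proj P b" "a \<in> A" "b \<in> B" using \<open>y \<in> ?R\<close> by blast
    then show ?thesis using l.add[of a b, symmetric] by blast
  qed
  ultimately show ?thesis by blast
qed

text \<open>The dimension formula for a sum, applied to the images in the quotient by P. The
  hypotheses say that C represents the intersection of these images, which can be larger than the
  image of the intersection of A and B.\<close>

lemma qdim_sums:
  assumes P: "subspace P" and A: "subspace A" "fin_dim A" and B: "subspace B" "fin_dim B"
    and C1: "\<And>a b. a \<in> A \<Longrightarrow> b \<in> B \<Longrightarrow> a - b \<in> P \<Longrightarrow> \<exists>c\<in>C. a - c \<in> P"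
    and C2: "\<And>c. c \<in> C \<Longrightarrow> \<exists>a\<in>A. c - a \<in> P" "\<And>c. c \<in> C \<Longrightarrow> \<exists>b\<in>B. c - b \<in> P"
  shows "qdim P {a + b |a b. a \<in> A \<and> b \<in> B} + qdim P C = qdim P A + qdim P B"
proof -
  interpret l: Vector_Spaces.linear scale scale "proj P" by (rule linear_proj[OF P])
  have "proj P ` {a + b |a b. a \<in> A \<and> b \<in> B} = {a + b |a b. a \<in> proj P ` A \<and> b \<in> proj P ` B}"
    by (rule proj_image_sums[OF P])
  moreover have "proj P ` C = proj P ` A \<inter> proj P ` B"
  proof (intro equalityI subsetI)
    fix y assume "y \<in> proj P ` C"
    then show "y \<in> proj P ` A \<inter> proj P ` B"
      using proj_image_mono[OF P, of C A] proj_image_mono[OF P, of C B] C2 by blast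
  next
    fix y assume "y \<in> proj P ` A \<inter> proj P ` B"
    then obtain a b where ab: "a \<in> A" "b \<in> B" "y = proj P a" "y = proj P b" by blast
    then have "a - b \<in> P" using proj_eq_iff[OF P] by metis
    then obtain c where "c \<in> C" "a - c \<in> P" using C1 ab by blast
    then show "y \<in> proj P ` C" using ab proj_eq_iff[OF P] by blast
  qed
  ultimately show ?thesis
    unfolding qdim_def
    using dim_sums[OF subspace_proj_image[OF P A(1)] fin_dim_image[OF linear_proj[OF P] A(2)]
      subspace_proj_image[OF P B(1)] fin_dim_image[OF linear_proj[OF P] B(2)]] by simp
qed

text \<open>Since f v lies in P exactly when v does, f induces an injective map on the quotient by
  P. It will be multiplication by a nonzerodivisor.\<close>

lemma qdim_inj_image:
  assumes P: "subspace P" and lin: "Vector_Spaces.linear scale scale f"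
    and V: "subspace V" "fin_dim V" and f: "\<And>v. f v \<in> P \<longleftrightarrow> v \<in> P"
  shows "qdim P (f ` V) = qdim P V"
proof -
  interpret l: Vector_Spaces.linear scale scale f by fact
  interpret p: Vector_Spaces.linear scale scale "proj P" by (rule linear_proj[OF P])
  have ling: "Vector_Spaces.linear scale scale (proj P \<circ> f)"
    using Vector_Spaces.linear_compose[OF lin linear_proj[OF P]] .
  have 1: "proj P (f v) = proj P (f (proj P v))" for v
  proof -
    have "f (v - proj P v) \<in> P" using f diff_proj[OF P] by blast
    then show ?thesis using proj_eq_iff[OF P] by (simp add: l.diff)
  qed
  have 3: "proj P ` f ` V = (proj P \<circ> f) ` (proj P ` V)"
    using 1 by (auto simp: image_iff)
  have 4: "{v \<in> proj P ` V. (proj P \<circ> f) v = 0} \<subseteq> {0}"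
  proof
    fix y assume "y \<in> {v \<in> proj P ` V. (proj P \<circ> f) v = 0}"
    then obtain v where v: "y = proj P v" "proj P (f y) = 0" by auto
    then have "f y \<in> P" using proj_eq_iff[OF P, of "f y" 0] by (simp add: p.zero)
    then have "y \<in> P" using f by blast
    then have "v \<in> P" using v diff_proj[OF P, of v] subspace_add[OF P] by fastforce
    then show "y \<in> {0}" using v proj_eq_iff[OF P, of v 0] by (simp add: p.zero)
  qed
  then have "dim {v \<in> proj P ` V. (proj P \<circ> f) v = 0} = 0"
    using dim_le_card[of "{v \<in> proj P ` V. (proj P \<circ> f) v = 0}" "{}"] by auto
  then show ?thesis
    unfolding qdim_def 3
    using rank_nullity[OF ling subspace_proj_image[OF P V(1)] fin_dim_image[OF linear_proj[OF P] V(2)]]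
    by simp
qed

text \<open>A is the sum of the kernel of l and the line through one a0 with l a0 nonzero, and this
  persists for the images modulo P, whether or not l factors through the quotient.\<close>

lemma qdim_kernel:
  assumes P: "subspace P" and A: "subspace A" "fin_dim A"
    and l: "\<And>a b. a \<in> A \<Longrightarrow> b \<in> A \<Longrightarrow> l (a + b) = l a + l b" "\<And>c a. a \<in> A \<Longrightarrow> l (scale c a) = c * l a"
  shows "qdim P A \<le> qdim P {a \<in> A. l a = (0::'a)} + 1"
proof (cases "\<exists>a\<in>A. l a \<noteq> 0")
  case False
  then have "{a \<in> A. l a = 0} = A" by auto
  then show ?thesis by simp
next
  case True
  then obtain a0 where a0: "a0 \<in> A" "l a0 \<noteq> 0" by blast
  let ?K = "{a \<in> A. l a = 0}"
  have K: "subspace ?K"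
    using A(1) unfolding subspace_def by (auto simp: l) (metis l(2) mult_zero_left scale_zero_left)
  have KA: "fin_dim ?K" by (rule fin_dim_subset[OF A(2)]) auto
  have fs: "fin_dim (span {a0})" unfolding fin_dim_def by blast
  have "qdim P A \<le> qdim P {a + b |a b. a \<in> ?K \<and> b \<in> span {a0}}"
  proof (rule qdim_mono[OF P fin_dim_sums[OF KA fs]])
    fix v assume v: "v \<in> A"
    let ?c = "l v / l a0"
    let ?u = "v + scale (- ?c) a0"
    have m: "scale (- ?c) a0 \<in> A" using a0 subspace_scale[OF A(1)] by blast
    have "l ?u = 0" using l(1)[OF v m] l(2)[OF a0(1), of "- ?c"] a0 by simp
    moreover have "?u \<in> A" using m v subspace_add[OF A(1)] by blast
    ultimately have "v \<in> {a + b |a b. a \<in> ?K \<and> b \<in> span {a0}}"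
      by (intro CollectI exI[of _ ?u] exI[of _ "scale ?c a0"]) (auto intro: span_scale span_base)
    then show "\<exists>w\<in>{a + b |a b. a \<in> ?K \<and> b \<in> span {a0}}. v - w \<in> P"
      using subspace_0[OF P] by (intro bexI[of _ v]) auto
  qed
  also have "\<dots> \<le> dim (proj P ` ?K) + dim (proj P ` span {a0})"
  proof -
    have "dim (proj P ` {a + b |a b. a \<in> ?K \<and> b \<in> span {a0}})
        = dim {a + b |a b. a \<in> proj P ` ?K \<and> b \<in> proj P ` span {a0}}"
    proof -
      interpret l: Vector_Spaces.linear scale scale "proj P" by (rule linear_proj[OF P])
      have "proj P ` {a + b |a b. a \<in> ?K \<and> b \<in> span {a0}}
        = {a + b |a b. a \<in> proj P ` ?K \<and> b \<in> proj P ` span {a0}}"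
        by (rule proj_image_sums[OF P])
      then show ?thesis by simp
    qed
    then show ?thesis unfolding qdim_def
      using dim_sums[OF subspace_proj_image[OF P K] fin_dim_image[OF linear_proj[OF P] KA]
      subspace_proj_image[OF P subspace_span] fin_dim_image[OF linear_proj[OF P] fs]] by simp
  qed
  also have "dim (proj P ` span {a0}) \<le> 1"
  proof -
    interpret l: Vector_Spaces.linear scale scale "proj P" by (rule linear_proj[OF P])
    show ?thesis using dim_le_card[of "proj P ` span {a0}" "{proj P a0}"] l.span_image[of "{a0}"] by auto
  qed
  finally show ?thesis unfolding qdim_def by simp
qed

lemma qdim_kernel_finite:
  assumes P: "subspace P" and A: "subspace A" "fin_dim A" and T: "finite T"
    and l: "\<And>a b t. t \<in> T \<Longrightarrow> a \<in> A \<Longrightarrow> b \<in> A \<Longrightarrow> l (a + b) t = l a t + l b t"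
      "\<And>c a t. t \<in> T \<Longrightarrow> a \<in> A \<Longrightarrow> l (scale c a) t = c * l a t"
  shows "qdim P A \<le> qdim P {a \<in> A. \<forall>t\<in>T. l a t = (0::'a)} + card T"
  using T l
proof (induction T rule: finite_induct)
  case empty
  then show ?case by simp
next
  case (insert t T)
  let ?K = "{a \<in> A. \<forall>t\<in>T. l a t = (0::'a)}"
  have ll: "\<And>a b s. s \<in> T \<Longrightarrow> a \<in> A \<Longrightarrow> b \<in> A \<Longrightarrow> l (a + b) s = l a s + l b s"
      "\<And>c a s. s \<in> T \<Longrightarrow> a \<in> A \<Longrightarrow> l (scale c a) s = c * l a s"
    using insert.prems by blast+
  have K: "subspace ?K"
    using A(1) unfolding subspace_def
    by (auto simp: ll) (metis ll(2) mult_zero_left scale_zero_left)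
  have KA: "fin_dim ?K" by (rule fin_dim_subset[OF A(2)]) auto
  have "qdim P A \<le> qdim P ?K + card T" using insert.IH ll by blast
  also have "qdim P ?K \<le> qdim P {a \<in> ?K. l a t = 0} + 1"
    by (rule qdim_kernel[OF P K KA]) (use insert.prems in auto)
  also have "{a \<in> ?K. l a t = 0} = {a \<in> A. \<forall>t\<in>insert t T. l a t = 0}" by auto
  finally show ?case using insert.hyps by simp
qed

text \<open>T lifts a basis of a complement of the image of U in the image of W; these finitely many
  vectors are the ones against which a pairing on W modulo U has to be tested.\<close>

lemma exists_complement_mod:
  assumes P: "subspace P" and U: "subspace U" and W: "subspace W" "fin_dim W" and UW: "U \<subseteq> W"
  shows "\<exists>T. finite T \<and> T \<subseteq> W \<and> card T + qdim P U = qdim P W \<and>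
      (\<forall>w\<in>W. \<exists>t\<in>span T. \<exists>u\<in>U. w - (t + u) \<in> P)"
proof -
  interpret l: Vector_Spaces.linear scale scale "proj P" by (rule linear_proj[OF P])
  obtain A where A: "A \<subseteq> proj P ` U" "independent A" "proj P ` U \<subseteq> span A" "card A = dim (proj P ` U)"
    using basis_exists by blast
  obtain B where B: "A \<subseteq> B" "B \<subseteq> proj P ` W" "independent B" "proj P ` W \<subseteq> span B"
    using maximal_independent_subset_extend[of A "proj P ` W"] A UW by blast
  have finB: "finite B" using fin_dim_basis[OF fin_dim_image[OF linear_proj[OF P] W(2)] B(3,2)] .
  obtain T where T: "T \<subseteq> W" "inj_on (proj P) T" "proj P ` T = B - A"
    using B(2) subset_image_inj[of "B - A" "proj P" W] by blast
  have cT: "card T = card (B - A)" using T card_image by metis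
  have finT: "finite T" using T finB by (metis finite_Diff finite_imageD)
  have "card (B - A) = card B - card A" using finB B(1) by (simp add: card_Diff_subset finite_subset)
  moreover have "card B = dim (proj P ` W)" using B basis_card_eq_dim by blast
  moreover have "card A \<le> card B" using finB B(1) card_mono by blast
  ultimately have "card T + qdim P U = qdim P W" using A(4) cT unfolding qdim_def by linarith
  moreover have "\<exists>t\<in>span T. \<exists>u\<in>U. w - (t + u) \<in> P" if w: "w \<in> W" for w
  proof -
    have "proj P w \<in> span ((B - A) \<union> A)" using B w by (metis Diff_partition Un_commute image_subset_iff subsetD)
    then obtain x y where xy: "x \<in> span (B - A)" "y \<in> span A" "proj P w = x + y"
      unfolding span_Un by blast
    have "x \<in> proj P ` span T" using xy(1) T(3) l.span_image[of T] by simp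
    then obtain t where t: "t \<in> span T" "x = proj P t" by blast
    have "y \<in> proj P ` U"
      using xy span_minimal[OF A(1) subspace_proj_image[OF P U]] by blast
    then obtain u where u: "u \<in> U" "y = proj P u" by blast
    have "proj P w = proj P (t + u)" using xy t u by (simp add: l.add)
    then show ?thesis using proj_eq_iff[OF P] t u by blast
  qed
  ultimately show ?thesis using finT T by blast
qed

text \<open>The pairing embeds A modulo P into the dual of W modulo U and P: an element of A
  orthogonal to the lifted complement T is orthogonal to all of W, hence lies in P, and each vector
  of T costs at most one dimension.\<close>

lemma qdim_le_of_pairing:
  assumes P: "subspace P" and A: "subspace A" "fin_dim A"
    and W: "subspace W" "fin_dim W" and U: "subspace U" "U \<subseteq> W"
    and b1: "\<And>a b w. w \<in> W \<Longrightarrow> a \<in> A \<Longrightarrow> b \<in> A \<Longrightarrow> \<beta> (a + b) w = \<beta> a w + \<beta> b w"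
      "\<And>c a w. w \<in> W \<Longrightarrow> a \<in> A \<Longrightarrow> \<beta> (scale c a) w = c * \<beta> a w"
    and b2: "\<And>a w v. w \<in> W \<Longrightarrow> v \<in> W \<Longrightarrow> a \<in> A \<Longrightarrow> \<beta> a (w + v) = \<beta> a w + \<beta> a v"
      "\<And>c a w. w \<in> W \<Longrightarrow> a \<in> A \<Longrightarrow> \<beta> a (scale c w) = c * \<beta> a w"
    and b0: "\<And>a u. a \<in> A \<Longrightarrow> u \<in> U \<Longrightarrow> \<beta> a u = 0" "\<And>a w. a \<in> A \<Longrightarrow> w \<in> W \<Longrightarrow> w \<in> P \<Longrightarrow> \<beta> a w = 0"
    and nd: "\<And>a. a \<in> A \<Longrightarrow> (\<And>w. w \<in> W \<Longrightarrow> \<beta> a w = (0::'a)) \<Longrightarrow> a \<in> P"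
  shows "qdim P A + qdim P U \<le> qdim P W"
proof -
  obtain T where T: "finite T" "T \<subseteq> W" "card T + qdim P U = qdim P W"
      "\<forall>w\<in>W. \<exists>t\<in>span T. \<exists>u\<in>U. w - (t + u) \<in> P"
    using exists_complement_mod[OF P U(1) W U(2)] by blast
  have "qdim P A \<le> qdim P {a \<in> A. \<forall>t\<in>T. \<beta> a t = 0} + card T"
    by (rule qdim_kernel_finite[OF P A T(1)]) (use b1 T(2) in auto)
  also have "qdim P {a \<in> A. \<forall>t\<in>T. \<beta> a t = 0} = 0"
  proof -
    have "a \<in> P" if a: "a \<in> A" "\<forall>t\<in>T. \<beta> a t = 0" for a
    proof (rule nd[OF a(1)])
      fix w assume w: "w \<in> W"
      obtain t u where tu: "t \<in> span T" "u \<in> U" "w - (t + u) \<in> P" using T w by blast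
      have sub: "subspace {t \<in> W. \<beta> a t = 0}"
        using W(1) a unfolding subspace_def
        by (auto simp: b2) (metis b2(2) mult_zero_left scale_zero_left)
      have "span T \<subseteq> {t \<in> W. \<beta> a t = 0}" by (rule span_minimal[OF _ sub]) (use T a in auto)
      then have t: "t \<in> W" "\<beta> a t = 0" using tu by auto
      have u: "u \<in> W" "\<beta> a u = 0" using tu U b0(1)[OF a(1)] by auto
      have m: "t + u \<in> W" "w - (t + u) \<in> W" using t u w W(1) subspace_add subspace_diff by blast+
      have "\<beta> a w = \<beta> a ((t + u) + (w - (t + u)))" by simp
      also have "\<dots> = 0" using b2(1)[OF m(1) m(2) a(1)] b2(1)[OF t(1) u(1) a(1)] t u b0(2)[OF a(1) m(2) tu(3)] by simp
      finally show "\<beta> a w = 0" .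
    qed
    then have "qdim P {a \<in> A. \<forall>t\<in>T. \<beta> a t = 0} \<le> qdim P {}"
      unfolding qdim_def
    proof -
      interpret l: Vector_Spaces.linear scale scale "proj P" by (rule linear_proj[OF P])
      assume "\<And>a. a \<in> A \<Longrightarrow> \<forall>t\<in>T. \<beta> a t = 0 \<Longrightarrow> a \<in> P"
      then have "proj P ` {a \<in> A. \<forall>t\<in>T. \<beta> a t = 0} \<subseteq> span {}"
        using proj_eq_iff[OF P, of _ 0] l.zero by auto
      then show "dim (proj P ` {a \<in> A. \<forall>t\<in>T. \<beta> a t = 0}) \<le> dim (proj P ` {})"
        using dim_le_card[of _ "{}"] by fastforce
    qed
    also have "qdim P {} = 0" unfolding qdim_def using dim_le_card[of "{}" "{}"] by simp
    finally show ?thesis by simp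
  qed
  finally show ?thesis using T(3) by simp
qed

text \<open>These are n + 1 vectors in a space of dimension at most n. Repeated images in the
  quotient are treated separately, since \<open>dependent\<close> speaks of sets and does not see
  repetitions.\<close>

lemma exists_relation_mod:
  assumes P: "subspace P" and W: "fin_dim W" and w: "\<And>i. i \<le> n \<Longrightarrow> w i \<in> W" and n: "qdim P W \<le> n"
  shows "\<exists>c. (\<exists>i\<le>n. c i \<noteq> 0) \<and> (\<Sum>i\<le>n. scale (c i) (w i)) \<in> P"
proof -
  interpret l: Vector_Spaces.linear scale scale "proj P" by (rule linear_proj[OF P])
  have "\<exists>c. (\<exists>i\<le>n. c i \<noteq> 0) \<and> (\<Sum>i\<le>n. scale (c i) (proj P (w i))) = 0"
  proof (cases "inj_on (\<lambda>i. proj P (w i)) {..n}")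
    case False
    then obtain i j where ij: "i \<le> n" "j \<le> n" "i \<noteq> j" "proj P (w i) = proj P (w j)"
      unfolding inj_on_def by auto
    let ?c = "\<lambda>k. if k = i then 1 else if k = j then - 1 else (0::'a)"
    have "(\<Sum>k\<le>n. scale (?c k) (proj P (w k))) = (\<Sum>k\<in>{i, j}. scale (?c k) (proj P (w k)))"
      by (rule sum.mono_neutral_right) (use ij in auto)
    also have "\<dots> = 0" using ij by simp
    finally show ?thesis using ij by (intro exI[of _ ?c]) auto
  next
    case True
    let ?S = "(\<lambda>i. proj P (w i)) ` {..n}"
    have c: "card ?S = Suc n" using True card_image by fastforce
    have "dependent ?S"
    proof (rule ccontr)
      assume "independent ?S"
      then have "card ?S = dim ?S" using dim_eq_card_independent by simp
      also have "\<dots> \<le> dim (proj P ` W)"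
        by (rule dim_mono_fin_dim[OF fin_dim_image[OF linear_proj[OF P] W]]) (use w in auto)
      finally show False using n c unfolding qdim_def by simp
    qed
    then obtain u v where u: "(\<Sum>v\<in>?S. scale (u v) v) = 0" "v \<in> ?S" "u v \<noteq> 0"
      using dependent_finite[of ?S] by auto
    have "(\<Sum>i\<le>n. scale (u (proj P (w i))) (proj P (w i))) = 0"
      using u(1) sum.reindex[OF True, of "\<lambda>v. scale (u v) v"] by simp
    then show ?thesis using u by (intro exI[of _ "\<lambda>i. u (proj P (w i))"]) auto
  qed
  then obtain c where c: "\<exists>i\<le>n. c i \<noteq> 0" "(\<Sum>i\<le>n. scale (c i) (proj P (w i))) = 0" by blast
  have "proj P (\<Sum>i\<le>n. scale (c i) (w i)) = proj P 0" using c by (simp add: l.sum l.scale l.zero)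
  then show ?thesis using c proj_eq_iff[OF P, of _ 0] by auto
qed

end

section \<open>Forms in three variables\<close>

abbreviation cf :: "'k::field poly3 \<Rightarrow> nat \<Rightarrow> nat \<Rightarrow> nat \<Rightarrow> 'k" where
  "cf f i j l \<equiv> coeff (coeff (coeff f l) j) i"

lemma poly3_eqI: "(\<And>i j l. cf f i j l = cf g i j l) \<Longrightarrow> f = g"
  by (intro poly_eqI)

lemma cf_mult:
  "cf (f * g) i j l = (\<Sum>l'\<le>l. \<Sum>j'\<le>j. \<Sum>i'\<le>i. cf f i' j' l' * cf g (i - i') (j - j') (l - l'))"
  by (simp add: coeff_mult coeff_sum)

text \<open>Degrees are integers so that shifts such as n - d or d - 3 - k can be written without
  case distinctions; in negative degree only 0 remains.\<close>

definition gr :: "int \<Rightarrow> 'k::field poly3 set" where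
  "gr n = {f. \<forall>i j l. cf f i j l \<noteq> 0 \<longrightarrow> int (i + j + l) = n}"

lemma form_iff_gr: "form n f \<longleftrightarrow> f \<in> gr (int n)"
  unfolding form_def gr_def by (auto simp flip: of_nat_add)

lemma gr_0 [simp]: "0 \<in> gr n"
  by (simp add: gr_def)

lemma gr_add: "f \<in> gr n \<Longrightarrow> g \<in> gr n \<Longrightarrow> f + g \<in> gr n"
  unfolding gr_def by (auto) (metis add.left_neutral)

lemma gr_uminus: "f \<in> gr n \<Longrightarrow> - f \<in> gr n"
  unfolding gr_def by auto

lemma gr_diff: "f \<in> gr n \<Longrightarrow> g \<in> gr n \<Longrightarrow> f - g \<in> gr n"
  using gr_add[of f n "- g"] gr_uminus[of g n] by simp

lemma gr_sum: "(\<And>x. x \<in> A \<Longrightarrow> f x \<in> gr n) \<Longrightarrow> sum f A \<in> gr n"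
  by (induction A rule: infinite_finite_induct) (auto intro: gr_add)

lemma gr_mult:
  assumes "f \<in> gr a" "g \<in> gr b"
  shows "f * g \<in> gr (a + b)"
  unfolding gr_def
proof (intro CollectI allI impI)
  fix i j l assume "cf (f * g) i j l \<noteq> 0"
  then obtain l' where l': "l' \<le> l"
    "(\<Sum>j'\<le>j. \<Sum>i'\<le>i. cf f i' j' l' * cf g (i - i') (j - j') (l - l')) \<noteq> 0"
    unfolding cf_mult by (meson sum.neutral atMost_iff)
  then obtain j' where j': "j' \<le> j" "(\<Sum>i'\<le>i. cf f i' j' l' * cf g (i - i') (j - j') (l - l')) \<noteq> 0"
    by (meson sum.neutral atMost_iff)
  then obtain i' where i': "i' \<le> i" "cf f i' j' l' * cf g (i - i') (j - j') (l - l') \<noteq> 0"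
    by (meson sum.neutral atMost_iff)
  then have "cf f i' j' l' \<noteq> 0" "cf g (i - i') (j - j') (l - l') \<noteq> 0" by auto
  then have "int (i' + j' + l') = a" "int ((i - i') + (j - j') + (l - l')) = b"
    using assms unfolding gr_def by blast+
  then show "int (i + j + l) = a + b" using l' j' i' by linarith
qed

lemma gr_mult_eq: "f \<in> gr a \<Longrightarrow> g \<in> gr b \<Longrightarrow> n = a + b \<Longrightarrow> f * g \<in> gr n"
  using gr_mult by blast

lemma const3_gr: "const3 c \<in> gr 0"
  unfolding gr_def const3_def by (auto simp: coeff_pCons split: nat.splits if_splits)

lemma one_gr: "1 \<in> gr 0"
  using const3_gr[of 1] by (simp add: const3_def flip: one_pCons)

lemma gr_power: "f \<in> gr a \<Longrightarrow> f ^ n \<in> gr (int n * a)"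
  by (induction n) (auto simp: one_gr algebra_simps intro!: gr_mult_eq)

lemma gr_power_one: "f \<in> gr 1 \<Longrightarrow> f ^ n \<in> gr (int n)"
  using gr_power[of f 1 n] by simp

lemma gr_neg: "n < 0 \<Longrightarrow> gr n = {0}"
  by (auto simp: gr_def intro!: poly3_eqI)

definition sc :: "'k::field \<Rightarrow> 'k poly3 \<Rightarrow> 'k poly3" where
  "sc c f = const3 c * f"

lemma cf_sc [simp]: "cf (sc c f) i j l = c * cf f i j l"
  by (simp add: sc_def const3_def)

lemma sc_gr: "f \<in> gr n \<Longrightarrow> sc c f \<in> gr n"
  by (auto simp: gr_def)

interpretation lin3: lin_space sc
  by unfold_locales (auto intro!: poly3_eqI simp: algebra_simps)

lemma linear_sc_iff:
  "Vector_Spaces.linear sc sc f \<longleftrightarrow> (\<forall>u v. f (u + v) = f u + f v) \<and> (\<forall>c v. f (sc c v) = sc c (f v))"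
  unfolding Vector_Spaces.linear_iff using lin3.vector_space_axioms by blast

lemma linear_mult: "Vector_Spaces.linear sc sc ((*) a)"
  by (simp add: linear_sc_iff sc_def algebra_simps)

lemma subspace_gr: "lin3.subspace (gr n)"
  unfolding lin3.subspace_def by (auto intro: gr_add sc_gr)

subsection \<open>Homogeneous components\<close>

lemma exists_poly_coeff:
  assumes "\<And>n. coeff u n = 0 \<Longrightarrow> h n = 0"
  shows "\<exists>p. \<forall>n. coeff p n = h n"
proof -
  have "\<forall>\<^sub>\<infinity>n. h n = 0" using MOST_coeff_eq_0[of u] assms by (auto elim!: MOST_rev_mp)
  then show ?thesis using Abs_poly_inverse[of h] by (intro exI[of _ "Abs_poly h"]) simp
qed

lemma exists_poly3_filter: "\<exists>g. \<forall>i j l. cf g i j l = (if p i j l then cf f i j l else 0)"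
proof -
  have 1: "\<exists>v. \<forall>i. coeff v i = (if q i then coeff u i else 0)" for q and u :: "'a poly"
    by (rule exists_poly_coeff[of u]) simp
  have 2: "\<exists>v. \<forall>j i. coeff (coeff v j) i = (if p i j then coeff (coeff u j) i else 0)"
    for p and u :: "'a poly poly"
  proof -
    have "\<forall>j. \<exists>v. \<forall>i. coeff v i = (if p i j then coeff (coeff u j) i else 0)"
      by (intro allI 1)
    then obtain h where h: "\<And>j i. coeff (h j) i = (if p i j then coeff (coeff u j) i else 0)"
      by (auto dest!: choice)
    have "\<exists>v. \<forall>j. coeff v j = h j"
      by (rule exists_poly_coeff[of u]) (auto intro!: poly_eqI simp: h)
    then obtain v where "\<And>j. coeff v j = h j" by blast
    then show ?thesis using h by (intro exI[of _ v]) simp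
  qed
  have "\<forall>l. \<exists>v. \<forall>j i. coeff (coeff v j) i = (if p i j l then cf f i j l else 0)"
    by (intro allI 2)
  then obtain h where h: "\<And>l j i. coeff (coeff (h l) j) i = (if p i j l then cf f i j l else 0)"
    by (auto dest!: choice)
  have "\<exists>v. \<forall>l. coeff v l = h l"
    by (rule exists_poly_coeff[of f]) (auto intro!: poly_eqI simp: h)
  then obtain v where "\<And>l. coeff v l = h l" by blast
  then show ?thesis using h by (intro exI[of _ v]) simp
qed

definition hcomp :: "int \<Rightarrow> 'k::field poly3 \<Rightarrow> 'k poly3" where
  "hcomp n f = (SOME g. \<forall>i j l. cf g i j l = (if int (i + j + l) = n then cf f i j l else 0))"

lemma cf_hcomp [simp]: "cf (hcomp n f) i j l = (if int (i + j + l) = n then cf f i j l else 0)"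
  using someI_ex[OF exists_poly3_filter[of "\<lambda>i j l. int (i + j + l) = n" f]]
  unfolding hcomp_def by blast

lemma hcomp_gr [simp]: "hcomp n f \<in> gr n"
  by (simp add: gr_def)

lemma hcomp_of_gr: "f \<in> gr m \<Longrightarrow> hcomp n f = (if n = m then f else 0)"
  by (intro poly3_eqI) (auto simp: gr_def)

lemma hcomp_add [simp]: "hcomp n (f + g) = hcomp n f + hcomp n g"
  by (intro poly3_eqI) auto

lemma hcomp_diff [simp]: "hcomp n (f - g) = hcomp n f - hcomp n g"
  by (intro poly3_eqI) auto

lemma hcomp_0 [simp]: "hcomp n 0 = 0"
  by (intro poly3_eqI) auto

lemma hcomp_sum: "hcomp n (sum f A) = (\<Sum>x\<in>A. hcomp n (f x))"
  by (induction A rule: infinite_finite_induct) auto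

lemma finite_cf: "finite {(i, j, l). cf f i j l \<noteq> 0}"
proof -
  define a where "a l j = {..degree (coeff (coeff f l) j)}" for l j
  have "{(i, j, l). cf f i j l \<noteq> 0} \<subseteq>
    (\<Union>l\<in>{..degree f}. \<Union>j\<in>{..degree (coeff f l)}. (\<lambda>i. (i, j, l)) ` a l j)"
  proof
    fix t assume "t \<in> {(i, j, l). cf f i j l \<noteq> 0}"
    then obtain i j l where t: "t = (i, j, l)" "cf f i j l \<noteq> 0" by auto
    then have "i \<le> degree (coeff (coeff f l) j)" "j \<le> degree (coeff f l)" "l \<le> degree f"
      by (auto intro!: le_degree)
    then show "t \<in> (\<Union>l\<in>{..degree f}. \<Union>j\<in>{..degree (coeff f l)}. (\<lambda>i. (i, j, l)) ` a l j)"
      using t(1) unfolding a_def by blast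
  qed
  then show ?thesis unfolding a_def by (rule finite_subset) auto
qed

lemma exists_degree_bound: "\<exists>D. \<forall>i j l. cf f i j l \<noteq> 0 \<longrightarrow> i + j + l < D"
proof -
  have "finite ((\<lambda>(i, j, l). i + j + l) ` {(i, j, l). cf f i j l \<noteq> 0})"
    using finite_cf by (rule finite_imageI)
  then obtain D where "\<forall>x\<in>((\<lambda>(i, j, l). i + j + l) ` {(i, j, l). cf f i j l \<noteq> 0}). x < D"
    using finite_nat_set_iff_bounded by blast
  then show ?thesis by (intro exI[of _ D]) (auto simp: image_iff)
qed

lemma cf_sum: "cf (sum f A) i j l = (\<Sum>x\<in>A. cf (f x) i j l)"
  by (simp add: coeff_sum)

lemma exists_sum_hcomp: "\<exists>D. f = (\<Sum>k<D. hcomp (int k) f)"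
proof -
  obtain D where D: "\<forall>i j l. cf f i j l \<noteq> 0 \<longrightarrow> i + j + l < D" using exists_degree_bound by blast
  have "f = (\<Sum>k<D. hcomp (int k) f)"
  proof (rule poly3_eqI)
    fix i j l
    have "cf (\<Sum>k<D. hcomp (int k) f) i j l = (\<Sum>k<D. if k = i + j + l then cf f i j l else 0)"
      unfolding cf_sum by (intro sum.cong) (auto simp flip: of_nat_add)
    also have "\<dots> = cf f i j l" using D by (auto simp: sum.delta)
    finally show "cf f i j l = cf (\<Sum>k<D. hcomp (int k) f) i j l" by simp
  qed
  then show ?thesis by blast
qed

text \<open>Multiplication by a form shifts components. Taking a component on both sides of an
  identity thus replaces an arbitrary cofactor by a homogeneous one, which is done
  throughout.\<close>

lemma hcomp_mult:
  assumes "g \<in> gr m"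
  shows "hcomp n (f * g) = hcomp (n - m) f * g"
proof -
  obtain D where D: "f = (\<Sum>k<D. hcomp (int k) f)" using exists_sum_hcomp by blast
  have 1: "hcomp (n - m) f = (\<Sum>k<D. if n - m = int k then hcomp (int k) f else 0)"
    by (subst D, simp only: hcomp_sum) (auto intro!: sum.cong simp: hcomp_of_gr[OF hcomp_gr])
  have "f * g = (\<Sum>k<D. hcomp (int k) f * g)" by (subst D) (simp add: sum_distrib_right)
  then have "hcomp n (f * g) = (\<Sum>k<D. hcomp n (hcomp (int k) f * g))" by (simp add: hcomp_sum)
  also have "\<dots> = (\<Sum>k<D. if n = int k + m then hcomp (int k) f * g else 0)"
    using hcomp_of_gr[OF gr_mult[OF hcomp_gr assms]] by (intro sum.cong) auto
  also have "\<dots> = hcomp (n - m) f * g"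
    unfolding 1 sum_distrib_right by (intro sum.cong) auto
  finally show ?thesis .
qed

lemma hcomp_mult_left: "g \<in> gr m \<Longrightarrow> hcomp n (g * f) = g * hcomp (n - m) f"
  using hcomp_mult[of g m n f] by (simp add: mult.commute)

subsection \<open>The dimension of the space of forms\<close>

definition mon :: "nat \<times> nat \<times> nat \<Rightarrow> 'k::field poly3" where
  "mon = (\<lambda>(i, j, l). monom (monom (monom 1 i) j) l)"

lemma cf_mon: "cf (mon (a, b, c)) i j l = (if i = a \<and> j = b \<and> l = c then 1 else 0)"
  by (auto simp: mon_def)

definition exps :: "nat \<Rightarrow> (nat \<times> nat \<times> nat) set" where
  "exps n = {(i, j, l). i + j + l = n}"

lemma exps_eq: "exps n = (\<lambda>(i, j). (i, j, n - i - j)) ` (SIGMA i:{..n}. {..n - i})"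
  by (auto simp: exps_def image_iff)

lemma finite_exps [simp]: "finite (exps n)"
  by (simp add: exps_eq)

lemma card_exps: "2 * card (exps n) = (n + 1) * (n + 2)"
proof -
  have "inj_on (\<lambda>(i, j). (i, j, n - i - j)) (SIGMA i:{..n}. {..n - i})" by (auto simp: inj_on_def)
  then have "card (exps n) = (\<Sum>i\<le>n. n - i + 1)"
    unfolding exps_eq by (simp add: card_image)
  also have "\<dots> = (\<Sum>i\<le>n. i + 1)"
    by (rule sum.reindex_bij_witness[of _ "\<lambda>i. n - i" "\<lambda>i. n - i"]) auto
  also have "2 * \<dots> = (n + 1) * (n + 2)" by (induction n) auto
  finally show ?thesis .
qed

lemma inj_mon: "inj mon"
  unfolding inj_def
proof (intro allI impI)
  fix x y :: "nat \<times> nat \<times> nat" assume eq: "mon x = (mon y :: 'a poly3)"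
  obtain a b c a' b' c' where xy: "x = (a, b, c)" "y = (a', b', c')" by (metis prod_cases3)
  have "cf (mon x :: 'a poly3) a b c = cf (mon y :: 'a poly3) a b c" using eq by simp
  then show "x = y" unfolding xy cf_mon by (auto split: if_splits)
qed

lemma mon_gr: "(i, j, l) \<in> exps n \<Longrightarrow> mon (i, j, l) \<in> gr (int n)"
  by (auto simp: gr_def cf_mon exps_def split: if_splits)

lemma cf_sum_mon: "finite T \<Longrightarrow> cf (\<Sum>t\<in>T. sc (u t) (mon t)) i j l = (if (i, j, l) \<in> T then u (i, j, l) else 0)"
proof -
  assume "finite T"
  have "cf (\<Sum>t\<in>T. sc (u t) (mon t)) i j l = (\<Sum>t\<in>T. if t = (i, j, l) then u t else 0)"
    unfolding cf_sum by (intro sum.cong refl) (auto simp: cf_mon split: prod.splits if_splits)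
  then show ?thesis using \<open>finite T\<close> by (simp add: sum.delta)
qed

lemma gr_eq_sum_mon:
  assumes "f \<in> gr (int n)"
  shows "f = (\<Sum>t\<in>exps n. sc (case t of (i, j, l) \<Rightarrow> cf f i j l) (mon t))"
proof (rule poly3_eqI)
  fix i j l
  have "cf f i j l = 0" if "i + j + l \<noteq> n"
    using assms that unfolding gr_def by (metis (mono_tags, lifting) mem_Collect_eq of_nat_eq_iff)
  then show "cf f i j l = cf (\<Sum>t\<in>exps n. sc (case t of (i, j, l) \<Rightarrow> cf f i j l) (mon t)) i j l"
    by (subst cf_sum_mon[OF finite_exps]) (auto simp: exps_def)
qed

lemma span_mon: "lin3.span (mon ` exps n :: 'a::field poly3 set) = gr (int n)"
proof
  show "lin3.span (mon ` exps n :: 'a poly3 set) \<subseteq> gr (int n)"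
    by (rule lin3.span_minimal[OF _ subspace_gr]) (auto intro: mon_gr)
  show "gr (int n) \<subseteq> lin3.span (mon ` exps n :: 'a poly3 set)"
  proof
    fix f :: "'a poly3" assume f: "f \<in> gr (int n)"
    have "(\<Sum>t\<in>exps n. sc (case t of (i, j, l) \<Rightarrow> cf f i j l) (mon t)) \<in> lin3.span (mon ` exps n)"
      by (intro lin3.span_sum lin3.span_scale lin3.span_base) auto
    then show "f \<in> lin3.span (mon ` exps n)" using gr_eq_sum_mon[OF f] by simp
  qed
qed

lemma independent_mon: "lin3.independent (mon ` exps n :: 'a::field poly3 set)"
proof (rule lin3.independent_if_scalars_zero)
  show "finite (mon ` exps n :: 'a poly3 set)" by simp
  fix u :: "'a poly3 \<Rightarrow> 'a" and x :: "'a poly3"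
  assume s: "(\<Sum>x\<in>mon ` exps n. sc (u x) x) = 0" and x: "x \<in> mon ` exps n"
  obtain i j l where t: "(i, j, l) \<in> exps n" "x = mon (i, j, l)" using x by (metis imageE prod_cases3)
  have "(\<Sum>t\<in>exps n. sc (u (mon t)) (mon t)) = 0"
    using s sum.reindex[of mon "exps n" "\<lambda>x. sc (u x) x"] inj_mon by (simp add: inj_on_subset[OF inj_mon])
  then have "cf (\<Sum>t\<in>exps n. sc (u (mon t)) (mon t)) i j l = 0" by simp
  then show "u x = 0" using cf_sum_mon[OF finite_exps, of "\<lambda>t. u (mon t)" n l j i] t by simp
qed

lemma fin_dim_gr: "lin3.fin_dim (gr n)"
proof (cases "n < 0")
  case True
  then show ?thesis unfolding lin3.fin_dim_def by (intro exI[of _ "{}"]) (auto simp: gr_neg)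
next
  case False
  then obtain m where "n = int m" by (metis nonneg_int_cases not_less)
  then show ?thesis unfolding lin3.fin_dim_def by (intro exI[of _ "mon ` exps m"]) (auto simp: span_mon)
qed

text \<open>The polynomial (n + 1)(n + 2) vanishes at -1 and -2, so the formula extends to these two
  negative degrees; this is why the Hilbert function of the curve is linear already from n = d - 2
  on.\<close>

lemma dim_gr:
  assumes "n \<ge> - 2"
  shows "2 * int (lin3.dim (gr n :: 'k::field poly3 set)) = (n + 1) * (n + 2)"
proof (cases "n < 0")
  case True
  then have "lin3.dim (gr n :: 'k poly3 set) = 0"
    using lin3.dim_le_card[of "gr n" "{}"] by (simp add: gr_neg)
  moreover have "n = - 1 \<or> n = - 2" using True assms by linarith
  ultimately show ?thesis by auto
next
  case False
  then obtain m where m: "n = int m" by (metis nonneg_int_cases not_less)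
  have "lin3.dim (gr n :: 'k poly3 set) = card (mon ` exps m :: 'k poly3 set)"
    unfolding m using lin3.dim_eq_card[OF _ independent_mon] span_mon by (metis lin3.span_span)
  also have "\<dots> = card (exps m)" by (rule card_image) (rule inj_on_subset[OF inj_mon subset_UNIV])
  finally show ?thesis using card_exps[of m] m by (metis of_nat_mult of_nat_numeral of_nat_add of_nat_1)
qed

lemma dim_gr_neg: "n < 0 \<Longrightarrow> lin3.dim (gr n :: 'k::field poly3 set) = 0"
  using lin3.dim_le_card[of "gr n" "{}"] by (simp add: gr_neg)

subsection \<open>Coordinates and evaluation\<close>

definition X0 :: "'k::field poly3" where "X0 = [:[:[:0, 1:]:]:]"
definition X1 :: "'k::field poly3" where "X1 = [:[:0, 1:]:]"
definition X2 :: "'k::field poly3" where "X2 = [:0, 1:]"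

lemma X_gr [simp]: "X0 \<in> gr 1" "X1 \<in> gr 1" "X2 \<in> gr 1"
  unfolding gr_def X0_def X1_def X2_def
  by (auto simp: coeff_pCons split: nat.splits if_splits) 

lemma eval3_add: "eval3 (f + g) p = eval3 f p + eval3 g p"
  by (cases p) (simp add: eval3_def)

lemma eval3_mult: "eval3 (f * g) p = eval3 f p * eval3 g p"
  by (cases p) (simp add: eval3_def)

lemma eval3_diff: "eval3 (f - g) p = eval3 f p - eval3 g p"
  by (cases p) (simp add: eval3_def)

lemma eval3_0 [simp]: "eval3 0 p = 0"
  by (cases p) (simp add: eval3_def)

lemma eval3_1 [simp]: "eval3 1 p = 1"
  by (cases p) (simp add: eval3_def)

lemma eval3_const3 [simp]: "eval3 (const3 c) p = c"
  by (cases p) (simp add: eval3_def const3_def)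

lemma eval3_sc [simp]: "eval3 (sc c f) p = c * eval3 f p"
  by (simp add: sc_def eval3_mult)

lemma eval3_power: "eval3 (f ^ n) p = eval3 f p ^ n"
  by (induction n) (simp_all add: eval3_mult)

lemma eval3_prod: "eval3 (prod f A) p = (\<Prod>x\<in>A. eval3 (f x) p)"
  by (induction A rule: infinite_finite_induct) (simp_all add: eval3_mult)

lemma eval3_sum: "eval3 (sum f A) p = (\<Sum>x\<in>A. eval3 (f x) p)"
  by (induction A rule: infinite_finite_induct) (simp_all add: eval3_add)

lemma eval3_X [simp]:
  "eval3 X0 (a, b, c) = a" "eval3 X1 (a, b, c) = b" "eval3 X2 (a, b, c) = c"
  by (simp_all add: eval3_def X0_def X1_def X2_def)

lemma poly3_decompose: "\<exists>a b c u. f = const3 u + X0 * a + X1 * b + X2 * c"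
proof -
  obtain g c where f: "f = pCons g c" by (cases f) auto
  obtain h b where g: "g = pCons h b" by (cases g) auto
  obtain u a where h: "h = pCons u a" by (cases h) auto
  have "f = const3 u + X0 * [:[:a:]:] + X1 * [:b:] + X2 * c"
    unfolding f g h const3_def X0_def X1_def X2_def by simp
  then show ?thesis by blast
qed

lemma gr_decompose:
  assumes "f \<in> gr n" "n \<noteq> 0"
  shows "\<exists>a b c. a \<in> gr (n - 1) \<and> b \<in> gr (n - 1) \<and> c \<in> gr (n - 1) \<and> f = X0 * a + X1 * b + X2 * c"
proof -
  obtain a b c u where f: "f = const3 u + X0 * a + X1 * b + X2 * c" using poly3_decompose by blast
  have "f = hcomp n f" using hcomp_of_gr[OF assms(1)] by simp
  also have "\<dots> = X0 * hcomp (n - 1) a + X1 * hcomp (n - 1) b + X2 * hcomp (n - 1) c"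
    using assms(2) unfolding f
    by (simp add: hcomp_mult_left[OF X_gr(1)] hcomp_mult_left[OF X_gr(2)] hcomp_mult_left[OF X_gr(3)]
        hcomp_of_gr[OF const3_gr])
  finally show ?thesis by (metis hcomp_gr)
qed

lemma gr_zero_const:
  fixes f :: "'a::field poly3"
  assumes f0: "f \<in> gr 0"
  shows "\<exists>u. f = const3 u"
proof -
  obtain a b c u where f: "f = const3 u + X0 * a + X1 * b + X2 * c" using poly3_decompose by blast
  have "f = hcomp 0 f" using hcomp_of_gr[OF f0] by simp
  also have "\<dots> = const3 u + X0 * hcomp (- 1) a + X1 * hcomp (- 1) b + X2 * hcomp (- 1) c"
    unfolding f
    by (simp add: hcomp_mult_left[OF X_gr(1)] hcomp_mult_left[OF X_gr(2)] hcomp_mult_left[OF X_gr(3)]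
        hcomp_of_gr[OF const3_gr])
  also have "\<dots> = const3 u"
  proof -
    have "hcomp (- 1) g = 0" for g :: "'a poly3"
      using hcomp_gr[of "- 1" g] gr_neg[of "- 1", where 'a = 'a] by simp
    then show ?thesis by simp
  qed
  finally show ?thesis by blast
qed

lemma gr_induct [consumes 1, case_names const decomp]:
  assumes "f \<in> gr (int n)"
    and "\<And>u. P 0 (const3 u)"
    and "\<And>n a b c. a \<in> gr (int n) \<Longrightarrow> b \<in> gr (int n) \<Longrightarrow> c \<in> gr (int n) \<Longrightarrow>
       P n a \<Longrightarrow> P n b \<Longrightarrow> P n c \<Longrightarrow> P (Suc n) (X0 * a + X1 * b + X2 * c)"
  shows "P n f"
  using assms(1)
proof (induction n arbitrary: f)
  case 0
  then show ?case using gr_zero_const assms(2) by fastforce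
next
  case (Suc n)
  obtain a b c where "a \<in> gr (int n)" "b \<in> gr (int n)" "c \<in> gr (int n)" "f = X0 * a + X1 * b + X2 * c"
    using gr_decompose[OF Suc.prems] by auto
  then show ?case using assms(3) Suc.IH by blast
qed

lemma eval3_scale_point:
  assumes "f \<in> gr (int n)"
  shows "eval3 f (t * x, t * y, t * z) = t ^ n * eval3 f (x, y, z)"
  using assms by (induction n f rule: gr_induct) (simp_all add: eval3_add eval3_mult algebra_simps)

subsection \<open>Homogeneous ideals\<close>

text \<open>Homogeneity is expressed by closure under components rather than by homogeneous
  generators, which is the form used in calculations; \<open>homogeneous_ideal_iff\<close>
  reconciles the two.\<close>

definition hid :: "'k::field poly3 set \<Rightarrow> bool" where
  "hid I \<longleftrightarrow> 0 \<in> I \<and> (\<forall>a\<in>I. \<forall>b\<in>I. a + b \<in> I) \<and> (\<forall>r. \<forall>a\<in>I. r * a \<in> I) \<and> (\<forall>n. \<forall>a\<in>I. hcomp n a \<in> I)"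

lemma hidD:
  assumes "hid I"
  shows "0 \<in> I" "a \<in> I \<Longrightarrow> b \<in> I \<Longrightarrow> a + b \<in> I" "a \<in> I \<Longrightarrow> r * a \<in> I" "a \<in> I \<Longrightarrow> a * r \<in> I"
    "a \<in> I \<Longrightarrow> hcomp n a \<in> I" "a \<in> I \<Longrightarrow> - a \<in> I" "a \<in> I \<Longrightarrow> b \<in> I \<Longrightarrow> a - b \<in> I" "a \<in> I \<Longrightarrow> sc u a \<in> I"
proof -
  show m: "r * a \<in> I" if "a \<in> I" for r a using assms that unfolding hid_def by blast
  show "0 \<in> I" and add: "\<And>a b. a \<in> I \<Longrightarrow> b \<in> I \<Longrightarrow> a + b \<in> I" and "a \<in> I \<Longrightarrow> hcomp n a \<in> I"
    using assms unfolding hid_def by blast+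
  show "a * r \<in> I" if "a \<in> I" using m[OF that, of r] by (simp add: mult.commute)
  show mi: "- a \<in> I" if "a \<in> I" for a using m[OF that, of "- 1"] by simp
  show "a - b \<in> I" if "a \<in> I" "b \<in> I" using add[OF that(1) mi[OF that(2)]] by simp
  show "sc u a \<in> I" if "a \<in> I" using m[OF that] by (simp add: sc_def)
qed

lemma hid_sum: "hid I \<Longrightarrow> (\<And>x. x \<in> A \<Longrightarrow> f x \<in> I) \<Longrightarrow> sum f A \<in> I"
  by (induction A rule: infinite_finite_induct) (auto intro: hidD(1,2))

lemma hid_subspace: "hid I \<Longrightarrow> lin3.subspace I"
  by (auto simp: lin3.subspace_def intro: hidD(1,2,8))

lemma hid_memI: "hid I \<Longrightarrow> (\<And>n. hcomp n f \<in> I) \<Longrightarrow> f \<in> I"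
  by (metis exists_sum_hcomp hid_sum)

lemma hid_gr_mono:
  assumes I: "hid I" and "gr n \<subseteq> I" "0 \<le> n" "n \<le> m"
  shows "gr m \<subseteq> I"
  using assms(4)
proof (induction m rule: int_ge_induct)
  case base
  then show ?case by (rule assms(2))
next
  case (step m)
  show ?case
  proof
    fix f :: "'a poly3" assume "f \<in> gr (m + 1)"
    then obtain a b c where "a \<in> gr m" "b \<in> gr m" "c \<in> gr m" "f = X0 * a + X1 * b + X2 * c"
      using gr_decompose[of f "m + 1"] step.hyps assms(3) by auto
    then show "f \<in> I" using step.IH by (auto intro!: hidD(2,3)[OF I])
  qed
qed

lemma hid_dvd:
  assumes "F \<in> gr d"
  shows "hid {f. F dvd f}"
  unfolding hid_def by (auto simp: dvd_def hcomp_mult_left[OF assms]) (metis distrib_left)+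

lemma hcomp_dvd: "F \<in> gr d \<Longrightarrow> F dvd f \<Longrightarrow> F dvd hcomp n f"
  by (auto simp: dvd_def hcomp_mult_left)

section \<open>Coordinates adapted to a plane curve\<close>

text \<open>\<open>x, y\<close> are linear forms whose common zero is not on the curve. The last clause is a trace
  functional on the Artinian Gorenstein ring \<open>R/(F, x^N, y^N)\<close>, whose socle has degree
  \<open>d + 2N - 3\<close>.\<close>

definition coords :: "'k::field poly3 \<Rightarrow> nat \<Rightarrow> 'k poly3 \<Rightarrow> 'k poly3 \<Rightarrow> bool" where
  "coords F d x y \<longleftrightarrow> x \<in> gr 1 \<and> y \<in> gr 1 \<and> \<not> F dvd x \<and> \<not> F dvd y \<and>
     (\<forall>N u v. F dvd y ^ N * u - x ^ N * v \<longrightarrow> (\<exists>w. F dvd u - x ^ N * w \<and> F dvd v - y ^ N * w)) \<and>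
     (\<forall>N n f. n \<ge> 2 * N + d \<and> f \<in> gr (int n) \<longrightarrow> (\<exists>a b. F dvd f - (x ^ N * a + y ^ N * b))) \<and>
     (\<forall>N>0. \<exists>\<rho>. (\<forall>f g. \<rho> (f + g) = \<rho> f + \<rho> g) \<and> (\<forall>c f. \<rho> (sc c f) = c * \<rho> f) \<and>
        (\<forall>f. \<rho> (F * f) = 0) \<and> (\<forall>f. \<rho> (x ^ N * f) = 0) \<and> (\<forall>f. \<rho> (y ^ N * f) = 0) \<and>
        (\<forall>i<N. \<forall>a\<in>gr (int i). \<not> F dvd a \<longrightarrow>
           (\<exists>t\<in>gr (int d - 3 + 2 * int N - int i). \<rho> (a * t) \<noteq> (0::'k))))"

lemma coordsD:
  assumes "coords F d x y"
  shows "x \<in> gr 1" "y \<in> gr 1" "\<not> F dvd x" "\<not> F dvd y"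
    "F dvd y ^ N * u - x ^ N * v \<Longrightarrow> (\<exists>w. F dvd u - x ^ N * w \<and> F dvd v - y ^ N * w)"
    "n \<ge> 2 * N + d \<Longrightarrow> f \<in> gr (int n) \<Longrightarrow> (\<exists>a b. F dvd f - (x ^ N * a + y ^ N * b))"
proof -
  note c = assms[unfolded coords_def]
  show "x \<in> gr 1" "y \<in> gr 1" "\<not> F dvd x" "\<not> F dvd y"
    subgoal using c by (elim conjE)
    subgoal using c by (elim conjE)
    subgoal using c by (elim conjE)
    subgoal using c by (elim conjE)
    done
  have c1: "\<forall>N u v. F dvd y ^ N * u - x ^ N * v \<longrightarrow> (\<exists>w. F dvd u - x ^ N * w \<and> F dvd v - y ^ N * w)"
    and c2: "\<forall>N n f. n \<ge> 2 * N + d \<and> f \<in> gr (int n) \<longrightarrow> (\<exists>a b. F dvd f - (x ^ N * a + y ^ N * b))"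
    subgoal using c by (elim conjE)
    subgoal using c by (elim conjE)
    done
  show "F dvd y ^ N * u - x ^ N * v \<Longrightarrow> (\<exists>w. F dvd u - x ^ N * w \<and> F dvd v - y ^ N * w)"
    using c1 by blast
  show "n \<ge> 2 * N + d \<Longrightarrow> f \<in> gr (int n) \<Longrightarrow> (\<exists>a b. F dvd f - (x ^ N * a + y ^ N * b))"
    using c2 by blast
qed

lemma coords_trace:
  assumes "coords F d x (y :: 'k::field poly3)" "N > 0"
  obtains \<rho> where "\<And>f g. \<rho> (f + g) = \<rho> f + \<rho> g" "\<And>c f. \<rho> (sc c f) = c * \<rho> f"
    "\<And>f. \<rho> (F * f) = 0" "\<And>f. \<rho> (x ^ N * f) = 0" "\<And>f. \<rho> (y ^ N * f) = 0"
    "\<And>i a. i < N \<Longrightarrow> a \<in> gr (int i) \<Longrightarrow> \<not> F dvd a \<Longrightarrow>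
       \<exists>t\<in>gr (int d - 3 + 2 * int N - int i). \<rho> (a * t) \<noteq> (0::'k)"
proof -
  note c = assms(1)[unfolded coords_def, THEN conjunct2, THEN conjunct2, THEN conjunct2, THEN conjunct2,
      THEN conjunct2, THEN conjunct2, rule_format, OF assms(2)]
  obtain \<rho> where "(\<forall>f g. \<rho> (f + g) = \<rho> f + \<rho> g) \<and> (\<forall>c f. \<rho> (sc c f) = c * \<rho> f) \<and>
        (\<forall>f. \<rho> (F * f) = 0) \<and> (\<forall>f. \<rho> (x ^ N * f) = 0) \<and> (\<forall>f. \<rho> (y ^ N * f) = 0) \<and>
        (\<forall>i<N. \<forall>a\<in>gr (int i). \<not> F dvd a \<longrightarrow>
           (\<exists>t\<in>gr (int d - 3 + 2 * int N - int i). \<rho> (a * t) \<noteq> (0::'k)))"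
    using c by (elim exE)
  then show ?thesis by (elim conjE) (rule that[of \<rho>]; blast)
qed

lemma const_poly_power: "[:a::'a::comm_semiring_1:] ^ n = [:a ^ n:]"
  by (induction n) (simp_all add: one_pCons mult.commute)

lemma X_power: "X0 ^ n = [:[:monom 1 n:]:]" "X1 ^ n = [:monom 1 n:]" "X2 ^ n = monom 1 n"
  unfolding X0_def X1_def X2_def const_poly_power by (simp_all add: monom_altdef)

lemma cf_X0_power_mult: "cf (X0 ^ N * g) i j l = (if i < N then 0 else cf g (i - N) j l)"
  unfolding X_power by (simp add: coeff_monom_mult)

lemma cf_X1_power_mult: "cf (X1 ^ N * g) i j l = (if j < N then 0 else cf g i (j - N) l)"
  unfolding X_power by (simp add: coeff_monom_mult)

lemma cf_X2_power_mult: "cf (X2 ^ N * g) i j l = (if l < N then 0 else cf g i j (l - N))"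
  unfolding X_power by (simp add: coeff_monom_mult)

lemma X0_power_dvdI:
  assumes "\<And>i j l. i < N \<Longrightarrow> cf g i j l = 0"
  shows "\<exists>w. g = X0 ^ N * w"
proof (intro exI poly3_eqI)
  fix i j l
  show "cf g i j l = cf (X0 ^ N * map_poly (map_poly (poly_shift N)) g) i j l"
    unfolding cf_X0_power_mult using assms by (auto simp: coeff_map_poly coeff_poly_shift)
qed

lemma X1_power_dvdI:
  assumes "\<And>i j l. j < N \<Longrightarrow> cf g i j l = 0"
  shows "\<exists>w. g = X1 ^ N * w"
proof (intro exI poly3_eqI)
  fix i j l
  show "cf g i j l = cf (X1 ^ N * map_poly (poly_shift N) g) i j l"
    unfolding cf_X1_power_mult using assms by (auto simp: coeff_map_poly coeff_poly_shift)
qed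

subsection \<open>Division by a form which is monic in the last variable\<close>

locale monic_form =
  fixes F :: "'k::field poly3" and d :: nat
  assumes F_gr: "F \<in> gr (int d)" and F_lead: "cf F 0 0 d \<noteq> 0" and d_pos: "0 < d"
begin

lemma coeff_F: "coeff F d = [:[:cf F 0 0 d:]:]"
proof (intro poly_eqI)
  fix j i
  show "coeff (coeff (coeff F d) j) i = coeff (coeff [:[:cf F 0 0 d:]:] j) i"
  proof (cases "i = 0 \<and> j = 0")
    case False
    then have "cf F i j d = 0" using F_gr unfolding gr_def by force
    then show ?thesis using False by (auto simp: coeff_pCons split: nat.splits)
  qed simp
qed

lemma degree_F: "degree F = d"
proof (rule antisym)
  show "degree F \<le> d"
  proof (rule degree_le, intro allI impI)
    fix l assume "d < l"
    then show "coeff F l = 0"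
      using F_gr unfolding gr_def by (intro poly_eqI) force
  qed
  show "d \<le> degree F" by (rule le_degree) (use F_lead in auto)
qed

lemma F_nz: "F \<noteq> 0"
  using F_lead by auto

text \<open>The leading coefficient of F in X2 is a nonzero constant by homogeneity, so the power of
  it produced by pseudo-division is a unit and can be divided out.\<close>

lemma division: "\<exists>q r. f = q * F + r \<and> degree r < d"
proof -
  obtain q r where qr: "pseudo_divmod f F = (q, r)" by fastforce
  let ?e = "Suc (degree f) - degree F"
  have "smult (coeff F (degree F) ^ ?e) f = F * q + r" "r = 0 \<or> degree r < degree F"
    using pseudo_divmod[OF F_nz qr] by auto
  then have 1: "smult (coeff F d ^ ?e) f = F * q + r" "degree r < d"
    using d_pos degree_F by auto
  define c where "c = cf F 0 0 d"
  have cF: "coeff F d = [:[:c:]:]" unfolding c_def by (rule coeff_F)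
  have pw: "coeff F d ^ n = [:[:c ^ n:]:]" for n
    unfolding cF by (induction n) (simp_all add: one_pCons mult.commute)
  have "f = smult [:[:1 / c ^ ?e:]:] (smult (coeff F d ^ ?e) f)"
    using F_lead unfolding pw by (simp add: c_def flip: one_pCons)
  also have "\<dots> = smult [:[:1 / c ^ ?e:]:] q * F + smult [:[:1 / c ^ ?e:]:] r"
    unfolding 1(1) by (simp add: smult_add_right mult.commute)
  finally show ?thesis using 1(2) degree_smult_le[of _ r] by (metis le_less_trans)
qed

definition remF :: "'k poly3 \<Rightarrow> 'k poly3" where
  "remF f = (SOME r. \<exists>q. f = q * F + r \<and> degree r < d)"

lemma remF: "\<exists>q. f = q * F + remF f" "degree (remF f) < d"
  using someI_ex[of "\<lambda>r. \<exists>q. f = q * F + r \<and> degree r < d"] division[of f]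
  unfolding remF_def by blast+

lemma dvd_diff_remF: "F dvd f - remF f"
  using remF(1)[of f] by (metis add_diff_cancel_right' dvd_triv_right)

lemma dvd_small: "F dvd r \<Longrightarrow> degree r < d \<Longrightarrow> r = 0"
  using dvd_imp_degree_le[of F r] degree_F by force

lemma remF_unique: "F dvd f - r \<Longrightarrow> degree r < d \<Longrightarrow> remF f = r"
proof -
  assume a: "F dvd f - r" "degree r < d"
  have "F dvd (f - r) - (f - remF f)" by (rule dvd_diff[OF a(1) dvd_diff_remF])
  moreover have "degree (remF f - r) < d" using a(2) remF(2) by (rule degree_diff_less[rotated])
  ultimately show ?thesis using dvd_small[of "remF f - r"] by simp
qed

lemma remF_add: "remF (f + g) = remF f + remF g"
proof (rule remF_unique)
  have "F dvd (f - remF f) + (g - remF g)" by (intro dvd_add dvd_diff_remF)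
  then show "F dvd f + g - (remF f + remF g)" by (simp add: algebra_simps)
qed (simp add: degree_add_less remF)

lemma remF_mult_eq: "degree (h * remF f) < d \<Longrightarrow> remF (h * f) = h * remF f"
  by (rule remF_unique) (metis dvd_mult dvd_diff_remF right_diff_distrib)

lemma remF_mult_const: "remF ([:u:] * f) = [:u:] * remF f"
  by (rule remF_mult_eq) (metis degree_pCons_0 degree_mult_le remF(2) add_0 le_less_trans)

lemma remF_dvd: "F dvd f \<Longrightarrow> remF f = 0"
  by (rule remF_unique) (use d_pos in auto)

lemma remF_zero_iff: "remF f = 0 \<longleftrightarrow> F dvd f"
  using remF_dvd dvd_diff_remF[of f] by fastforce

lemma remF_gr: "f \<in> gr n \<Longrightarrow> remF f \<in> gr n"
proof -
  assume f: "f \<in> gr n"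
  have "F dvd hcomp n (f - remF f)" by (rule hcomp_dvd[OF F_gr dvd_diff_remF])
  then have 1: "F dvd f - hcomp n (remF f)" using hcomp_of_gr[OF f] by simp
  have "degree (hcomp n (remF f)) \<le> degree (remF f)"
    by (rule degree_le) (auto intro!: poly_eqI simp: coeff_eq_0)
  then have "remF f = hcomp n (remF f)" using remF_unique[OF 1] remF(2)[of f] by linarith
  then show ?thesis by (metis hcomp_gr)
qed

text \<open>Remainders modulo F identify S with the free k[X0, X1]-module on 1, X2, ..., X2^(d-1),
  and taking remainders commutes with multiplication by X0 and X1. Divisibility by their powers in S
  is thus read off from coefficients.\<close>

lemma coords: "coords F d X0 X1"
  unfolding coords_def
proof (intro conjI)
  have deg: "degree (X0 :: 'k poly3) < d" "degree (X1 :: 'k poly3) < d"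
    using d_pos by (auto simp: X0_def X1_def)
  show "\<not> F dvd X0" "\<not> F dvd X1"
    using dvd_small[OF _ deg(1)] dvd_small[OF _ deg(2)] by (auto simp: X0_def X1_def)
  have x: "remF (X0 ^ N * f) = X0 ^ N * remF f" for N f
    unfolding X_power by (rule remF_mult_const)
  have y: "remF (X1 ^ N * f) = X1 ^ N * remF f" for N f
    unfolding X_power by (rule remF_mult_const)
  show "\<forall>N u v. F dvd X1 ^ N * u - X0 ^ N * v \<longrightarrow> (\<exists>w. F dvd u - X0 ^ N * w \<and> F dvd v - X1 ^ N * w)"
  proof (intro allI impI)
    fix N u v assume "F dvd X1 ^ N * u - X0 ^ N * v"
    then have "remF (X0 ^ N * v + (X1 ^ N * u - X0 ^ N * v)) = remF (X0 ^ N * v) + 0"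
      unfolding remF_add by (simp add: remF_dvd)
    then have eq: "X1 ^ N * remF u = X0 ^ N * remF v" by (simp add: x y)
    have "cf (remF u) i j l = 0" if "i < N" for i j l
    proof -
      have "cf (remF u) i j l = cf (X1 ^ N * remF u) i (j + N) l" by (simp add: cf_X1_power_mult)
      also have "\<dots> = 0" unfolding eq using that by (simp add: cf_X0_power_mult)
      finally show ?thesis .
    qed
    then obtain w where w: "remF u = X0 ^ N * w" using X0_power_dvdI by blast
    have "X0 ^ N * (X1 ^ N * w) = X0 ^ N * remF v" using eq w by (simp add: mult.left_commute)
    moreover have "X0 ^ N \<noteq> (0 :: 'k poly3)" unfolding X_power by simp
    ultimately have "remF v = X1 ^ N * w" by (metis mult_left_cancel)
    then show "\<exists>w. F dvd u - X0 ^ N * w \<and> F dvd v - X1 ^ N * w"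
      using dvd_diff_remF[of u] dvd_diff_remF[of v] w by auto
  qed
  show "\<forall>N n f. n \<ge> 2 * N + d \<and> f \<in> gr (int n) \<longrightarrow> (\<exists>a b. F dvd f - (X0 ^ N * a + X1 ^ N * b))"
  proof (intro allI impI, elim conjE)
    fix N n :: nat and f :: "'k poly3"
    assume n: "n \<ge> 2 * N + d" and f: "f \<in> gr (int n)"
    let ?r = "remF f"
    have r: "?r \<in> gr (int n)" by (rule remF_gr[OF f])
    obtain A where A: "\<And>i j l. cf A i j l = (if N \<le> i then cf ?r i j l else 0)"
      using exists_poly3_filter[of "\<lambda>i j l. N \<le> i" ?r] by blast
    obtain a where a: "A = X0 ^ N * a" using X0_power_dvdI[of N A] A by auto
    \<comment> \<open>A monomial with i < N, j < N, l < d has degree at most 2N + d - 3, below n; so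
      the terms not divisible by X0^N are divisible by X1^N.\<close>
    have "cf (?r - A) i j l = 0" if "j < N" for i j l
    proof (cases "cf ?r i j l = 0 \<or> N \<le> i")
      case True
      then show ?thesis by (auto simp: A)
    next
      case False
      then have "int (i + j + l) = int n" using r unfolding gr_def by blast
      moreover have "l < d"
        using False remF(2)[of f] by (metis coeff_0 coeff_eq_0 less_le_trans not_le order_less_trans)
      ultimately show ?thesis using False that n by linarith
    qed
    then obtain b where b: "?r - A = X1 ^ N * b" using X1_power_dvdI by blast
    have "?r = X0 ^ N * a + X1 ^ N * b" using a b by (metis add.commute diff_add_cancel)
    then show "\<exists>a b. F dvd f - (X0 ^ N * a + X1 ^ N * b)" using dvd_diff_remF[of f] by metis
  qed
  show "\<forall>N>0. \<exists>\<rho>. (\<forall>f g. \<rho> (f + g) = \<rho> f + \<rho> g) \<and> (\<forall>c f. \<rho> (sc c f) = c * \<rho> f) \<and>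
        (\<forall>f. \<rho> (F * f) = 0) \<and> (\<forall>f. \<rho> (X0 ^ N * f) = 0) \<and> (\<forall>f. \<rho> (X1 ^ N * f) = 0) \<and>
        (\<forall>i<N. \<forall>a\<in>gr (int i). \<not> F dvd a \<longrightarrow>
           (\<exists>t\<in>gr (int d - 3 + 2 * int N - int i). \<rho> (a * t) \<noteq> (0::'k)))"
  proof (intro allI impI)
    fix N :: nat assume N: "N > 0"
    \<comment> \<open>The coefficient of the socle monomial X0^(N-1) X1^(N-1) X2^(d-1), of degree d
      + 2N - 3, in the remainder.\<close>
    define \<rho> where "\<rho> f = cf (remF f) (N - 1) (N - 1) (d - 1)" for f
    show "\<exists>\<rho>. (\<forall>f g. \<rho> (f + g) = \<rho> f + \<rho> g) \<and> (\<forall>c f. \<rho> (sc c f) = c * \<rho> f) \<and>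
        (\<forall>f. \<rho> (F * f) = 0) \<and> (\<forall>f. \<rho> (X0 ^ N * f) = 0) \<and> (\<forall>f. \<rho> (X1 ^ N * f) = 0) \<and>
        (\<forall>i<N. \<forall>a\<in>gr (int i). \<not> F dvd a \<longrightarrow>
           (\<exists>t\<in>gr (int d - 3 + 2 * int N - int i). \<rho> (a * t) \<noteq> (0::'k)))"
    proof (intro exI[of _ \<rho>] conjI allI impI ballI)
      fix f g c
      show "\<rho> (f + g) = \<rho> f + \<rho> g" by (simp add: \<rho>_def remF_add)
      have "remF (sc c f) = sc c (remF f)" unfolding sc_def const3_def by (rule remF_mult_const)
      then show "\<rho> (sc c f) = c * \<rho> f" by (simp add: \<rho>_def)
      show "\<rho> (F * f) = 0" by (simp add: \<rho>_def remF_dvd)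
      show "\<rho> (X0 ^ N * f) = 0" "\<rho> (X1 ^ N * f) = 0"
        using N by (simp_all add: \<rho>_def x y cf_X0_power_mult cf_X1_power_mult)
    next
      fix i a assume i: "i < N" and a: "a \<in> gr (int i)" "\<not> F dvd a"
      let ?r = "remF a"
      have r: "?r \<in> gr (int i)" "?r \<noteq> 0" "degree ?r < d"
        using remF_gr[OF a(1)] a(2) remF_zero_iff remF(2) by auto
      \<comment> \<open>The monomial (k, j, l) is chosen with l the full X2-degree of the remainder
        of a. Multiplication by the complementary monomial t then keeps the X2-degree below d, so no
        further reduction mixes coefficients, and \<rho> (a t) is the coefficient at (k, j,
        l).\<close>
      define l j k where "l = degree ?r" and "j = degree (coeff ?r l)"
        and "k = degree (coeff (coeff ?r l) j)"
      have nz: "cf ?r k j l \<noteq> 0" using r(2) by (simp add: l_def j_def k_def)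
      then have sum: "k + j + l = i" using r(1) unfolding gr_def by force
      define t :: "'k poly3" where "t = X0 ^ (N - 1 - k) * (X1 ^ (N - 1 - j) * X2 ^ (d - 1 - l))"
      have t: "t \<in> gr (int (N - 1 - k) + (int (N - 1 - j) + int (d - 1 - l)))"
        unfolding t_def by (intro gr_mult gr_power_one X_gr)
      have ld: "l < d" using r(3) l_def by simp
      have "int (N - 1 - k) + (int (N - 1 - j) + int (d - 1 - l)) = int d - 3 + 2 * int N - int i"
        using sum i ld by linarith
      then have t': "t \<in> gr (int d - 3 + 2 * int N - int i)" using t by simp
      have "degree t \<le> d - 1 - l"
        unfolding t_def X_power
        by (intro order_trans[OF degree_mult_le]) (simp add: degree_monom_eq order_trans[OF degree_mult_le])
      then have "degree (t * ?r) < d"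
        using degree_mult_le[of t ?r] ld unfolding l_def by linarith
      then have "remF (a * t) = t * ?r" using remF_mult_eq[of t a] by (simp add: mult.commute)
      then have "\<rho> (a * t) = cf (X0 ^ (N - 1 - k) * (X1 ^ (N - 1 - j) * (X2 ^ (d - 1 - l) * ?r))) (N - 1) (N - 1) (d - 1)"
        unfolding \<rho>_def t_def by (simp only: mult.assoc)
      also have "\<dots> = cf ?r k j l"
      proof -
        have "\<not> N - 1 < N - 1 - k" "\<not> N - 1 < N - 1 - j" "\<not> d - 1 < d - 1 - l"
          "N - 1 - (N - 1 - k) = k" "N - 1 - (N - 1 - j) = j" "d - 1 - (d - 1 - l) = l"
          using sum i ld by linarith+
        then show ?thesis
          by (simp only: cf_X0_power_mult cf_X1_power_mult cf_X2_power_mult not_False_eq_True if_False)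
      qed
      finally have "\<rho> (a * t) = cf ?r k j l" .
      then show "\<exists>t\<in>gr (int d - 3 + 2 * int N - int i). \<rho> (a * t) \<noteq> 0" using nz t' by (intro bexI[of _ t]) simp_all
    qed
  qed
qed (rule X_gr)+

end

subsection \<open>Linear changes of coordinates\<close>

definition is_hom :: "('a::comm_ring_1 \<Rightarrow> 'b::comm_ring_1) \<Rightarrow> bool" where
  "is_hom h \<longleftrightarrow> h 1 = 1 \<and> (\<forall>a b. h (a + b) = h a + h b) \<and> (\<forall>a b. h (a * b) = h a * h b)"

lemma is_homD:
  assumes "is_hom h"
  shows "h 0 = 0" "h 1 = 1" "h (a + b) = h a + h b" "h (a * b) = h a * h b" "h (- a) = - h a" "h (a - b) = h a - h b"
    "h (a ^ n) = h a ^ n" "h (sum f A) = (\<Sum>x\<in>A. h (f x))"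
proof -
  have *: "h 1 = 1" "\<And>a b. h (a + b) = h a + h b" "\<And>a b. h (a * b) = h a * h b"
    using assms unfolding is_hom_def by blast+
  have z: "h 0 = 0" using *(2)[of 0 0] by simp
  have m: "h (- a) = - h a" for a using *(2)[of a "- a"] z by (simp add: eq_neg_iff_add_eq_0 add.commute)
  show "h 0 = 0" "h 1 = 1" "h (a + b) = h a + h b" "h (a * b) = h a * h b" "h (- a) = - h a"
    using * z m by blast+
  show "h (a - b) = h a - h b" using *(2)[of a "- b"] m by simp
  show "h (a ^ n) = h a ^ n" by (induction n) (simp_all add: *)
  show "h (sum f A) = (\<Sum>x\<in>A. h (f x))" by (induction A rule: infinite_finite_induct) (simp_all add: * z)
qed

lemma is_hom_comp: "is_hom f \<Longrightarrow> is_hom g \<Longrightarrow> is_hom (\<lambda>x. f (g x))"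
  by (simp add: is_hom_def)

lemma is_hom_poly_map:
  assumes "is_hom h"
  shows "is_hom (\<lambda>p. poly (map_poly h p) c)"
proof -
  note h = is_homD[OF assms]
  have add: "map_poly h (p + q) = map_poly h p + map_poly h q" for p q
    by (intro poly_eqI) (simp add: coeff_map_poly h)
  have smult: "map_poly h (smult a p) = smult (h a) (map_poly h p)" for a p
    by (intro poly_eqI) (simp add: coeff_map_poly h)
  have mult: "poly (map_poly h (p * q)) c = poly (map_poly h p) c * poly (map_poly h q) c" for p q
  proof (induction p)
    case 0
    then show ?case by simp
  next
    case (pCons a p)
    then show ?case by (simp add: add smult map_poly_pCons h algebra_simps)
  qed
  show ?thesis unfolding is_hom_def using mult by (simp add: add h map_poly_1)
qed

definition subst3 :: "'k::field poly3 \<Rightarrow> 'k poly3 \<Rightarrow> 'k poly3 \<Rightarrow> 'k poly3 \<Rightarrow> 'k poly3" where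
  "subst3 A B C f = poly (map_poly (\<lambda>g. poly (map_poly (\<lambda>u. poly (map_poly const3 u) A) g) B) f) C"

lemma is_hom_const3: "is_hom const3"
  by (simp add: is_hom_def const3_def flip: one_pCons)

lemma is_hom_subst3: "is_hom (subst3 A B C)"
  unfolding subst3_def by (intro is_hom_poly_map is_hom_const3)

lemma subst3_X [simp]: "subst3 A B C X0 = A" "subst3 A B C X1 = B" "subst3 A B C X2 = C"
  "subst3 A B C (const3 c) = const3 c"
proof -
  define p where "p u = poly (map_poly const3 u) A" for u
  define q where "q g = poly (map_poly p g) B" for g
  have p: "is_hom p" unfolding p_def by (rule is_hom_poly_map[OF is_hom_const3])
  have q: "is_hom q" unfolding q_def by (rule is_hom_poly_map[OF p])
  have s: "subst3 A B C f = poly (map_poly q f) C" for f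
    unfolding subst3_def q_def p_def by simp
  note h = is_homD(1,2)[OF is_hom_const3] is_homD(1,2)[OF p] is_homD(1,2)[OF q]
  have p1: "p [:u, v:] = const3 u + A * const3 v" for u v
    unfolding p_def by (simp add: map_poly_pCons h)
  have q1: "q [:u, v:] = p u + B * p v" for u v
    unfolding q_def by (simp add: map_poly_pCons h)
  have s1: "subst3 A B C [:u, v:] = q u + C * q v" for u v
    unfolding s by (simp add: map_poly_pCons h)
  show "subst3 A B C X0 = A" "subst3 A B C X1 = B" "subst3 A B C X2 = C"
    "subst3 A B C (const3 c) = const3 c"
    using s1[of "[:[:0, 1:]:]" 0] q1[of "[:0, 1:]" 0] p1[of 0 1] s1[of "[:0, 1:]" 0] q1[of 0 1] s1[of 0 1]
      s1[of "[:[:c:]:]" 0] q1[of "[:c:]" 0] p1[of c 0]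
    by (simp_all add: X0_def X1_def X2_def h const3_def[of c] flip: one_pCons)
qed

lemma is_hom_poly3_eq:
  fixes g h :: "'k::field poly3 \<Rightarrow> 'b::comm_ring_1"
  assumes "is_hom g" "is_hom h" "\<And>c. g (const3 c) = h (const3 c)" "g X0 = h X0" "g X1 = h X1" "g X2 = h X2"
  shows "g f = h f"
proof -
  have form: "g f = h f" if "f \<in> gr (int n)" for f n
    using that by (induction n f rule: gr_induct) (simp_all add: assms is_homD[OF assms(1)] is_homD[OF assms(2)])
  obtain D where "f = (\<Sum>k<D. hcomp (int k) f)" using exists_sum_hcomp by blast
  moreover have "g (\<Sum>k<D. hcomp (int k) f) = h (\<Sum>k<D. hcomp (int k) f)"
    unfolding is_homD(8)[OF assms(1)] is_homD(8)[OF assms(2)]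
    by (intro sum.cong refl form[OF hcomp_gr])
  ultimately show ?thesis by simp
qed

lemma subst3_gr:
  fixes A :: "'a::field poly3"
  assumes "A \<in> gr 1" "B \<in> gr 1" "C \<in> gr 1" "f \<in> gr n"
  shows "subst3 A B C f \<in> gr n"
proof (cases "n < 0")
  case True
  then have "f = 0" using assms(4) gr_neg[of n, where 'a = 'a] by simp
  then show ?thesis using is_homD(1)[OF is_hom_subst3] gr_0 by metis
next
  case False
  then obtain m where n: "n = int m" by (metis nonneg_int_cases not_less)
  have "subst3 A B C f \<in> gr (int m)" using assms(4) unfolding n
  proof (induction m f rule: gr_induct)
    case (const u)
    then show ?case by (simp add: const3_gr)
  next
    case (decomp n a b c)
    then show ?case
      by (auto simp: is_homD[OF is_hom_subst3] intro!: gr_add gr_mult_eq[OF assms(1)]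
          gr_mult_eq[OF assms(2)] gr_mult_eq[OF assms(3)])
  qed
  then show ?thesis using n by simp
qed

lemma eval3_subst3: "eval3 (subst3 A B C f) p = eval3 f (eval3 A p, eval3 B p, eval3 C p)"
proof -
  have ev: "is_hom (\<lambda>f. eval3 f q)" for q :: "'a point"
    by (simp add: is_hom_def eval3_add eval3_mult)
  show ?thesis
    by (rule is_hom_poly3_eq[where g = "\<lambda>f. eval3 (subst3 A B C f) p"])
       (simp_all add: ev is_hom_comp[OF ev is_hom_subst3])
qed

lemma coords_transfer:
  fixes \<sigma> \<tau> :: "'k::field poly3 \<Rightarrow> 'k poly3"
  assumes hom: "is_hom \<sigma>" "is_hom \<tau>" and inv: "\<And>f. \<tau> (\<sigma> f) = f" "\<And>f. \<sigma> (\<tau> f) = f"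
    and gr: "\<And>f n. f \<in> gr n \<Longrightarrow> \<sigma> f \<in> gr n" "\<And>f n. f \<in> gr n \<Longrightarrow> \<tau> f \<in> gr n"
    and const: "\<And>c. \<sigma> (const3 c) = const3 c"
    and c: "coords (\<sigma> F) d x y"
  shows "coords F d (\<tau> x) (\<tau> y)"
proof -
  note s = is_homD[OF hom(1)] and t = is_homD[OF hom(2)]
  have dvd: "F dvd f \<longleftrightarrow> \<sigma> F dvd \<sigma> f" for f
  proof
    assume "F dvd f"
    then show "\<sigma> F dvd \<sigma> f" by (auto simp: dvd_def s)
  next
    assume "\<sigma> F dvd \<sigma> f"
    then obtain k where "\<sigma> f = \<sigma> F * k" by (auto simp: dvd_def)
    then have "\<tau> (\<sigma> f) = \<tau> (\<sigma> F * k)" by simp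
    then show "F dvd f" by (simp add: t inv)
  qed
  have ssc: "\<sigma> (sc c f) = sc c (\<sigma> f)" for c f by (simp add: sc_def s const)
  have c': "x \<in> gr 1" "y \<in> gr 1" "\<not> \<sigma> F dvd x" "\<not> \<sigma> F dvd y"
    "\<And>N u v. \<sigma> F dvd y ^ N * u - x ^ N * v \<Longrightarrow> (\<exists>w. \<sigma> F dvd u - x ^ N * w \<and> \<sigma> F dvd v - y ^ N * w)"
    "\<And>N n f. n \<ge> 2 * N + d \<Longrightarrow> f \<in> gr (int n) \<Longrightarrow> (\<exists>a b. \<sigma> F dvd f - (x ^ N * a + y ^ N * b))"
    using coordsD[OF c] by blast+
  show ?thesis
    unfolding coords_def
  proof (intro conjI allI impI)
    show "\<tau> x \<in> gr 1" "\<tau> y \<in> gr 1" "\<not> F dvd \<tau> x" "\<not> F dvd \<tau> y"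
      using c' gr by (simp_all add: dvd inv)
  next
    fix N u v assume "F dvd \<tau> y ^ N * u - \<tau> x ^ N * v"
    then have "\<sigma> F dvd y ^ N * \<sigma> u - x ^ N * \<sigma> v" by (simp add: dvd s inv)
    then obtain w where "\<sigma> F dvd \<sigma> u - x ^ N * w" "\<sigma> F dvd \<sigma> v - y ^ N * w" using c'(5) by blast
    then show "\<exists>w. F dvd u - \<tau> x ^ N * w \<and> F dvd v - \<tau> y ^ N * w"
      by (intro exI[of _ "\<tau> w"]) (simp add: dvd s inv)
  next
    fix N n :: nat and f :: "'k poly3" assume nf: "n \<ge> 2 * N + d \<and> f \<in> gr (int n)"
    have "\<exists>a b. \<sigma> F dvd \<sigma> f - (x ^ N * a + y ^ N * b)" by (rule c'(6)[of N n]) (use nf gr in auto)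
    then obtain a b where "\<sigma> F dvd \<sigma> f - (x ^ N * a + y ^ N * b)" by blast
    then show "\<exists>a b. F dvd f - (\<tau> x ^ N * a + \<tau> y ^ N * b)"
      by (intro exI[of _ "\<tau> a"] exI[of _ "\<tau> b"]) (simp add: dvd s inv)
  next
    fix N :: nat assume "N > 0"
    show "\<exists>\<rho>. (\<forall>f g. \<rho> (f + g) = \<rho> f + \<rho> g) \<and> (\<forall>c f. \<rho> (sc c f) = c * \<rho> f) \<and>
        (\<forall>f. \<rho> (F * f) = 0) \<and> (\<forall>f. \<rho> (\<tau> x ^ N * f) = 0) \<and> (\<forall>f. \<rho> (\<tau> y ^ N * f) = 0) \<and>
        (\<forall>i<N. \<forall>a\<in>gr (int i). \<not> F dvd a \<longrightarrow>
           (\<exists>t\<in>gr (int d - 3 + 2 * int N - int i). \<rho> (a * t) \<noteq> (0::'k)))"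
    proof (rule coords_trace[OF c \<open>N > 0\<close>])
      fix \<rho>
      assume r: "\<And>f g. \<rho> (f + g) = \<rho> f + \<rho> g" "\<And>c f. \<rho> (sc c f) = c * \<rho> f"
        "\<And>f. \<rho> (\<sigma> F * f) = 0" "\<And>f. \<rho> (x ^ N * f) = 0" "\<And>f. \<rho> (y ^ N * f) = 0"
        "\<And>i a. i < N \<Longrightarrow> a \<in> gr (int i) \<Longrightarrow> \<not> \<sigma> F dvd a \<Longrightarrow>
           \<exists>t\<in>gr (int d - 3 + 2 * int N - int i). \<rho> (a * t) \<noteq> (0::'k)"
      show ?thesis
      proof (intro exI[of _ "\<lambda>f. \<rho> (\<sigma> f)"] conjI allI impI ballI)
        fix i a assume i: "i < N" and a: "a \<in> gr (int i)" "\<not> F dvd a"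
        then have "\<exists>t\<in>gr (int d - 3 + 2 * int N - int i). \<rho> (\<sigma> a * t) \<noteq> 0"
          using r(6) gr(1) dvd by blast
        then obtain t where "t \<in> gr (int d - 3 + 2 * int N - int i)" "\<rho> (\<sigma> a * t) \<noteq> 0" by blast
        then show "\<exists>t\<in>gr (int d - 3 + 2 * int N - int i). \<rho> (\<sigma> (a * t)) \<noteq> 0"
          by (intro bexI[of _ "\<tau> t"]) (simp_all add: s inv gr)
      qed (simp_all add: s inv r ssc)
    qed
  qed
qed

text \<open>For a form, putting X2 = 1 loses no coefficient, since the exponent of X2 is determined
  by the other two; and a nonzero polynomial in two variables over an infinite field has a nonzero
  value.\<close>

lemma exists_nonzero_value:
  fixes F :: "'k::field_char_0 poly3"
  assumes F: "F \<in> gr (int d)" "F \<noteq> 0"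
  shows "\<exists>a b. eval3 F (a, b, 1) \<noteq> 0"
proof (rule ccontr)
  assume "\<not> ?thesis"
  then have z: "poly (poly (poly F 1) [:b:]) a = 0" for a b
    by (simp add: eval3_def one_pCons)
  define G where "G = poly F 1"
  have "poly G [:b:] = 0" for b
    unfolding G_def using poly_all_0_iff_0[of "poly (poly F 1) [:b:]"] z by blast
  then have "range (\<lambda>b. [:b:]) \<subseteq> {x. poly G x = 0}" by auto
  moreover have "infinite (range (\<lambda>b::'k. [:b:]))"
    by (metis finite_imageD infinite_UNIV_char_0 injI pCons_eq_iff)
  ultimately have "G = 0" using poly_roots_finite[of G] finite_subset by blast
  moreover have "coeff (coeff G j) i = cf F i j (d - i - j)" for i j
  proof -
    have "coeff (coeff G j) i = (\<Sum>l\<le>degree F. cf F i j l)"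
      unfolding G_def by (simp add: poly_altdef coeff_sum)
    also have "\<dots> = (\<Sum>l\<le>max d (degree F). cf F i j l)"
      by (rule sum.mono_neutral_left) (auto simp: coeff_eq_0)
    also have "\<dots> = (\<Sum>l\<in>{d - i - j}. cf F i j l)"
    proof (rule sum.mono_neutral_right)
      have "cf F i j l = 0" if "l \<noteq> d - i - j" for l
        using F(1) that unfolding gr_def by force
      then show "\<forall>l\<in>{..max d (degree F)} - {d - i - j}. cf F i j l = 0" by blast
    qed auto
    finally show ?thesis by simp
  qed
  ultimately have z2: "cf F i j (d - i - j) = 0" for i j by (metis coeff_0)
  have "F = 0"
  proof (rule poly3_eqI)
    fix i j l
    show "cf F i j l = cf 0 i j l"
    proof (cases "i + j + l = d")
      case True
      then have "l = d - i - j" by simp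
      then show ?thesis using z2[of i j] by simp
    next
      case False
      then have "int (i + j + l) \<noteq> int d" by linarith
      then show ?thesis using F(1) unfolding gr_def by auto
    qed
  qed
  then show False using F(2) by simp
qed

text \<open>If F does not vanish at (a, b, 1), the substitution of X0 + a X2 and X1 + b X2 moves
  this point to (0, 0, 1). The value there is the coefficient of X2^d, so the transformed form is
  monic in X2 up to a constant.\<close>

lemma exists_coords:
  fixes F :: "'k::field_char_0 poly3"
  assumes F: "F \<in> gr (int d)" "F \<noteq> 0" and d: "0 < d"
  shows "\<exists>x y. coords F d x y"
proof -
  obtain a b where ab: "eval3 F (a, b, 1) \<noteq> 0" using exists_nonzero_value[OF F] by blast
  define \<sigma> where "\<sigma> = subst3 (X0 + sc a X2) (X1 + sc b X2) X2"
  define \<tau> where "\<tau> = subst3 (X0 - sc a X2) (X1 - sc b X2) X2"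
  have hom: "is_hom \<sigma>" "is_hom \<tau>" unfolding \<sigma>_def \<tau>_def by (rule is_hom_subst3)+
  have id: "is_hom (\<lambda>f :: 'k poly3. f)" by (simp add: is_hom_def)

  have sX: "\<sigma> X0 = X0 + sc a X2" "\<sigma> X1 = X1 + sc b X2" "\<sigma> X2 = X2" "\<sigma> (const3 c) = const3 c"
    and tX: "\<tau> X0 = X0 - sc a X2" "\<tau> X1 = X1 - sc b X2" "\<tau> X2 = X2" "\<tau> (const3 c) = const3 c" for c
    unfolding \<sigma>_def \<tau>_def by simp_all
  have ssc: "\<sigma> (sc c f) = sc c (\<sigma> f)" "\<tau> (sc c f) = sc c (\<tau> f)" for c f
    unfolding sc_def using is_homD(4)[OF hom(1)] is_homD(4)[OF hom(2)] sX(4) tX(4) by auto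
  have inv: "\<tau> (\<sigma> f) = f" "\<sigma> (\<tau> f) = f" for f
  proof -
    show "\<tau> (\<sigma> f) = f"
      by (rule is_hom_poly3_eq[OF is_hom_comp[OF hom(2,1)] id])
         (simp_all add: sX tX is_homD[OF hom(2)] ssc)
    show "\<sigma> (\<tau> f) = f"
      by (rule is_hom_poly3_eq[OF is_hom_comp[OF hom(1,2)] id])
         (simp_all add: sX tX is_homD[OF hom(1)] ssc)
  qed
  have gr: "\<sigma> f \<in> gr n" "\<tau> f \<in> gr n" if "f \<in> gr n" for f n
    unfolding \<sigma>_def \<tau>_def using that by (intro subst3_gr gr_add gr_diff sc_gr X_gr; assumption)+
  have "eval3 (\<sigma> F) (0, 0, 1) \<noteq> 0"
    unfolding \<sigma>_def eval3_subst3 using ab by (simp add: eval3_add)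
  moreover have "eval3 (\<sigma> F) (0, 0, 1) = cf (\<sigma> F) 0 0 d"
  proof -
    have "eval3 (\<sigma> F) (0, 0, 1) = coeff (coeff (poly (\<sigma> F) 1) 0) 0"
      by (simp add: eval3_def poly_0_coeff_0 one_pCons)
    also have "\<dots> = (\<Sum>l\<le>degree (\<sigma> F). cf (\<sigma> F) 0 0 l)" by (simp add: poly_altdef coeff_sum)
    also have "\<dots> = (\<Sum>l\<le>max d (degree (\<sigma> F)). cf (\<sigma> F) 0 0 l)"
      by (rule sum.mono_neutral_left) (auto simp: coeff_eq_0)
    also have "\<dots> = (\<Sum>l\<in>{d}. cf (\<sigma> F) 0 0 l)"
    proof (rule sum.mono_neutral_right)
      have "cf (\<sigma> F) 0 0 l = 0" if "l \<noteq> d" for l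
        using gr(1)[OF F(1)] that unfolding gr_def by force
      then show "\<forall>l\<in>{..max d (degree (\<sigma> F))} - {d}. cf (\<sigma> F) 0 0 l = 0" by blast
    qed auto
    finally show ?thesis by simp
  qed
  ultimately interpret monic_form "\<sigma> F" d
    using gr(1)[OF F(1)] d by unfold_locales simp_all
  show ?thesis using coords_transfer[OF hom inv gr sX(4) coords] by blast
qed

section \<open>The projective Nullstellensatz\<close>

lemma hid_add_principal:
  assumes I: "hid I" and f: "f \<in> gr m"
  shows "hid {a + f * r |a r. a \<in> I}"
  unfolding hid_def
proof (intro conjI ballI allI)
  show "0 \<in> {a + f * r |a r. a \<in> I}" using hidD(1)[OF I] by (auto intro!: exI[of _ 0])
next
  fix u v assume "u \<in> {a + f * r |a r. a \<in> I}" "v \<in> {a + f * r |a r. a \<in> I}"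
  then obtain a r b s where "u = a + f * r" "v = b + f * s" "a \<in> I" "b \<in> I" by blast
  then have "u + v = (a + b) + f * (r + s)" "a + b \<in> I" using hidD(2)[OF I] by (auto simp: algebra_simps)
  then show "u + v \<in> {a + f * r |a r. a \<in> I}" by blast
next
  fix t u assume "u \<in> {a + f * r |a r. a \<in> I}"
  then obtain a r where "u = a + f * r" "a \<in> I" by blast
  then have "t * u = t * a + f * (t * r)" "t * a \<in> I" using hidD(3)[OF I] by (auto simp: algebra_simps)
  then show "t * u \<in> {a + f * r |a r. a \<in> I}" by blast
next
  fix n u assume "u \<in> {a + f * r |a r. a \<in> I}"
  then obtain a r where "u = a + f * r" "a \<in> I" by blast
  then have "hcomp n u = hcomp n a + f * hcomp (n - m) r" "hcomp n a \<in> I"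
    using hidD(5)[OF I] by (auto simp: hcomp_mult_left[OF f])
  then show "hcomp n u \<in> {a + f * r |a r. a \<in> I}" by blast
qed

text \<open>Forms of degree n + m are sums of products of forms of degrees n and m. The induction
  peels off one linear factor, and J stays general because it is replaced by the set of g with X0 g,
  X1 g and X2 g in J.\<close>

lemma gr_mult_closure:
  fixes J :: "'k::field poly3 set"
  assumes "\<And>a b. a \<in> gr (int n) \<Longrightarrow> b \<in> gr (int m) \<Longrightarrow> a * b \<in> J"
    and "\<And>a b. a \<in> J \<Longrightarrow> b \<in> J \<Longrightarrow> a + b \<in> J"
  shows "gr (int (n + m)) \<subseteq> J"
  using assms
proof (induction n arbitrary: J)
  case 0
  then show ?case using one_gr by fastforce
next
  case (Suc n)
  let ?J = "{g. X0 * g \<in> J \<and> X1 * g \<in> J \<and> X2 * g \<in> J}"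
  have "gr (int (n + m)) \<subseteq> ?J"
  proof (rule Suc.IH)
    fix a b :: "'k poly3" assume ab: "a \<in> gr (int n)" "b \<in> gr (int m)"
    have "l * a \<in> gr (int (Suc n))" if "l \<in> gr 1" for l :: "'k poly3"
      using gr_mult[OF that ab(1)] by simp
    then have "l * a * b \<in> J" if "l \<in> gr 1" for l :: "'k poly3" using Suc.prems(1) ab(2) that by blast
    then show "a * b \<in> ?J" by (simp add: mult.assoc)
  next
    fix a b assume "a \<in> ?J" "b \<in> ?J"
    then show "a + b \<in> ?J" using Suc.prems(2) by (simp add: distrib_left)
  qed
  then show ?case
  proof (intro subsetI)
    fix f :: "'k poly3" assume sub: "gr (int (n + m)) \<subseteq> ?J" and f: "f \<in> gr (int (Suc n + m))"
    have eq: "int (Suc n + m) - 1 = int (n + m)" and nz: "int (Suc n + m) \<noteq> 0" by simp_all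
    obtain a b c where abc: "a \<in> gr (int (n + m))" "b \<in> gr (int (n + m))" "c \<in> gr (int (n + m))"
      "f = X0 * a + X1 * b + X2 * c"
      using gr_decompose[OF f nz] unfolding eq by (elim exE conjE)
    have "X0 * a \<in> J" "X1 * b \<in> J" "X2 * c \<in> J" using sub abc(1-3) by blast+
    then show "f \<in> J" unfolding abc(4) by (intro Suc.prems(2))
  qed
qed

text \<open>Maximal homogeneous ideals among those of positive-dimensional quotient; they turn out to be the
  ideals of points.\<close>

locale maximal_relevant =
  fixes P :: "'k::alg_closed_field poly3 set"
  assumes P: "hid P" and relevant: "\<And>n. \<not> gr (int n) \<subseteq> P"
    and maximal: "\<And>J. hid J \<Longrightarrow> P \<subseteq> J \<Longrightarrow> (\<And>n. \<not> gr (int n) \<subseteq> J) \<Longrightarrow> J = P"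
begin

lemma exists_gr_subset:
  assumes f: "f \<in> gr m" "f \<notin> P"
  shows "\<exists>N. \<forall>n\<ge>N. gr (int n) \<subseteq> {a + f * r |a r. a \<in> P}"
proof -
  let ?J = "{a + f * r |a r. a \<in> P}"
  have J: "hid ?J" by (rule hid_add_principal[OF P f(1)])
  have "f \<in> ?J" using hidD(1)[OF P] by (intro CollectI exI[of _ 0] exI[of _ 1]) auto
  moreover have "P \<subseteq> ?J"
  proof
    fix a assume "a \<in> P"
    then show "a \<in> ?J" by (intro CollectI exI[of _ a] exI[of _ 0]) simp
  qed
  ultimately obtain N where "gr (int N) \<subseteq> ?J" using maximal[OF J] f(2) by blast
  then show ?thesis using hid_gr_mono[OF J, of "int N"] by (meson of_nat_0_le_iff of_nat_mono)
qed

text \<open>By maximality P + (f) and P + (g) contain all forms of some degrees N and M. Products of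
  such forms lie in P + (f g), so f g in P would put all forms of degree N + M into P.\<close>

lemma prime:
  assumes f: "f \<in> gr m" "f \<notin> P" and g: "g \<in> gr k" "g \<notin> P"
  shows "f * g \<notin> P"
proof
  assume fg: "f * g \<in> P"
  obtain N where N: "gr (int N) \<subseteq> {a + f * r |a r. a \<in> P}" using exists_gr_subset[OF f] by blast
  obtain M where M: "gr (int M) \<subseteq> {a + g * r |a r. a \<in> P}" using exists_gr_subset[OF g] by blast
  have "gr (int (N + M)) \<subseteq> P"
  proof (rule gr_mult_closure)
    fix u v :: "'k poly3" assume "u \<in> gr (int N)" "v \<in> gr (int M)"
    then obtain a r b s where uv: "u = a + f * r" "v = b + g * s" "a \<in> P" "b \<in> P" using N M by blast
    have "u * v = a * v + f * r * b + (f * g) * (r * s)" unfolding uv by (simp add: algebra_simps)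
    also have "\<dots> \<in> P" by (intro hidD(2)[OF P] hidD(3)[OF P uv(4)] hidD(4)[OF P uv(3)] hidD(4)[OF P fg])
    finally show "u * v \<in> P" .
  qed (rule hidD(2)[OF P])
  then show False using relevant by blast
qed

lemma one_not_mem: "1 \<notin> P"
  using relevant[of 0] hidD(3)[OF P, of 1] by (metis mult_1_right subsetI)

lemma power_not_mem: "f \<in> gr m \<Longrightarrow> f \<notin> P \<Longrightarrow> f ^ n \<notin> P"
  by (induction n) (auto simp: one_not_mem dest: prime[OF _ _ gr_power])

lemma mult_mem_iff:
  assumes f: "f \<in> gr m" "f \<notin> P"
  shows "f * v \<in> P \<longleftrightarrow> v \<in> P"
proof
  assume fv: "f * v \<in> P"
  show "v \<in> P"
  proof (rule hid_memI[OF P])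
    fix n
    have "f * hcomp n v = hcomp (n + m) (f * v)" by (simp add: hcomp_mult_left[OF f(1)])
    then have "f * hcomp n v \<in> P" using hidD(5)[OF P fv] by simp
    then show "hcomp n v \<in> P" using prime[OF f hcomp_gr] by blast
  qed
qed (rule hidD(3)[OF P])

text \<open>A linear form f outside P acts injectively on the quotient by P, and surjectively in
  large degrees because P + (f) then contains everything. Hence the Hilbert function of the quotient
  is eventually nonincreasing.\<close>

lemma qdim_bounded: "\<exists>D N. \<forall>n\<ge>N. lin3.qdim P (gr (int n)) \<le> D"
proof -
  have "\<exists>f\<in>gr 1. f \<notin> P" using relevant[of 1] by auto
  then obtain f where f: "f \<in> gr 1" "f \<notin> P" by blast
  obtain N where N: "\<And>n. n \<ge> N \<Longrightarrow> gr (int n) \<subseteq> {a + f * r |a r. a \<in> P}"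
    using exists_gr_subset[OF f] by blast
  have "lin3.qdim P (gr (int n)) \<le> lin3.qdim P (gr (int N))" if "N \<le> n" for n
    using that
  proof (induction n rule: dec_induct)
    case (step n)
    have sub: "lin3.subspace P" by (rule hid_subspace[OF P])
    have "lin3.qdim P (gr (int (Suc n))) \<le> lin3.qdim P ((*) f ` gr (int n))"
    proof (rule lin3.qdim_mono[OF sub lin3.fin_dim_image[OF linear_mult fin_dim_gr]])
      fix v :: "'k poly3" assume v: "v \<in> gr (int (Suc n))"
      then obtain a r where ar: "v = a + f * r" "a \<in> P" using N[of "Suc n"] step.hyps by auto
      have "v = hcomp (int (Suc n)) v" using hcomp_of_gr[OF v] by simp
      also have "\<dots> = hcomp (int (Suc n)) a + f * hcomp (int n) r"
        unfolding ar by (simp add: hcomp_mult_left[OF f(1)])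
      finally have "v - f * hcomp (int n) r = hcomp (int (Suc n)) a" by simp
      then have "v - f * hcomp (int n) r \<in> P" using hidD(5)[OF P ar(2)] by simp
      then show "\<exists>w\<in>(*) f ` gr (int n). v - w \<in> P" by (intro bexI[of _ "f * hcomp (int n) r"]) auto
    qed
    also have "\<dots> = lin3.qdim P (gr (int n))"
      by (rule lin3.qdim_inj_image[OF sub linear_mult subspace_gr fin_dim_gr mult_mem_iff[OF f]])
    finally show ?case using step.IH by simp
  qed simp
  then show ?thesis by blast
qed

text \<open>The homogenisation v^n p(u / v). The degree of p may be smaller than n; then a power of
  v splits off.\<close>

definition homog :: "'k poly \<Rightarrow> nat \<Rightarrow> 'k poly3 \<Rightarrow> 'k poly3 \<Rightarrow> 'k poly3" where
  "homog p n u v = (\<Sum>i\<le>n. sc (coeff p i) (u ^ i * v ^ (n - i)))"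

lemma homog_gr:
  assumes "u \<in> gr 1" "v \<in> gr 1"
  shows "homog p n u v \<in> gr (int n)"
  unfolding homog_def
proof (intro gr_sum sc_gr)
  fix i assume "i \<in> {..n}"
  then show "u ^ i * v ^ (n - i) \<in> gr (int n)"
    by (intro gr_mult_eq[OF gr_power_one[OF assms(1)] gr_power_one[OF assms(2)]]) auto
qed

lemma homog_Suc: "degree p \<le> n \<Longrightarrow> homog p (Suc n) u v = v * homog p n u v"
proof -
  assume "degree p \<le> n"
  then have "coeff p (Suc n) = 0" by (simp add: coeff_eq_0)
  then have "homog p (Suc n) u v = (\<Sum>i\<le>n. sc (coeff p i) (u ^ i * v ^ (Suc n - i)))"
    by (simp add: homog_def)
  also have "\<dots> = (\<Sum>i\<le>n. v * sc (coeff p i) (u ^ i * v ^ (n - i)))"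
    by (intro sum.cong refl) (simp add: Suc_diff_le sc_def algebra_simps)
  finally show ?thesis by (simp add: homog_def sum_distrib_left)
qed

lemma homog_linear_factor:
  assumes "degree q \<le> n"
  shows "homog ([:- c, 1:] * q) (Suc n) u v = (u - sc c v) * homog q n u v"
proof -
  have 0: "coeff q (Suc n) = 0" using assms by (simp add: coeff_eq_0)
  let ?p = "[:- c, 1:] * q"
  have cp: "coeff ?p i = coeff (pCons 0 q) i - c * coeff q i" for i by simp
  have scd: "sc (a - b) f = sc a f - sc b f" for a b and f :: "'k poly3"
    by (rule lin3.scale_left_diff_distrib)
  have "homog ?p (Suc n) u v = (\<Sum>i\<le>Suc n. sc (coeff (pCons 0 q) i) (u ^ i * v ^ (Suc n - i)))
      - (\<Sum>i\<le>Suc n. sc (c * coeff q i) (u ^ i * v ^ (Suc n - i)))"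
    unfolding homog_def cp scd by (rule sum_subtractf)
  also have "(\<Sum>i\<le>Suc n. sc (coeff (pCons 0 q) i) (u ^ i * v ^ (Suc n - i))) = u * homog q n u v"
    unfolding sum.atMost_Suc_shift homog_def sum_distrib_left
    by (simp add: sc_def algebra_simps const3_def[of 0])
  also have "(\<Sum>i\<le>Suc n. sc (c * coeff q i) (u ^ i * v ^ (Suc n - i))) = sc c (homog q (Suc n) u v)"
    by (simp only: homog_def lin3.scale_sum_right lin3.scale_scale)
  also have "\<dots> = sc c v * homog q n u v" unfolding homog_Suc[OF assms] by (simp add: sc_def)
  finally show ?thesis by (simp add: algebra_simps)
qed

text \<open>Over an algebraically closed field p splits, so its homogenisation is a product of
  factors u - c v, a power of v and a nonzero constant; P is prime and contains no nonzero
  constant.\<close>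

lemma linear_factor_mem:
  assumes u: "u \<in> gr 1" and v: "v \<in> gr 1"
  shows "p \<noteq> 0 \<Longrightarrow> degree p \<le> n \<Longrightarrow> homog p n u v \<in> P \<Longrightarrow>
    v \<in> P \<or> (\<exists>c. u - sc c v \<in> P)"
proof (induction n arbitrary: p)
  case 0
  then obtain c where c: "p = [:c:]" using degree_eq_zeroE[of p] by auto
  then have "c \<noteq> 0" using 0 by simp
  then have "sc c 1 \<in> P" using 0 c by (simp add: homog_def)
  then have "sc (1 / c) (sc c 1) \<in> P" by (rule hidD(8)[OF P])
  then show ?case using \<open>c \<noteq> 0\<close> one_not_mem by (simp add: lin3.scale_one)
next
  case (Suc n)
  show ?case
  proof (cases "degree p \<le> n")
    case True
    then have "v * homog p n u v \<in> P" using Suc.prems(3) homog_Suc by metis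
    then show ?thesis using prime[OF v _ homog_gr[OF u v]] Suc.IH[OF Suc.prems(1) True] by blast
  next
    case False
    then have deg: "degree p = Suc n" using Suc.prems(2) by simp
    then obtain c where "poly p c = 0" using alg_closed_imp_poly_has_root[of p] by auto
    then obtain q where q: "p = [:- c, 1:] * q" using poly_eq_0_iff_dvd by (metis dvdE)
    have qnz: "q \<noteq> 0" using q Suc.prems(1) by auto
    have "degree p = 1 + degree q" unfolding q by (subst degree_mult_eq) (use qnz in auto)
    then have dq: "degree q \<le> n" using deg by simp
    have "(u - sc c v) * homog q n u v \<in> P"
      using Suc.prems(3) homog_linear_factor[OF dq] q by metis
    then show ?thesis
      using prime[OF gr_diff[OF u sc_gr[OF v]] _ homog_gr[OF u v]] Suc.IH[OF qnz dq] by blast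
  qed
qed

text \<open>The bounded Hilbert function forces a linear relation modulo P among the n + 1 monomials
  u^i v^(n-i). In other words u / v is algebraic over k, hence a constant.\<close>

lemma proportional:
  assumes u: "u \<in> gr 1" and v: "v \<in> gr 1" "v \<notin> P"
  shows "\<exists>c. u - sc c v \<in> P"
proof -
  obtain D N where D: "\<forall>n\<ge>N. lin3.qdim P (gr (int n)) \<le> D" using qdim_bounded by blast
  define n where "n = max N D"
  have "\<exists>c. (\<exists>i\<le>n. c i \<noteq> 0) \<and> (\<Sum>i\<le>n. sc (c i) (u ^ i * v ^ (n - i))) \<in> P"
  proof (rule lin3.exists_relation_mod[OF hid_subspace[OF P] fin_dim_gr])
    show "u ^ i * v ^ (n - i) \<in> gr (int n)" if "i \<le> n" for i
      using that by (intro gr_mult_eq[OF gr_power_one[OF u] gr_power_one[OF v(1)]]) auto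
    show "lin3.qdim P (gr (int n)) \<le> n" using D unfolding n_def by (metis le_trans max.cobounded1 max.cobounded2)
  qed
  then obtain c where c: "\<exists>i\<le>n. c i \<noteq> 0" "(\<Sum>i\<le>n. sc (c i) (u ^ i * v ^ (n - i))) \<in> P" by blast
  define p where "p = (\<Sum>i\<le>n. monom (c i) i)"
  have cp: "coeff p i = (if i \<le> n then c i else 0)" for i
    by (auto simp: p_def coeff_sum)
  have "p \<noteq> 0" using c(1) cp by (metis coeff_0)
  moreover have "degree p \<le> n" by (rule degree_le) (simp add: cp)
  moreover have "homog p n u v \<in> P" using c(2) by (simp add: homog_def cp)
  ultimately show ?thesis using linear_factor_mem[OF u v(1)] v(2) by blast
qed

text \<open>Each coordinate is congruent modulo P to a multiple c_i l of one linear form l outside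
  P, and the c_i are the coordinates of the zero: a form f of degree n is congruent to f(c0, c1, c2)
  l^n, while l^n is not in P.\<close>

lemma exists_zero: "\<exists>p. p \<noteq> (0, 0, 0) \<and> (\<forall>f\<in>P. eval3 f p = 0)"
proof -
  have "\<exists>l\<in>{X0, X1, X2}. l \<notin> P"
  proof (rule ccontr)
    assume "\<not> ?thesis"
    then have "gr 1 \<subseteq> P" using gr_decompose[of _ 1] by (auto intro!: hidD(2,4)[OF P])
    then show False using relevant[of 1] by simp
  qed
  then obtain l where l: "l \<in> {X0, X1, X2}" "l \<notin> P" by blast
  then have lgr: "l \<in> gr 1" by auto
  obtain c0 c1 c2 where c: "X0 - sc c0 l \<in> P" "X1 - sc c1 l \<in> P" "X2 - sc c2 l \<in> P"
    using proportional[OF _ lgr l(2)] by (metis X_gr)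
  let ?q = "(c0, c1, c2)"
  have eq: "f - sc (eval3 f ?q) (l ^ n) \<in> P" if "f \<in> gr (int n)" for f n
    using that
  proof (induction n f rule: gr_induct)
    case (const u)
    then show ?case using hidD(1)[OF P] by (simp add: sc_def)
  next
    case (decomp n f g h)
    let ?e = "\<lambda>f. eval3 f ?q"
    have "X0 * f + X1 * g + X2 * h - sc (?e (X0 * f + X1 * g + X2 * h)) (l ^ Suc n) =
      (X0 * (f - sc (?e f) (l ^ n)) + sc (?e f) (l ^ n) * (X0 - sc c0 l)) +
      (X1 * (g - sc (?e g) (l ^ n)) + sc (?e g) (l ^ n) * (X1 - sc c1 l)) +
      (X2 * (h - sc (?e h) (l ^ n)) + sc (?e h) (l ^ n) * (X2 - sc c2 l))"
    proof -
      have "const3 (a + b) = const3 a + const3 b" "const3 (a * b) = const3 a * const3 b" for a b :: 'k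
        by (simp_all add: const3_def)
      then show ?thesis by (simp add: sc_def eval3_add eval3_mult algebra_simps)
    qed
    also have "\<dots> \<in> P" by (intro hidD(2)[OF P] hidD(3)[OF P] decomp.IH c)
    finally show ?case .
  qed
  have "?q \<noteq> (0, 0, 0)"
  proof
    assume q0: "?q = (0, 0, 0)"
    have "l \<in> P" using c l(1) q0 by (auto simp: sc_def const3_def)
    then show False using l by simp
  qed
  moreover have "eval3 f ?q = 0" if f: "f \<in> P" for f
  proof -
    have "eval3 (hcomp (int k) f) ?q = 0" for k
    proof (rule ccontr)
      assume nz: "eval3 (hcomp (int k) f) ?q \<noteq> 0"
      let ?c = "eval3 (hcomp (int k) f) ?q"
      have "hcomp (int k) f - (hcomp (int k) f - sc ?c (l ^ k)) \<in> P"
        by (rule hidD(7)[OF P hidD(5)[OF P f] eq[OF hcomp_gr]])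
      then have "sc ?c (l ^ k) \<in> P" by simp
      then have "sc (1 / ?c) (sc ?c (l ^ k)) \<in> P" by (rule hidD(8)[OF P])
      then have "l ^ k \<in> P" using nz by (simp add: lin3.scale_one)
      then show False using power_not_mem[OF lgr l(2)] by blast
    qed
    moreover obtain D where "f = (\<Sum>k<D. hcomp (int k) f)" using exists_sum_hcomp by blast
    ultimately show ?thesis by (metis (no_types, lifting) eval3_sum sum.neutral)
  qed
  ultimately show ?thesis by blast
qed

end

lemma exists_maximal_relevant:
  fixes I :: "'k::alg_closed_field poly3 set"
  assumes I: "hid I" "\<And>n. \<not> gr (int n) \<subseteq> I"
  shows "\<exists>P. I \<subseteq> P \<and> maximal_relevant P"
proof -
  let ?A = "{J. hid J \<and> I \<subseteq> J \<and> (\<forall>n. \<not> gr (int n) \<subseteq> J)}"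
  have "\<exists>M\<in>?A. \<forall>K\<in>?A. M \<subseteq> K \<longrightarrow> K = M"
  proof (rule subset_Zorn_nonempty)
    show "?A \<noteq> {}" using I by auto
    fix C assume C: "C \<noteq> {}" "subset.chain ?A C"
    have CA: "hid J" "I \<subseteq> J" "\<not> gr (int n) \<subseteq> J" if "J \<in> C" for J n
      using C(2) that unfolding subset.chain_def by auto
    have "hid (\<Union>C)"
      unfolding hid_def
    proof (intro conjI ballI allI)
      show "0 \<in> \<Union>C" using C(1) CA(1) hidD(1) by blast
      fix a assume a: "a \<in> \<Union>C"
      then obtain J where J: "J \<in> C" "a \<in> J" by blast
      show "r * a \<in> \<Union>C" for r using J CA(1) hidD(3) by blast
      show "hcomp n a \<in> \<Union>C" for n using J CA(1) hidD(5) by blast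
      fix b assume "b \<in> \<Union>C"
      then obtain K where K: "K \<in> C" "b \<in> K" by blast
      have "J \<subseteq> K \<or> K \<subseteq> J" using C(2) J(1) K(1) unfolding subset.chain_def by blast
      then show "a + b \<in> \<Union>C" using J K CA(1) hidD(2) by (metis UnionI subsetD)
    qed
    moreover have "I \<subseteq> \<Union>C" using C(1) CA(2) by blast
    \<comment> \<open>The forms of degree n are spanned by finitely many monomials, and these would
      all lie in a single member of the chain.\<close>
    moreover have "\<not> gr (int n) \<subseteq> \<Union>C" for n
    proof
      assume "gr (int n) \<subseteq> \<Union>C"
      then have "mon ` exps n \<subseteq> \<Union>C" using span_mon lin3.span_superset by blast
      then obtain B where B: "B \<in> C" "mon ` exps n \<subseteq> B"
        using finite_subset_Union_chain[OF _ _ C] by (metis finite_exps finite_imageI)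
      then have "lin3.span (mon ` exps n) \<subseteq> B"
        using lin3.span_minimal[OF B(2) hid_subspace] CA(1) by blast
      then show False using CA(3)[OF B(1)] span_mon by blast
    qed
    ultimately show "\<Union>C \<in> ?A" by blast
  qed
  then obtain M where M: "M \<in> ?A" "\<forall>K\<in>?A. M \<subseteq> K \<longrightarrow> K = M" by blast
  then have "maximal_relevant M" by unfold_locales (simp_all, metis subset_trans)
  then show ?thesis using M by blast
qed

theorem projective_nullstellensatz:
  fixes I :: "'k::alg_closed_field poly3 set"
  assumes "hid I" "\<And>p. p \<noteq> (0, 0, 0) \<Longrightarrow> \<exists>f\<in>I. eval3 f p \<noteq> 0"
  shows "\<exists>N. gr (int N) \<subseteq> I"
  using exists_maximal_relevant[OF assms(1)] maximal_relevant.exists_zero assms(2) by blast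

subsection \<open>Schemes of bounded Hilbert function have finite support\<close>

lemma proj_point_scale:
  assumes "t \<noteq> 0"
  shows "proj_point (t * a, t * b, t * c) = proj_point (a, b, c :: 'k::field)"
proof -
  have "(s * (t * a), s * (t * b), s * (t * c)) \<in> range (\<lambda>u. (u * a, u * b, u * c))" for s
    by (rule image_eqI[of _ _ "s * t"]) (simp_all add: mult.assoc)
  moreover have "(s * a, s * b, s * c) \<in> range (\<lambda>u. (u * (t * a), u * (t * b), u * (t * c)))" for s
    by (rule image_eqI[of _ _ "s / t"]) (use assms in simp_all)
  ultimately show ?thesis unfolding proj_point_def by auto
qed

lemma exists_separating_form:
  fixes p q :: "'k::field point"
  assumes "p \<noteq> (0, 0, 0)" "q \<noteq> (0, 0, 0)" "proj_point p \<noteq> proj_point q"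
  shows "\<exists>l\<in>gr 1. eval3 l q = 0 \<and> eval3 l p \<noteq> 0"
proof (rule ccontr)
  assume no: "\<not> ?thesis"
  obtain a b c a' b' c' where p: "p = (a, b, c)" and q: "q = (a', b', c')" by (metis prod_cases3)
  have g: "sc u l - sc v m \<in> gr 1" if "l \<in> gr 1" "m \<in> gr 1" for u v :: 'k and l m
    using that by (intro gr_diff sc_gr)
  have z: "b' * a = a' * b" "c' * a = a' * c" "c' * b = b' * c"
    using no g[OF X_gr(1,2), of b' a'] g[OF X_gr(1,3), of c' a'] g[OF X_gr(2,3), of c' b']
    by (auto simp: p q eval3_diff mult.commute)
  have "\<exists>t. p = (t * a', t * b', t * c')"
  proof -
    consider "a' \<noteq> 0" | "b' \<noteq> 0" | "c' \<noteq> 0" using assms(2) q by auto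
    then show ?thesis
    proof cases
      case 1 then show ?thesis using z unfolding p by (intro exI[of _ "a / a'"]) (simp add: field_simps)
    next
      case 2 then show ?thesis using z unfolding p by (intro exI[of _ "b / b'"]) (simp add: field_simps)
    next
      case 3 then show ?thesis using z unfolding p by (intro exI[of _ "c / c'"]) (simp add: field_simps)
    qed
  qed
  then obtain t where t: "p = (t * a', t * b', t * c')" by blast
  then have "t \<noteq> 0" using assms(1) by auto
  then show False using proj_point_scale assms(3) t q by metis
qed

lemma exists_form_nonzero_at:
  assumes "p \<noteq> (0, 0, 0)"
  shows "\<exists>l\<in>gr 1. eval3 l p \<noteq> (0 :: 'k::field)"
proof -
  obtain a b c where p: "p = (a, b, c)" by (metis prod_cases3)
  have "eval3 X0 p \<noteq> 0 \<or> eval3 X1 p \<noteq> 0 \<or> eval3 X2 p \<noteq> 0" using assms p by auto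
  then show ?thesis using X_gr by blast
qed

text \<open>Given D + 1 points of the support, products of linear forms separating them yield D + 1
  forms of one degree, each nonzero at exactly one of these points; such forms are independent
  modulo I.\<close>

lemma finite_support_of_bounded:
  assumes I: "hid I" and D: "\<And>n. n \<ge> n0 \<Longrightarrow> lin3.qdim I (gr (int n)) \<le> D"
  shows "finite (support (I :: 'k::field poly3 set))"
proof (rule ccontr)
  assume "infinite (support I)"
  then obtain S where S: "finite S" "card S = Suc D" "S \<subseteq> support I"
    using infinite_arbitrarily_large by blast
  obtain s where s: "bij_betw s {..D} S"
    using S(1,2) by (metis bij_betw_iff_card card_atMost finite_atMost)
  have "\<forall>i. \<exists>p. i \<le> D \<longrightarrow> s i = proj_point p \<and> p \<noteq> (0, 0, 0) \<and> (\<forall>f \<in> I. eval3 f p = 0)"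
  proof
    fix i
    show "\<exists>p. i \<le> D \<longrightarrow> s i = proj_point p \<and> p \<noteq> (0, 0, 0) \<and> (\<forall>f \<in> I. eval3 f p = 0)"
    proof (cases "i \<le> D")
      case True
      then have "s i \<in> support I" using s S(3) unfolding bij_betw_def by auto
      then show ?thesis unfolding support_def by blast
    qed auto
  qed
  then obtain p where p: "\<And>i. i \<le> D \<Longrightarrow> s i = proj_point (p i)" "\<And>i. i \<le> D \<Longrightarrow> p i \<noteq> (0, 0, 0)"
      "\<And>i f. i \<le> D \<Longrightarrow> f \<in> I \<Longrightarrow> eval3 f (p i) = 0"
    by metis
  have "\<exists>l. i \<le> D \<longrightarrow> j \<le> D \<longrightarrow> i \<noteq> j \<longrightarrow> l \<in> gr 1 \<and> eval3 l (p j) = 0 \<and> eval3 l (p i) \<noteq> 0" for i j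
  proof (cases "i \<le> D \<and> j \<le> D \<and> i \<noteq> j")
    case True
    then have "proj_point (p i) \<noteq> proj_point (p j)"
      using p(1) s unfolding bij_betw_def inj_on_def by (metis atMost_iff)
    then show ?thesis using exists_separating_form p(2) True by blast
  qed auto
  then obtain l where l: "\<And>i j. i \<le> D \<Longrightarrow> j \<le> D \<Longrightarrow> i \<noteq> j \<Longrightarrow>
      l i j \<in> gr 1 \<and> eval3 (l i j) (p j) = 0 \<and> eval3 (l i j) (p i) \<noteq> 0" by metis
  have "\<exists>l. i \<le> D \<longrightarrow> l \<in> gr 1 \<and> eval3 l (p i) \<noteq> 0" for i
    using exists_form_nonzero_at[OF p(2), of i] by blast
  then obtain m where m: "\<And>i. i \<le> D \<Longrightarrow> m i \<in> gr 1 \<and> eval3 (m i) (p i) \<noteq> 0" by metis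
  define n where "n = max n0 D"
  \<comment> \<open>The power of m i raises the degree from D to n without introducing a zero at p
    i.\<close>
  define f where "f i = (\<Prod>j\<in>{..D} - {i}. l i j) * m i ^ (n - D)" for i
  have prod_gr: "finite A \<Longrightarrow> (\<And>j. j \<in> A \<Longrightarrow> g j \<in> gr 1) \<Longrightarrow> prod g A \<in> gr (int (card A))"
    for A :: "nat set" and g :: "nat \<Rightarrow> 'k poly3"
    by (induction A rule: finite_induct) (auto simp: one_gr intro: gr_mult_eq)
  have fgr: "f i \<in> gr (int n)" if "i \<le> D" for i
  proof -
    have "(\<Prod>j\<in>{..D} - {i}. l i j) \<in> gr (int (card ({..D} - {i})))"
      by (rule prod_gr) (use l that in auto)
    moreover have "card ({..D} - {i}) = D" using that by simp
    ultimately show ?thesis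
      unfolding f_def using gr_power_one[of "m i" "n - D"] m[OF that]
      by (intro gr_mult_eq) (auto simp: n_def)
  qed
  have off: "eval3 (f i) (p j) = 0" if "i \<le> D" "j \<le> D" "i \<noteq> j" for i j
  proof -
    have "eval3 (\<Prod>j\<in>{..D} - {i}. l i j) (p j) = 0"
      unfolding eval3_prod by (rule prod_zero) (use l that in auto)
    then show ?thesis by (simp add: f_def eval3_mult)
  qed
  have on: "eval3 (f i) (p i) \<noteq> 0" if "i \<le> D" for i
    using l[of i] m that by (auto simp: f_def eval3_mult eval3_prod eval3_power)
  have nD: "lin3.qdim I (gr (int n)) \<le> D" by (rule D) (simp add: n_def)
  have "\<exists>c. (\<exists>i\<le>D. c i \<noteq> 0) \<and> (\<Sum>i\<le>D. sc (c i) (f i)) \<in> I"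
    by (rule lin3.exists_relation_mod[OF hid_subspace[OF I] fin_dim_gr fgr nD])
  then obtain c j where c: "j \<le> D" "c j \<noteq> 0" "(\<Sum>i\<le>D. sc (c i) (f i)) \<in> I" by blast
  have "0 = eval3 (\<Sum>i\<le>D. sc (c i) (f i)) (p j)" using p(3) c by simp
  also have "\<dots> = (\<Sum>i\<le>D. if i = j then c j * eval3 (f j) (p j) else 0)"
    unfolding eval3_sum by (intro sum.cong refl) (use off c in auto)
  also have "\<dots> = c j * eval3 (f j) (p j)" using c by simp
  finally show False using on c by simp
qed

context lin_space
begin

lemma qdim_sums_le:
  assumes P: "subspace P" and A: "subspace A" "fin_dim A" and B: "subspace B" "fin_dim B"
    and C: "\<And>c. c \<in> C \<Longrightarrow> \<exists>a\<in>A. c - a \<in> P" "\<And>c. c \<in> C \<Longrightarrow> \<exists>b\<in>B. c - b \<in> P"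
  shows "qdim P {a + b |a b. a \<in> A \<and> b \<in> B} + qdim P C \<le> qdim P A + qdim P B"
proof -
  have fin: "fin_dim (proj P ` A)" by (rule fin_dim_image[OF linear_proj[OF P] A(2)])
  have "proj P ` C \<subseteq> proj P ` A \<inter> proj P ` B"
    using proj_image_mono[OF P C(1)] proj_image_mono[OF P C(2)] by blast
  then have "dim (proj P ` C) \<le> dim (proj P ` A \<inter> proj P ` B)"
    by (rule dim_mono_fin_dim[OF fin_dim_subset[OF fin], rotated]) auto
  then show ?thesis
    unfolding qdim_def proj_image_sums[OF P]
    using dim_sums[OF subspace_proj_image[OF P A(1)] fin subspace_proj_image[OF P B(1)]
        fin_dim_image[OF linear_proj[OF P] B(2)]] by simp
qed

end

section \<open>Hilbert functions on a plane curve\<close>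

locale plane_curve =
  fixes F :: "'k::{alg_closed_field,field_char_0} poly3" and d :: nat
  assumes F_gr: "F \<in> gr (int d)" and F_prime: "prime_elem F" and d_pos: "0 < d"
begin

definition x :: "'k poly3" where "x = fst (SOME p. coords F d (fst p) (snd p))"
definition y :: "'k poly3" where "y = snd (SOME p. coords F d (fst p) (snd p))"

lemma coords_xy: "coords F d x y"
proof -
  have "F \<noteq> 0" using F_prime by auto
  then have "\<exists>p. coords F d (fst p) (snd p)" using exists_coords[OF F_gr _ d_pos] by auto
  then show ?thesis unfolding x_def y_def by (rule someI_ex)
qed

lemmas x_gr = coordsD(1)[OF coords_xy] and y_gr = coordsD(2)[OF coords_xy]
  and x_ndvd = coordsD(3)[OF coords_xy] and y_ndvd = coordsD(4)[OF coords_xy]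

lemma x_pow_gr: "x ^ N \<in> gr (int N)" and y_pow_gr: "y ^ N \<in> gr (int N)"
  using gr_power_one[OF x_gr] gr_power_one[OF y_gr] by blast+

lemma dvd_mult_iff: "F dvd a * b \<longleftrightarrow> F dvd a \<or> F dvd b"
  by (rule prime_elem_dvd_mult_iff[OF F_prime])

lemma pow_ndvd: "\<not> F dvd x ^ N" "\<not> F dvd y ^ N"
  using prime_elem_dvd_power[OF F_prime] x_ndvd y_ndvd by blast+

abbreviation cong :: "'k poly3 \<Rightarrow> 'k poly3 \<Rightarrow> bool" (infix \<open>\<doteq>\<close> 50) where
  "f \<doteq> g \<equiv> F dvd f - g"

lemma cong_refl [simp]: "f \<doteq> f" by simp

lemma cong_sym: "f \<doteq> g \<Longrightarrow> g \<doteq> f" by (metis dvd_minus_iff minus_diff_eq)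

lemma cong_trans: "f \<doteq> g \<Longrightarrow> g \<doteq> h \<Longrightarrow> f \<doteq> h"
  using dvd_add[of F "f - g" "g - h"] by simp

lemma cong_add: "f \<doteq> g \<Longrightarrow> f' \<doteq> g' \<Longrightarrow> f + f' \<doteq> g + g'"
  using dvd_add[of F "f - g" "f' - g'"] by (simp add: algebra_simps)

lemma cong_mult_left: "f \<doteq> g \<Longrightarrow> a * f \<doteq> a * g"
  using dvd_mult[of F "f - g" a] by (simp add: algebra_simps)

lemma cong_mult_right: "f \<doteq> g \<Longrightarrow> f * a \<doteq> g * a"
  using dvd_mult2[of F "f - g" a] by (simp add: algebra_simps)

lemma cong_cancel: "a * f \<doteq> a * g \<Longrightarrow> \<not> F dvd a \<Longrightarrow> f \<doteq> g"
  using dvd_mult_iff[of a "f - g"] by (simp add: algebra_simps)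

lemma cong_hcomp: "f \<doteq> g \<Longrightarrow> hcomp n f \<doteq> hcomp n g"
  using hcomp_dvd[OF F_gr, of "f - g" n] by simp

lemma cong_dvd: "f \<doteq> g \<Longrightarrow> F dvd f \<longleftrightarrow> F dvd g"
  using dvd_add_right_iff[of F "f - g" g] by simp

abbreviation zeroF :: "'k poly3 set" where "zeroF \<equiv> {f. F dvd f}"

lemma sub_zeroF: "lin3.subspace zeroF"
  by (rule hid_subspace[OF hid_dvd[OF F_gr]])

text \<open>The dimension of the image of V in S, taken as an integer because differences of such
  dimensions are formed all the time.\<close>

definition rd :: "'k poly3 set \<Rightarrow> int" where "rd V = int (lin3.qdim zeroF V)"

definition H :: "'k poly3 set \<Rightarrow> int \<Rightarrow> int" where "H I n = rd (I \<inter> gr n)"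

lemma rd_nonneg [simp]: "0 \<le> rd V" by (simp add: rd_def)

lemma H_nonneg [simp]: "0 \<le> H I n" by (simp add: H_def)

lemma fin_dim_piece: "lin3.fin_dim (I \<inter> gr n)"
  by (rule lin3.fin_dim_subset[OF fin_dim_gr]) auto

lemma subspace_piece: "hid I \<Longrightarrow> lin3.subspace (I \<inter> gr n)"
  by (intro lin3.subspace_inter hid_subspace subspace_gr)

lemma hid_UNIV: "hid UNIV" by (simp add: hid_def)

lemma rd_mono: "lin3.fin_dim W \<Longrightarrow> (\<And>v. v \<in> V \<Longrightarrow> \<exists>w\<in>W. v \<doteq> w) \<Longrightarrow> rd V \<le> rd W"
  unfolding rd_def using lin3.qdim_mono[OF sub_zeroF, of W V] by simp

lemma rd_cong: "(\<And>v. v \<in> V \<Longrightarrow> \<exists>w\<in>W. v \<doteq> w) \<Longrightarrow> (\<And>w. w \<in> W \<Longrightarrow> \<exists>v\<in>V. w \<doteq> v) \<Longrightarrow> rd V = rd W"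
  unfolding rd_def using lin3.qdim_cong[OF sub_zeroF, of V W] by simp

lemma rd_mult:
  assumes "\<not> F dvd u" "lin3.subspace V" "lin3.fin_dim V"
  shows "rd ((*) u ` V) = rd V"
  unfolding rd_def
  using lin3.qdim_inj_image[OF sub_zeroF linear_mult[of u] assms(2,3)] assms(1) by (simp add: dvd_mult_iff)

lemma rd_eq_0: "(\<And>v. v \<in> V \<Longrightarrow> F dvd v) \<Longrightarrow> rd V = 0"
proof -
  assume a: "\<And>v. v \<in> V \<Longrightarrow> F dvd v"
  have f0: "lin3.fin_dim {0 :: 'k poly3}" unfolding lin3.fin_dim_def by (intro exI[of _ "{}"]) auto
  then have "rd V \<le> rd {0}" by (rule rd_mono) (use a in auto)
  also have "rd {0} = 0"
  proof -
    have "lin3.dim {0 :: 'k poly3} = lin3.qdim zeroF {0} + lin3.dim ({0} \<inter> zeroF)"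
      by (rule lin3.dim_eq_qdim[OF sub_zeroF lin3.subspace_single_0 f0])
    moreover have "lin3.dim {0 :: 'k poly3} \<le> 0" using lin3.dim_le_card[of "{0}" "{}"] by simp
    ultimately show ?thesis unfolding rd_def by simp
  qed
  finally show ?thesis using rd_nonneg[of V] by linarith
qed

lemma H_neg: "n < 0 \<Longrightarrow> H I n = 0"
  unfolding H_def by (rule rd_eq_0) (auto simp: gr_neg)

lemma H_pos_imp: "H I n > 0 \<Longrightarrow> \<exists>g\<in>I \<inter> gr n. \<not> F dvd g"
  unfolding H_def using rd_eq_0[of "I \<inter> gr n"] by force

lemma H_UNIV: "H UNIV n = rd (gr n)" by (simp add: H_def)

lemma H_dim:
  assumes "hid I" "F \<in> I"
  shows "int (lin3.dim (I \<inter> gr n)) = H I n + int (lin3.dim (gr (n - int d) :: 'k poly3 set))"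
proof -
  have Fnz: "F \<noteq> 0" using F_prime by auto
  have "(I \<inter> gr n) \<inter> zeroF = (*) F ` gr (n - int d)"
  proof (intro equalityI subsetI)
    fix f assume f: "f \<in> (I \<inter> gr n) \<inter> zeroF"
    then obtain k where k: "f = F * k" by (auto simp: dvd_def)
    have "f = hcomp n f" using f hcomp_of_gr by fastforce
    also have "\<dots> = F * hcomp (n - int d) k" unfolding k by (rule hcomp_mult_left[OF F_gr])
    finally show "f \<in> (*) F ` gr (n - int d)" using hcomp_gr by blast
  next
    fix f assume "f \<in> (*) F ` gr (n - int d)"
    then show "f \<in> (I \<inter> gr n) \<inter> zeroF"
      using hidD(4)[OF assms] gr_mult_eq[OF F_gr, of _ "n - int d" n] by auto
  qed
  moreover have "lin3.dim ((*) F ` gr (n - int d)) = lin3.dim (gr (n - int d) :: 'k poly3 set)"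
  proof -
    have "{v \<in> gr (n - int d). F * v = 0} = {0}" using Fnz by auto
    moreover have "lin3.dim {0 :: 'k poly3} \<le> 0" using lin3.dim_le_card[of "{0}" "{}"] by simp
    ultimately show ?thesis
      using lin3.rank_nullity[OF linear_mult[of F] subspace_gr[of "n - int d"] fin_dim_gr] by simp
  qed
  ultimately show ?thesis
    using lin3.dim_eq_qdim[OF sub_zeroF subspace_piece[OF assms(1)] fin_dim_piece]
    unfolding H_def rd_def by simp
qed

text \<open>Doubling clears the denominators of the binomial coefficients; n >= d - 2 keeps n - d in
  the range where the formula for the dimension of the space of forms is valid.\<close>

lemma two_H_UNIV:
  assumes "n \<ge> int d - 2"
  shows "2 * H UNIV n = 2 * int d * n + 3 * int d - int d * int d"
proof -
  have 1: "2 * int (lin3.dim (gr n :: 'k poly3 set)) = (n + 1) * (n + 2)"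
    by (rule dim_gr) (use assms d_pos in linarith)
  have 2: "2 * int (lin3.dim (gr (n - int d) :: 'k poly3 set)) = (n - int d + 1) * (n - int d + 2)"
    by (rule dim_gr) (use assms in linarith)
  have 3: "int (lin3.dim (gr n :: 'k poly3 set)) = H UNIV n + int (lin3.dim (gr (n - int d) :: 'k poly3 set))"
    using H_dim[OF hid_UNIV UNIV_I, where n = n] unfolding Int_UNIV_left .
  show ?thesis using 1 2 3 by (simp add: algebra_simps)
qed

lemma two_H_UNIV_small:
  assumes "- 2 \<le> n" "n < int d"
  shows "2 * H UNIV n = (n + 1) * (n + 2)"
  using dim_gr[OF assms(1), where 'k = 'k] H_dim[OF hid_UNIV UNIV_I, where n = n] dim_gr_neg[of "n - int d", where 'k = 'k] assms
  by simp

subsection \<open>Saturated ideals\<close>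

definition closed :: "'k poly3 set \<Rightarrow> bool" where
  "closed I \<longleftrightarrow> hid I \<and> F \<in> I \<and> (\<forall>f N. (\<forall>g\<in>gr (int N). f * g \<in> I) \<longrightarrow> f \<in> I)"

lemma closedD:
  assumes "closed I"
  shows "hid I" "F \<in> I" "(\<And>g. g \<in> gr (int N) \<Longrightarrow> f * g \<in> I) \<Longrightarrow> f \<in> I"
proof -
  have c: "\<forall>f N. (\<forall>g\<in>gr (int N). f * g \<in> I) \<longrightarrow> f \<in> I"
    using assms unfolding closed_def by (elim conjE)
  show "hid I" "F \<in> I" using assms unfolding closed_def by simp_all
  show "(\<And>g. g \<in> gr (int N) \<Longrightarrow> f * g \<in> I) \<Longrightarrow> f \<in> I"
    using c[rule_format, of N f] by blast
qed

lemma closed_dvd: "closed I \<Longrightarrow> F dvd f \<Longrightarrow> f \<in> I"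
  using hidD(4)[OF closedD(1) closedD(2)] by (auto simp: dvd_def)

lemma closed_cong:
  assumes "closed I" "f \<doteq> g" "g \<in> I"
  shows "f \<in> I"
proof -
  have "(f - g) + g \<in> I" by (rule hidD(2)[OF closedD(1) closed_dvd assms(3)]) (use assms in auto)
  then show ?thesis by simp
qed

text \<open>The powers x^N, y^N form a regular sequence in S, which gives the quotient w. It lies in
  I because x^N w and y^N w do: modulo F every form of degree 2N + d is in (x^N, y^N), so saturation
  applies. Thus I/(F) has depth two.\<close>

lemma depth:
  assumes I: "closed I" and uv: "u \<in> I" "v \<in> I" "u \<in> gr (n + int N)" "y ^ N * u \<doteq> x ^ N * v"
  shows "\<exists>w\<in>I \<inter> gr n. u \<doteq> x ^ N * w"
proof -
  note hid = closedD(1)[OF I]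
  obtain w where w: "u \<doteq> x ^ N * w" "v \<doteq> y ^ N * w" using coordsD(5)[OF coords_xy uv(4)] by blast
  have xw: "x ^ N * w \<in> I" "y ^ N * w \<in> I"
    using closed_cong[OF I cong_sym] w uv by blast+
  have "w \<in> I"
  proof (rule closedD(3)[OF I])
    fix f :: "'k poly3" assume "f \<in> gr (int (2 * N + d))"
    then obtain a b where ab: "f \<doteq> x ^ N * a + y ^ N * b"
      using coordsD(6)[OF coords_xy order_refl] by blast
    have "w * (x ^ N * a + y ^ N * b) = (x ^ N * w) * a + (y ^ N * w) * b" by (simp add: algebra_simps)
    then have "w * (x ^ N * a + y ^ N * b) \<in> I" using xw by (auto intro: hidD(2,4)[OF hid])
    then show "w * f \<in> I" using closed_cong[OF I cong_mult_left[OF ab]] by blast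
  qed
  moreover have "hcomp (n + int N) u \<doteq> hcomp (n + int N) (x ^ N * w)" by (rule cong_hcomp[OF w(1)])
  then have "u \<doteq> x ^ N * hcomp n w"
    using hcomp_of_gr[OF uv(3)] by (simp add: hcomp_mult_left[OF x_pow_gr])
  ultimately show ?thesis using hidD(5)[OF hid] hcomp_gr by blast
qed

definition xyN :: "'k poly3 set \<Rightarrow> nat \<Rightarrow> int \<Rightarrow> 'k poly3 set" where
  "xyN I N n = {a + b |a b. a \<in> (*) (x ^ N) ` (I \<inter> gr n) \<and> b \<in> (*) (y ^ N) ` (I \<inter> gr n)}"

lemma subspace_mult_image: "lin3.subspace V \<Longrightarrow> lin3.subspace ((*) u ` V)"
  using linear_mult[of u] module_hom.subspace_image[of sc sc "(*) u" V]
  by (simp add: Vector_Spaces.linear_def)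

lemma fin_dim_mult_image: "lin3.fin_dim V \<Longrightarrow> lin3.fin_dim ((*) u ` V)"
  by (rule lin3.fin_dim_image[OF linear_mult])

lemma xyN_props:
  assumes I: "hid I"
  shows "lin3.subspace (xyN I N n)" "lin3.fin_dim (xyN I N n)" "xyN I N n \<subseteq> I \<inter> gr (n + int N)"
proof -
  show "lin3.subspace (xyN I N n)" unfolding xyN_def
    by (intro lin3.subspace_sums subspace_mult_image subspace_piece I)
  show "lin3.fin_dim (xyN I N n)" unfolding xyN_def
    by (intro lin3.fin_dim_sums fin_dim_mult_image fin_dim_piece)
  have "u * v \<in> I \<inter> gr (n + int N)" if "v \<in> I \<inter> gr n" "u \<in> gr (int N)" for u v
    using that hidD(3)[OF I] gr_mult_eq[of u "int N" v n "n + int N"] by auto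
  then show "xyN I N n \<subseteq> I \<inter> gr (n + int N)"
    unfolding xyN_def using x_pow_gr y_pow_gr by (auto intro: hidD(2)[OF I] gr_add)
qed

text \<open>The Koszul relation: by \<open>depth\<close> the two summands meet in S exactly in x^N
  y^N times the part of I of degree n - N, and multiplication by powers of x and y preserves
  dimensions in the domain S.\<close>

lemma rd_xyN:
  assumes I: "closed I"
  shows "rd (xyN I N n) = 2 * H I n - H I (n - int N)"
proof -
  note hid = closedD(1)[OF I]
  let ?A = "(*) (x ^ N) ` (I \<inter> gr n)" and ?B = "(*) (y ^ N) ` (I \<inter> gr n)"
    and ?C = "(*) (x ^ N * y ^ N) ` (I \<inter> gr (n - int N))"
  have "lin3.qdim zeroF {a + b |a b. a \<in> ?A \<and> b \<in> ?B} + lin3.qdim zeroF ?C = lin3.qdim zeroF ?A + lin3.qdim zeroF ?B"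
  proof (rule lin3.qdim_sums[OF sub_zeroF])
    fix a b assume "a \<in> ?A" "b \<in> ?B" and ab: "a - b \<in> zeroF"
    then obtain u v where uv: "u \<in> I \<inter> gr n" "v \<in> I \<inter> gr n" "a = x ^ N * u" "b = y ^ N * v" by blast
    have "x ^ N * u \<doteq> y ^ N * v" using ab uv by simp
    then have 1: "y ^ N * v \<doteq> x ^ N * u" by (rule cong_sym)
    have "v \<in> gr (n - int N + int N)" using uv by simp
    then obtain w where w: "w \<in> I \<inter> gr (n - int N)" "v \<doteq> x ^ N * w"
      using depth[OF I _ _ _ 1] uv by blast
    have "b \<doteq> x ^ N * y ^ N * w" unfolding uv using cong_mult_left[OF w(2), of "y ^ N"] by (simp add: algebra_simps)
    then have "a - x ^ N * y ^ N * w \<in> zeroF" using cong_trans[of a b] ab by blast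
    then show "\<exists>c\<in>?C. a - c \<in> zeroF" using w(1) by blast
  next
    fix c assume "c \<in> ?C"
    then obtain w where w: "w \<in> I \<inter> gr (n - int N)" "c = x ^ N * y ^ N * w" by blast
    have m: "u * w \<in> I \<inter> gr n" if "u \<in> gr (int N)" for u
      using w that hidD(3)[OF hid] gr_mult_eq[of u "int N" w "n - int N" n] by auto
    show "\<exists>a\<in>?A. c - a \<in> zeroF"
      by (rule bexI[of _ "x ^ N * (y ^ N * w)"]) (use m[OF y_pow_gr] w in \<open>auto simp: algebra_simps\<close>)
    show "\<exists>b\<in>?B. c - b \<in> zeroF"
      by (rule bexI[of _ "y ^ N * (x ^ N * w)"]) (use m[OF x_pow_gr] w in \<open>auto simp: algebra_simps\<close>)
  qed (intro subspace_mult_image fin_dim_mult_image subspace_piece fin_dim_piece hid)+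
  then have "rd (xyN I N n) + rd ?C = rd ?A + rd ?B" unfolding rd_def xyN_def by linarith
  moreover have "rd ?A = H I n" "rd ?B = H I n" unfolding H_def
    by (rule rd_mult; use pow_ndvd subspace_piece[OF hid] fin_dim_piece in blast)+
  moreover have "rd ?C = H I (n - int N)" unfolding H_def
    by (rule rd_mult) (use pow_ndvd subspace_piece[OF hid] fin_dim_piece dvd_mult_iff in blast)+
  ultimately show ?thesis by simp
qed

text \<open>For N = 1 this is the convexity of the Hilbert function; it holds because x^N I + y^N I
  is contained in I.\<close>

lemma second_difference:
  assumes I: "closed I"
  shows "2 * H I n - H I (n - int N) \<le> H I (n + int N)"
  unfolding rd_xyN[OF I, symmetric] unfolding H_def
  by (rule rd_mono[OF fin_dim_piece]) (metis xyN_props(3)[OF closedD(1)[OF I]] cong_refl subsetD)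

subsection \<open>The gap property\<close>

text \<open>Equality means that x and y times the part of degree n - 1 fill the part of degree n.
  The spaces W k, generated over k[x, y] by that part, are then stable under all linear forms, so
  modulo F they contain the multiples by forms of degree k of one g nonzero in S, and their
  dimension is at least d k up to a constant. But it grows by at most h = H (n - 1) - H (n - 2) per
  step, whence d <= h.\<close>

lemma gap:
  assumes I: "closed I" and eq: "H I n = 2 * H I (n - 1) - H I (n - 2)" and pos: "H I (n - 1) > 0"
  shows "int d \<le> H I (n - 1) - H I (n - 2)"
proof -
  note hid = closedD(1)[OF I]
  define W where "W = rec_nat (I \<inter> gr (n - 1)) (\<lambda>_ V. {a + b |a b. a \<in> (*) x ` V \<and> b \<in> (*) y ` V})"
  have W0: "W 0 = I \<inter> gr (n - 1)" and WS: "W (Suc k) = {a + b |a b. a \<in> (*) x ` W k \<and> b \<in> (*) y ` W k}" for k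
    by (simp_all add: W_def)
  have sub: "lin3.subspace (W k)" for k
  proof (induction k)
    case 0
    then show ?case unfolding W0 by (rule subspace_piece[OF hid])
  next
    case (Suc k)
    then show ?case unfolding WS by (intro lin3.subspace_sums subspace_mult_image)
  qed
  have fin: "lin3.fin_dim (W k)" for k
  proof (induction k)
    case 0
    then show ?case unfolding W0 by (rule fin_dim_piece)
  next
    case (Suc k)
    then show ?case unfolding WS by (intro lin3.fin_dim_sums fin_dim_mult_image)
  qed
  have z: "0 \<in> W k" for k by (rule lin3.subspace_0[OF sub])
  have add: "a + b \<in> W k" if "a \<in> W k" "b \<in> W k" for a b k using lin3.subspace_add[OF sub] that .
  have xW: "x * a \<in> W (Suc k)" and yW: "y * a \<in> W (Suc k)" if "a \<in> W k" for a k
    unfolding WS using that z[of k] by force+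
  have WSE: "\<exists>a\<in>W k. \<exists>b\<in>W k. f = x * a + y * b" if "f \<in> W (Suc k)" for f k
    using that unfolding WS by blast
  have ypow: "y ^ e * a \<in> W e" if "a \<in> W 0" for a e
    using that by (induction e) (auto dest: yW simp: mult.assoc)
  have gen: "\<exists>u\<in>W 0. \<exists>v\<in>W 0. f \<doteq> x * u + y * v" if f: "f \<in> I \<inter> gr n" for f
  proof -
    have s: "xyN I 1 (n - 1) \<subseteq> I \<inter> gr n" using xyN_props(3)[OF hid, of 1 "n - 1"] by simp
    have "rd (I \<inter> gr n) \<le> rd (xyN I 1 (n - 1))"
      using rd_xyN[OF I, of 1 "n - 1"] eq unfolding H_def by simp
    then have q: "lin3.qdim zeroF (I \<inter> gr n) \<le> lin3.qdim zeroF (xyN I 1 (n - 1))"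
      unfolding rd_def by simp
    have s': "\<exists>w\<in>I \<inter> gr n. v - w \<in> zeroF" if "v \<in> xyN I 1 (n - 1)" for v
      using s that by (intro bexI[of _ v]) auto
    have "\<exists>v\<in>xyN I 1 (n - 1). f - v \<in> zeroF"
      by (rule lin3.qdim_eq_imp[OF sub_zeroF xyN_props(1)[OF hid] fin_dim_piece s' q f])
    then show ?thesis unfolding xyN_def W0 by auto
  qed
  \<comment> \<open>An element of W (k + 1) is x b + y c with b, c in W k, and l commutes with x and
    y; so only the base case uses the equality assumed.\<close>
  have lin: "\<exists>b\<in>W (Suc k). l * a \<doteq> b" if "a \<in> W k" "l \<in> gr 1" for a l k
    using that(1)
  proof (induction k arbitrary: a)
    case 0
    have "l * a \<in> I \<inter> gr n"
      using 0 hidD(3)[OF hid] gr_mult_eq[OF that(2), of a "n - 1" n] unfolding W0 by auto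
    then obtain u v where "u \<in> W 0" "v \<in> W 0" "l * a \<doteq> x * u + y * v" using gen by blast
    then show ?case using xW yW add by blast
  next
    case (Suc k)
    obtain b c where bc: "b \<in> W k" "c \<in> W k" "a = x * b + y * c" using WSE[OF Suc.prems] by blast
    obtain b' c' where "b' \<in> W (Suc k)" "c' \<in> W (Suc k)" "l * b \<doteq> b'" "l * c \<doteq> c'"
      using Suc.IH bc by metis
    moreover from this have "x * (l * b) + y * (l * c) \<doteq> x * b' + y * c'"
      by (intro cong_add cong_mult_left)
    ultimately show ?case unfolding bc using xW yW add by (auto simp: algebra_simps)
  qed
  obtain g where g: "g \<in> W 0" "\<not> F dvd g" using H_pos_imp[OF pos] W0 by blast
  have mult: "\<exists>b\<in>W k. f * g \<doteq> b" if "f \<in> gr (int k)" for f k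
    using that
  proof (induction k f rule: gr_induct)
    case (const u)
    have "const3 u * g \<in> W 0" using lin3.subspace_scale[OF sub g(1), of u] by (simp add: sc_def)
    then show ?case using cong_refl by blast
  next
    case (decomp k f1 f2 f3)
    obtain b1 b2 b3 where b: "b1 \<in> W k" "f1 * g \<doteq> b1" "b2 \<in> W k" "f2 * g \<doteq> b2" "b3 \<in> W k" "f3 * g \<doteq> b3"
      using decomp.IH by blast
    obtain c1 c2 c3 where c: "c1 \<in> W (Suc k)" "X0 * b1 \<doteq> c1" "c2 \<in> W (Suc k)" "X1 * b2 \<doteq> c2"
      "c3 \<in> W (Suc k)" "X2 * b3 \<doteq> c3"
      using lin[OF b(1) X_gr(1)] lin[OF b(3) X_gr(2)] lin[OF b(5) X_gr(3)] by blast
    have "X0 * (f1 * g) + X1 * (f2 * g) + X2 * (f3 * g) \<doteq> c1 + c2 + c3"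
      by (intro cong_add)
         (rule cong_trans[OF cong_mult_left[OF b(2)] c(2)] cong_trans[OF cong_mult_left[OF b(4)] c(4)]
          cong_trans[OF cong_mult_left[OF b(6)] c(6)])+
    then show ?case using c add by (auto simp: algebra_simps)
  qed
  have lower: "H UNIV (int k) \<le> rd (W k)" for k
  proof -
    have "H UNIV (int k) = rd ((*) g ` gr (int k))"
      unfolding H_UNIV by (rule rd_mult[symmetric, OF g(2) subspace_gr fin_dim_gr])
    also have "\<dots> \<le> rd (W k)" by (rule rd_mono[OF fin]) (use mult in \<open>auto simp: mult.commute\<close>)
    finally show ?thesis .
  qed
  \<comment> \<open>Every monomial of degree k + 1 in x and y other than y^(k+1) contains a factor
    x.\<close>
  have form: "\<exists>a\<in>W k. \<exists>b\<in>W 0. f = x * a + y ^ Suc k * b" if "f \<in> W (Suc k)" for f k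
    using that
  proof (induction k arbitrary: f)
    case 0
    then show ?case using WSE by auto
  next
    case (Suc k)
    obtain a b where ab: "a \<in> W (Suc k)" "b \<in> W (Suc k)" "f = x * a + y * b" using WSE[OF Suc.prems] by blast
    obtain b1 b2 where b: "b1 \<in> W k" "b2 \<in> W 0" "b = x * b1 + y ^ Suc k * b2" using Suc.IH[OF ab(2)] by blast
    have "f = x * (a + y * b1) + y ^ Suc (Suc k) * b2" unfolding ab b by (simp add: algebra_simps)
    then show ?case using add[OF ab(1) yW[OF b(1)]] b(2) by blast
  qed
  define h where "h = H I (n - 1) - H I (n - 2)"
  \<comment> \<open>Both x W k and y^(k+1) W 0 contain x y^(k+1) times the part of I of degree n -
    2, whose dimension is therefore subtracted from H (n - 1).\<close>
  have step: "rd (W (Suc k)) \<le> rd (W k) + h" for k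
  proof -
    let ?A = "(*) x ` W k" and ?B = "(*) (y ^ Suc k) ` W 0" and ?C = "(*) (x * y ^ Suc k) ` (I \<inter> gr (n - 2))"
    have fAB: "lin3.fin_dim {a + b |a b. a \<in> ?A \<and> b \<in> ?B}"
      by (intro lin3.fin_dim_sums fin_dim_mult_image fin)
    have mI: "u * w \<in> W 0" if "w \<in> I \<inter> gr (n - 2)" "u \<in> gr 1" for u w
      unfolding W0 using that hidD(3)[OF hid] gr_mult_eq[of u 1 w "n - 2" "n - 1"] by auto
    have "rd (W (Suc k)) \<le> rd {a + b |a b. a \<in> ?A \<and> b \<in> ?B}"
    proof (rule rd_mono[OF fAB])
      fix v assume "v \<in> W (Suc k)"
      then have "v \<in> {a + b |a b. a \<in> ?A \<and> b \<in> ?B}" using form by blast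
      then show "\<exists>w\<in>{a + b |a b. a \<in> ?A \<and> b \<in> ?B}. v \<doteq> w" by (intro bexI[of _ v]) auto
    qed
    moreover have "lin3.qdim zeroF {a + b |a b. a \<in> ?A \<and> b \<in> ?B} + lin3.qdim zeroF ?C \<le> lin3.qdim zeroF ?A + lin3.qdim zeroF ?B"
    proof (rule lin3.qdim_sums_le[OF sub_zeroF])
      fix c assume "c \<in> ?C"
      then obtain w where w: "w \<in> I \<inter> gr (n - 2)" "c = x * y ^ Suc k * w" by blast
      have "c = x * (y ^ k * (y * w))" unfolding w by (simp add: algebra_simps)
      then show "\<exists>a\<in>?A. c - a \<in> zeroF" using ypow[OF mI[OF w(1) y_gr], of k] by (intro bexI[of _ c]) auto
      have "c = y ^ Suc k * (x * w)" unfolding w by (simp add: algebra_simps)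
      then show "\<exists>b\<in>?B. c - b \<in> zeroF" using mI[OF w(1) x_gr] by (intro bexI[of _ c]) auto
    qed (intro subspace_mult_image fin_dim_mult_image sub fin)+
    moreover have "rd ?A = rd (W k)" by (rule rd_mult[OF x_ndvd sub fin])
    moreover have "rd ?B = H I (n - 1)" unfolding H_def W0[symmetric] by (rule rd_mult[OF pow_ndvd(2) sub fin])
    moreover have "rd ?C = H I (n - 2)" unfolding H_def
      by (rule rd_mult[OF _ subspace_piece[OF hid] fin_dim_piece])
         (use x_ndvd pow_ndvd dvd_mult_iff in blast)
    ultimately show ?thesis unfolding h_def rd_def by linarith
  qed
  have upper: "rd (W k) \<le> rd (W 0) + int k * h" for k
  proof (induction k)
    case (Suc k)
    then show ?case using step[of k] by (simp add: algebra_simps)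
  qed simp
  show ?thesis
  proof (rule ccontr)
    assume "\<not> ?thesis"
    then have h: "h \<le> int d - 1" unfolding h_def by simp
    \<comment> \<open>Large enough for the lower bound with leading term d k to exceed the upper
      bound rd (W 0) + (d - 1) k.\<close>
    define k where "k = nat (2 * rd (W 0) + int d * int d) + d"
    have nn: "0 \<le> 2 * rd (W 0) + int d * int d" using rd_nonneg[of "W 0"] by simp
    then have k: "int k = 2 * rd (W 0) + int d * int d + int d" by (simp add: k_def)
    have "2 * H UNIV (int k) = 2 * int d * int k + 3 * int d - int d * int d"
      by (rule two_H_UNIV) (use k nn in linarith)
    moreover have "H UNIV (int k) \<le> rd (W 0) + int k * h" using lower[of k] upper[of k] by linarith
    moreover have "int k * h \<le> int k * (int d - 1)" using h by (intro mult_left_mono) auto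
    ultimately have "2 * int d * int k + 3 * int d - int d * int d \<le> 2 * rd (W 0) + 2 * (int d * int k) - 2 * int k"
      by (simp add: algebra_simps)
    then have "2 * int k + 3 * int d \<le> 2 * rd (W 0) + int d * int d" by (simp add: algebra_simps)
    then show False using k rd_nonneg[of "W 0"] d_pos by (simp add: algebra_simps)
  qed
qed

subsection \<open>Linkage and the Riemann-Roch theorem\<close>

definition princ :: "'k poly3 \<Rightarrow> 'k poly3 set" where
  "princ h = {f. \<exists>c. f \<doteq> h * c}"

lemma hid_princ:
  assumes h: "h \<in> gr m"
  shows "hid (princ h)"
  unfolding hid_def
proof (intro conjI ballI allI)
  show "0 \<in> princ h" unfolding princ_def by (auto intro: exI[of _ 0])
  fix a assume "a \<in> princ h"
  then obtain c where c: "a \<doteq> h * c" unfolding princ_def by blast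
  show "r * a \<in> princ h" for r
    using cong_mult_left[OF c, of r] unfolding princ_def by (auto intro!: exI[of _ "r * c"] simp: algebra_simps)
  show "hcomp n a \<in> princ h" for n
    using cong_hcomp[OF c, of n] unfolding princ_def by (auto simp: hcomp_mult_left[OF h])
  fix b assume "b \<in> princ h"
  then obtain c' where c': "b \<doteq> h * c'" unfolding princ_def by blast
  show "a + b \<in> princ h"
    using cong_add[OF c c'] unfolding princ_def by (auto intro!: exI[of _ "c + c'"] simp: algebra_simps)
qed

text \<open>If f x^N = h b and f y^N = h b' in S, cancelling h in the domain S leaves y^N b = x^N
  b'. By regularity b = x^N w, and f = h w.\<close>

lemma closed_princ:
  assumes h: "h \<in> gr m" "\<not> F dvd h"
  shows "closed (princ h)"
  unfolding closed_def
proof (intro conjI allI impI)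
  show "hid (princ h)" by (rule hid_princ[OF h(1)])
  show "F \<in> princ h" unfolding princ_def by (auto intro: exI[of _ 0])
  fix f N assume a: "\<forall>g\<in>gr (int N). f * g \<in> princ h"
  obtain b b' where b: "f * x ^ N \<doteq> h * b" "f * y ^ N \<doteq> h * b'"
    using a x_pow_gr y_pow_gr unfolding princ_def by blast
  have "y ^ N * (h * b) \<doteq> y ^ N * (f * x ^ N)" by (rule cong_mult_left[OF cong_sym[OF b(1)]])
  also have "y ^ N * (f * x ^ N) = x ^ N * (f * y ^ N)" by (simp add: algebra_simps)
  finally have "y ^ N * (h * b) \<doteq> x ^ N * (h * b')"
    using cong_trans cong_mult_left[OF b(2), of "x ^ N"] by blast
  then have "h * (y ^ N * b) \<doteq> h * (x ^ N * b')" by (simp add: mult.left_commute)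
  then have "y ^ N * b \<doteq> x ^ N * b'" using cong_cancel h(2) by blast
  then obtain w where "b \<doteq> x ^ N * w" using coordsD(5)[OF coords_xy] by blast
  then have "f * x ^ N \<doteq> h * (x ^ N * w)" using cong_trans[OF b(1) cong_mult_left] by blast
  then have "x ^ N * f \<doteq> x ^ N * (h * w)" by (simp add: algebra_simps)
  then have "f \<doteq> h * w" using cong_cancel pow_ndvd by blast
  then show "f \<in> princ h" unfolding princ_def by blast
qed

definition colon :: "'k poly3 set \<Rightarrow> 'k poly3 set \<Rightarrow> 'k poly3 set" where
  "colon Z I = {f. \<forall>a\<in>I. f * a \<in> Z}"

lemma closed_colon:
  assumes Z: "closed Z" and I: "hid I"
  shows "closed (colon Z I)"
proof -
  note hZ = closedD(1)[OF Z]
  have "hid (colon Z I)"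
    unfolding hid_def
  proof (intro conjI ballI allI)
    show "0 \<in> colon Z I" using hidD(1)[OF hZ] by (simp add: colon_def)
    fix f assume f: "f \<in> colon Z I"
    show "r * f \<in> colon Z I" for r
      using f hidD(3)[OF hZ, of _ r] by (simp add: colon_def mult.assoc)
    show "hcomp n f \<in> colon Z I" for n
      unfolding colon_def
    proof (intro CollectI ballI)
      fix a assume a: "a \<in> I"
      obtain D where D: "a = (\<Sum>k<D. hcomp (int k) a)" using exists_sum_hcomp by blast
      have "hcomp n f * hcomp (int k) a \<in> Z" for k
      proof -
        have "hcomp n f * hcomp (int k) a = hcomp (n + int k) (f * hcomp (int k) a)"
          by (simp add: hcomp_mult[OF hcomp_gr])
        moreover have "f * hcomp (int k) a \<in> Z" using f hidD(5)[OF I a] by (simp add: colon_def)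
        ultimately show ?thesis using hidD(5)[OF hZ] by simp
      qed
      then have "(\<Sum>k<D. hcomp n f * hcomp (int k) a) \<in> Z" by (intro hid_sum[OF hZ])
      then show "hcomp n f * a \<in> Z" using D by (metis sum_distrib_left)
    qed
    fix g assume "g \<in> colon Z I"
    then show "f + g \<in> colon Z I" using f hidD(2)[OF hZ] by (simp add: colon_def distrib_right)
  qed
  moreover have "F \<in> colon Z I" using hidD(4)[OF hZ closedD(2)[OF Z]] by (simp add: colon_def)
  moreover have "f \<in> colon Z I" if "\<forall>g\<in>gr (int N). f * g \<in> colon Z I" for f N
    unfolding colon_def
  proof (intro CollectI ballI, rule closedD(3)[OF Z])
    fix a g :: "'k poly3" assume "a \<in> I" "g \<in> gr (int N)"
    then have "f * g * a \<in> Z" using that by (simp add: colon_def)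
    then show "f * a * g \<in> Z" by (simp add: algebra_simps)
  qed
  ultimately show ?thesis unfolding closed_def by blast
qed

text \<open>If \<open>I J \<subseteq> (F, h)\<close> then \<open>(a, b) \<mapsto> \<rho> (a b / h)\<close> pairs \<open>I\<close> with \<open>J / (x^N, y^N) J\<close>, without left kernel.\<close>

lemma duality_inequality:
  assumes I: "hid I" and J: "closed J" and h: "h \<in> gr m" "\<not> F dvd h" "h \<in> J"
    and IJ: "\<And>a b. a \<in> I \<Longrightarrow> b \<in> J \<Longrightarrow> a * b \<in> princ h"
    and HJ: "\<And>n. n \<ge> n0 \<Longrightarrow> H J n = int d * n + \<gamma>"
    and i': "i' = int d - 3 + m - i"
  shows "H I i + (int d * i' + \<gamma>) \<le> H J i'"
proof -
  note hJ = closedD(1)[OF J]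
  \<comment> \<open>N > i makes the trace nondegenerate on forms of degree i, and i' + N >= n0 puts
    the degrees i' + N and i' + 2N in the range where H J is linear.\<close>
  define N where "N = nat \<bar>i\<bar> + nat \<bar>n0 - i'\<bar> + 1"
  have N: "0 < N" "i < int N" "n0 \<le> i' + int N" by (auto simp: N_def)
  then have N': "n0 \<le> i' + 2 * int N" by linarith
  show ?thesis
  proof (rule coords_trace[OF coords_xy N(1)])
    fix \<rho> :: "'k poly3 \<Rightarrow> 'k"
    assume \<rho>: "\<And>f g. \<rho> (f + g) = \<rho> f + \<rho> g" "\<And>c f. \<rho> (sc c f) = c * \<rho> f"
      "\<And>f. \<rho> (F * f) = 0" "\<And>f. \<rho> (x ^ N * f) = 0" "\<And>f. \<rho> (y ^ N * f) = 0"
      "\<And>i a. i < N \<Longrightarrow> a \<in> gr (int i) \<Longrightarrow> \<not> F dvd a \<Longrightarrow>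
         \<exists>t\<in>gr (int d - 3 + 2 * int N - int i). \<rho> (a * t) \<noteq> (0::'k)"
    have \<rho>cong: "\<rho> f = \<rho> g" if fg: "f \<doteq> g" for f g
    proof -
      obtain k where "f - g = F * k" using fg by (auto simp: dvd_def)
      then have "f = g + F * k" by (simp add: algebra_simps)
      then show ?thesis by (simp add: \<rho>)
    qed
    define \<beta> where "\<beta> a b = \<rho> (SOME c. a * b \<doteq> h * c)" for a b
    have \<beta>: "\<beta> a b = \<rho> c" if c: "a * b \<doteq> h * c" for a b c
    proof -
      have "a * b \<doteq> h * (SOME c. a * b \<doteq> h * c)" by (rule someI[of "\<lambda>c. a * b \<doteq> h * c", OF c])
      then have "h * (SOME c. a * b \<doteq> h * c) \<doteq> h * c" using cong_trans[OF cong_sym c] by blast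
      then show ?thesis unfolding \<beta>_def using \<rho>cong cong_cancel h(2) by blast
    qed
    have quot: "\<exists>c. a * b \<doteq> h * c" if "a \<in> I" "b \<in> J" for a b
      using IJ[OF that] unfolding princ_def by blast
    let ?A = "I \<inter> gr i" and ?W = "J \<inter> gr (i' + 2 * int N)" and ?U = "xyN J N (i' + int N)"
    have U: "?U \<subseteq> ?W" using xyN_props(3)[OF hJ, of N "i' + int N"] by (simp add: algebra_simps)
    have "lin3.qdim zeroF ?A + lin3.qdim zeroF ?U \<le> lin3.qdim zeroF ?W"
    proof (rule lin3.qdim_le_of_pairing[where \<beta> = \<beta>, OF sub_zeroF subspace_piece[OF I] fin_dim_piece
        subspace_piece[OF hJ] fin_dim_piece xyN_props(1)[OF hJ] U])
      fix a b w assume w: "w \<in> ?W" and a: "a \<in> ?A" "b \<in> ?A"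
      obtain c e where "a * w \<doteq> h * c" "b * w \<doteq> h * e" using quot w a by blast
      moreover from this have "(a + b) * w \<doteq> h * (c + e)" unfolding distrib_left distrib_right by (rule cong_add)
      ultimately show "\<beta> (a + b) w = \<beta> a w + \<beta> b w" using \<beta> \<rho>(1) by simp
    next
      fix u a w assume w: "w \<in> ?W" and a: "a \<in> ?A"
      obtain c where "a * w \<doteq> h * c" using quot w a by blast
      moreover from this have "sc u a * w \<doteq> h * sc u c"
        using cong_mult_left[of "a * w" "h * c" "const3 u"] by (simp add: sc_def algebra_simps)
      ultimately show "\<beta> (sc u a) w = u * \<beta> a w" using \<beta> \<rho>(2) by simp
    next
      fix a w v assume w: "w \<in> ?W" "v \<in> ?W" and a: "a \<in> ?A"
      obtain c e where "a * w \<doteq> h * c" "a * v \<doteq> h * e" using quot w a by blast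
      moreover from this have "a * (w + v) \<doteq> h * (c + e)" unfolding distrib_left by (rule cong_add)
      ultimately show "\<beta> a (w + v) = \<beta> a w + \<beta> a v" using \<beta> \<rho>(1) by simp
    next
      fix u a w assume w: "w \<in> ?W" and a: "a \<in> ?A"
      obtain c where "a * w \<doteq> h * c" using quot w a by blast
      moreover from this have "a * sc u w \<doteq> h * sc u c"
        using cong_mult_left[of "a * w" "h * c" "const3 u"] by (simp add: sc_def algebra_simps)
      ultimately show "\<beta> a (sc u w) = u * \<beta> a w" using \<beta> \<rho>(2) by simp
    next
      fix a u assume a: "a \<in> ?A" and "u \<in> ?U"
      then obtain p q where pq: "p \<in> J" "q \<in> J" "u = x ^ N * p + y ^ N * q" unfolding xyN_def by blast
      obtain c e where "a * p \<doteq> h * c" "a * q \<doteq> h * e" using quot pq a by blast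
      then have "x ^ N * (a * p) + y ^ N * (a * q) \<doteq> x ^ N * (h * c) + y ^ N * (h * e)"
        by (intro cong_add cong_mult_left)
      then have "a * u \<doteq> h * (x ^ N * c + y ^ N * e)" unfolding pq by (simp add: algebra_simps)
      then show "\<beta> a u = 0" using \<beta> \<rho> by simp
    next
      fix a w assume "w \<in> zeroF"
      then have "a * w \<doteq> h * 0" by simp
      moreover have "\<rho> 0 = 0" using \<rho>(3)[of 0] by simp
      ultimately show "\<beta> a w = 0" using \<beta> by metis
    next
      fix a assume a: "a \<in> ?A" and nd: "\<And>w. w \<in> ?W \<Longrightarrow> \<beta> a w = 0"
      show "a \<in> zeroF"
      proof (cases "i < 0")
        case True
        then show ?thesis using a by (simp add: gr_neg)
      next
        case False
        then have i: "i = int (nat i)" "nat i < N" using N by auto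
        show ?thesis
        proof (rule ccontr)
          assume "a \<notin> zeroF"
          then have "\<exists>t\<in>gr (int d - 3 + 2 * int N - int (nat i)). \<rho> (a * t) \<noteq> 0"
            using \<rho>(6)[OF i(2), of a] a i(1) by auto
          then obtain t where t: "t \<in> gr (int d - 3 + 2 * int N - i)" "\<rho> (a * t) \<noteq> 0" using i(1) by auto
          \<comment> \<open>Testing a against h t, which is in J because h is, turns the pairing
            into \<rho> (a t), and there the trace is nondegenerate.\<close>
          have "h * t \<in> ?W" using hidD(4)[OF hJ h(3)] gr_mult_eq[OF h(1) t(1), of "i' + 2 * int N"] i' by auto
          then have "\<beta> a (h * t) = 0" by (rule nd)
          moreover have "a * (h * t) \<doteq> h * (a * t)" by (simp add: algebra_simps)
          then have "\<beta> a (h * t) = \<rho> (a * t)" by (rule \<beta>)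
          ultimately show False using t by simp
        qed
      qed
    qed
    \<comment> \<open>The linear values of H J in degrees i' + N and i' + 2N combine to d i' +
      \<gamma>; the unknown H J i' enters through \<open>rd_xyN\<close>.\<close>
    then have "H I i + rd ?U \<le> H J (i' + 2 * int N)" unfolding H_def rd_def by linarith
    then show ?thesis
      using HJ[OF N(3)] HJ[OF N'] rd_xyN[OF J, of N "i' + int N"] by (simp add: algebra_simps)
  qed
qed

text \<open>The duality inequality is applied to (I, J) and to (J, I). The sum of the two is an
  equality because \<gamma> + \<delta> = - d (d - 3 + m), so each of them is sharp.\<close>

lemma riemann_roch:
  assumes I: "closed I" and J: "closed J" and h: "h \<in> gr m" "\<not> F dvd h" "h \<in> I" "h \<in> J"
    and IJ: "\<And>a b. a \<in> I \<Longrightarrow> b \<in> J \<Longrightarrow> a * b \<in> princ h"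
    and HI: "\<And>n. n \<ge> n0 \<Longrightarrow> H I n = int d * n + \<gamma>"
    and HJ: "\<And>n. n \<ge> n1 \<Longrightarrow> H J n = int d * n + \<delta>"
    and deg: "\<gamma> + \<delta> = - int d * (int d - 3 + m)"
    and i: "i + j = int d - 3 + m"
  shows "H J j = H I i + int d * j + \<delta>"
proof -
  have "H I i + (int d * j + \<delta>) \<le> H J j"
    by (rule duality_inequality[OF closedD(1)[OF I] J h(1,2,4) IJ HJ]) (use i in auto)
  moreover have "H J j + (int d * i + \<gamma>) \<le> H I i"
  proof (rule duality_inequality[OF closedD(1)[OF J] I h(1,2,3) _ HI])
    show "b * a \<in> princ h" if "b \<in> J" "a \<in> I" for a b
      using IJ[OF that(2,1)] by (simp add: mult.commute)
    show "i = int d - 3 + m - j" using i by simp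
  qed
  moreover have "int d * i = int d * (int d - 3 + m) - int d * j"
  proof -
    have i_eq: "i = int d - 3 + m - j" using i by simp
    show ?thesis by (subst i_eq) (simp add: algebra_simps)
  qed
  ultimately show ?thesis using deg by (simp add: algebra_simps)
qed

end

section \<open>Avoiding finitely many subspaces\<close>

context lin_space
begin

text \<open>The line v + t w, with v outside the earlier subspaces and w outside the new one, meets
  each subspace for at most one parameter t, and the field is infinite.\<close>

lemma exists_avoiding_subspaces:
  assumes inf: "infinite (UNIV :: 'a set)" and V: "subspace V" and fin: "finite \<B>"
    and B: "\<And>B. B \<in> \<B> \<Longrightarrow> subspace B" "\<And>B. B \<in> \<B> \<Longrightarrow> \<not> V \<subseteq> B"
  shows "\<exists>v\<in>V. \<forall>B\<in>\<B>. v \<notin> B"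
  using fin B
proof (induction \<B> rule: finite_induct)
  case empty
  then show ?case using subspace_0[OF V] by blast
next
  case (insert C \<B>)
  then obtain v where v: "v \<in> V" "\<forall>B\<in>\<B>. v \<notin> B" by (meson insertI2)
  obtain w where w: "w \<in> V" "w \<notin> C" using insert.prems(2) by blast
  have *: "finite {t. v + scale t w \<in> B}" if B: "subspace B" "\<not> (v \<in> B \<and> w \<in> B)" for B
  proof -
    have "t = u" if t: "v + scale t w \<in> B" "v + scale u w \<in> B" for t u
    proof (rule ccontr)
      assume ne: "t \<noteq> u"
      have "(v + scale t w) - (v + scale u w) \<in> B" by (rule subspace_diff[OF B(1) t])
      then have "scale (t - u) w \<in> B" by (simp add: scale_left_diff_distrib)
      then have "scale (1 / (t - u)) (scale (t - u) w) \<in> B" by (rule subspace_scale[OF B(1)])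
      then have wB: "w \<in> B" using ne by simp
      have "(v + scale t w) - scale t w \<in> B"
        by (rule subspace_diff[OF B(1) t(1) subspace_scale[OF B(1) wB]])
      then show False using B(2) wB by simp
    qed
    then have "{t. v + scale t w \<in> B} = {} \<or> (\<exists>t. {t. v + scale t w \<in> B} = {t})" by blast
    then show ?thesis by auto
  qed
  have "finite (\<Union>B\<in>insert C \<B>. {t. v + scale t w \<in> B})"
  proof (rule finite_UN_I)
    show "finite (insert C \<B>)" using insert.hyps by simp
    show "finite {t. v + scale t w \<in> B}" if "B \<in> insert C \<B>" for B
      by (rule *) (use that insert.prems(1) w v in auto)
  qed
  then obtain t where t: "t \<notin> (\<Union>B\<in>insert C \<B>. {t. v + scale t w \<in> B})"
    using inf by (metis UNIV_I finite_subset subsetI)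
  have "v + scale t w \<in> V" by (intro subspace_add[OF V] subspace_scale[OF V] v w)
  then show ?case using t by blast
qed

end

section \<open>Locally principal ideals\<close>

lemma point_eq_scale:
  assumes "proj_point p = proj_point q" "q \<noteq> (0, 0, 0)"
  shows "\<exists>t. t \<noteq> 0 \<and> (case p of (a, b, c) \<Rightarrow> q = (t * a, t * b, t * (c :: 'k::field)))"
proof -
  obtain a b c a' b' c' where p: "p = (a, b, c)" and q: "q = (a', b', c')" by (metis prod_cases3)
  have "q \<in> proj_point q" unfolding proj_point_def q by (auto intro!: image_eqI[of _ _ 1])
  then obtain t where "q = (t * a, t * b, t * c)" using assms(1) unfolding proj_point_def p by auto
  moreover from this have "t \<noteq> 0" using assms(2) by auto
  ultimately show ?thesis using p by auto
qed

lemma eval3_proj_point_cong: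
  assumes "proj_point p = proj_point q" "q \<noteq> (0, 0, 0)" "f \<in> gr n"
  shows "eval3 f p = 0 \<longleftrightarrow> eval3 f q = 0"
proof (cases "n < 0")
  case True
  then have "f = 0" using assms(3) gr_neg[of n, where 'a = 'a] by simp
  then show ?thesis by simp
next
  case False
  then obtain m where n: "n = int m" by (metis nonneg_int_cases not_less)
  obtain a b c where p: "p = (a, b, c)" by (metis prod_cases3)
  obtain t where "t \<noteq> 0" "q = (t * a, t * b, t * c)" using point_eq_scale[OF assms(1,2)] p by auto
  then show ?thesis using eval3_scale_point[of f m t a b c] assms(3) p n by auto
qed

context plane_curve
begin

lemma hid_quotient:
  assumes I: "hid I" and f: "f \<in> gr m"
  shows "hid {q. q * f \<in> I}"
  unfolding hid_def
proof (intro conjI ballI allI)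
  show "0 \<in> {q. q * f \<in> I}" using hidD(1)[OF I] by simp
  fix a assume "a \<in> {q. q * f \<in> I}"
  then have a: "a * f \<in> I" by simp
  show "r * a \<in> {q. q * f \<in> I}" for r using hidD(3)[OF I a, of r] by (simp add: mult.assoc)
  show "hcomp n a \<in> {q. q * f \<in> I}" for n
    using hidD(5)[OF I a, of "n + m"] by (simp add: hcomp_mult[OF f])
  fix b assume "b \<in> {q. q * f \<in> I}"
  then show "a + b \<in> {q. q * f \<in> I}" using hidD(2)[OF I a, of "b * f"] by (simp add: distrib_right)
qed

text \<open>The q with q f in I form a homogeneous ideal without zeros: points of the curve are
  covered by hypothesis, all others by F. By the Nullstellensatz it contains all forms of some
  degree, and saturation gives f.\<close>

lemma local_global:
  assumes I: "closed I" and f: "f \<in> gr m"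
    and loc: "\<And>p. p \<in> points F \<Longrightarrow> \<exists>q. eval3 q p \<noteq> 0 \<and> q * f \<in> I"
  shows "f \<in> I"
proof -
  note hid = closedD(1)[OF I]
  have "\<exists>N. gr (int N) \<subseteq> {q. q * f \<in> I}"
  proof (rule projective_nullstellensatz[OF hid_quotient[OF hid f]])
    fix p :: "'k point" assume p: "p \<noteq> (0, 0, 0)"
    show "\<exists>q\<in>{q. q * f \<in> I}. eval3 q p \<noteq> 0"
    proof (cases "eval3 F p = 0")
      case True
      then show ?thesis using loc[of p] p by (auto simp: points_def)
    next
      case False
      then show ?thesis using hidD(4)[OF hid closedD(2)[OF I]] by auto
    qed
  qed
  then obtain N where N: "gr (int N) \<subseteq> {q. q * f \<in> I}" by blast
  show ?thesis
  proof (rule closedD(3)[OF I])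
    fix g :: "'k poly3" assume "g \<in> gr (int N)"
    then have "g * f \<in> I" using N by blast
    then show "f * g \<in> I" by (simp add: mult.commute)
  qed
qed

text \<open>Generation of the stalk of I at p, with denominators cleared. The cofactor a may be
  inhomogeneous; a component of it is taken where one is needed.\<close>

definition locgen :: "'k poly3 set \<Rightarrow> 'k point \<Rightarrow> 'k poly3 \<Rightarrow> bool" where
  "locgen I p g \<longleftrightarrow> g \<in> I \<and> (\<exists>n. g \<in> gr n) \<and>
     (\<forall>f\<in>I. \<forall>k. f \<in> gr k \<longrightarrow> (\<exists>j b a. b \<in> gr j \<and> eval3 b p \<noteq> 0 \<and> b * f \<doteq> a * g))"

definition locally_principal :: "'k poly3 set \<Rightarrow> bool" where
  "locally_principal I \<longleftrightarrow> (\<forall>p\<in>points F. \<exists>g. locgen I p g)"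

text \<open>For a group of points of degree \<alpha> the constant is
  \<open>euler - int \<alpha>\<close>; leaving it free treats I and its linked ideals alike.\<close>

definition eventually_linear :: "'k poly3 set \<Rightarrow> int \<Rightarrow> bool" where
  "eventually_linear I \<gamma> \<longleftrightarrow> (\<exists>n0. \<forall>n\<ge>n0. H I n = int d * n + \<gamma>)"

text \<open>Where the Hilbert function is linear its second difference vanishes, so x I + y I fills
  I in that degree by dimension. This supplies finite generation of I.\<close>

lemma eventually_generated:
  assumes I: "closed I" and ev: "eventually_linear I \<gamma>"
  shows "\<exists>n1. \<forall>n>n1. \<forall>f\<in>I \<inter> gr n. \<exists>u\<in>I \<inter> gr (n - 1). \<exists>v\<in>I \<inter> gr (n - 1). f \<doteq> x * u + y * v"
proof -
  note hid = closedD(1)[OF I]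
  obtain n0 where n0: "\<And>n. n \<ge> n0 \<Longrightarrow> H I n = int d * n + \<gamma>"
    using ev unfolding eventually_linear_def by blast
  have "\<exists>u\<in>I \<inter> gr (n - 1). \<exists>v\<in>I \<inter> gr (n - 1). f \<doteq> x * u + y * v"
    if n: "n > n0 + 2" and f: "f \<in> I \<inter> gr n" for n f
  proof -
    have s: "xyN I 1 (n - 1) \<subseteq> I \<inter> gr n" using xyN_props(3)[OF hid, of 1 "n - 1"] by simp
    have "H I n = 2 * H I (n - 1) - H I (n - 2)"
      using n0[of n] n0[of "n - 1"] n0[of "n - 2"] n by (simp add: algebra_simps)
    then have q: "lin3.qdim zeroF (I \<inter> gr n) \<le> lin3.qdim zeroF (xyN I 1 (n - 1))"
      using rd_xyN[OF I, of 1 "n - 1"] unfolding H_def rd_def by simp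
    have s': "\<exists>w\<in>I \<inter> gr n. v - w \<in> zeroF" if "v \<in> xyN I 1 (n - 1)" for v
      using s that by (intro bexI[of _ v]) auto
    have "\<exists>v\<in>xyN I 1 (n - 1). f - v \<in> zeroF"
      by (rule lin3.qdim_eq_imp[OF sub_zeroF xyN_props(1)[OF hid] fin_dim_piece s' q f])
    then show ?thesis unfolding xyN_def by auto
  qed
  then show ?thesis by blast
qed

lemma princ_dvd: "F dvd f \<Longrightarrow> f \<in> princ g"
  unfolding princ_def by (auto intro: exI[of _ 0])

lemma princ_cong: "f \<doteq> f' \<Longrightarrow> f' \<in> princ g \<Longrightarrow> f \<in> princ g"
  unfolding princ_def using cong_trans by blast

lemma hid_quot_princ:
  assumes g: "g \<in> gr m" and u: "u \<in> gr j"
  shows "hid {f. u * f \<in> princ g}"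
  using hid_quotient[OF hid_princ[OF g] u] by (simp add: mult.commute)

text \<open>Each element of I comes with its own denominator at p. A product of finitely many
  denominators serves bases of I in all degrees up to n1, and the higher degrees are generated from
  there by x and y, so a single u works for all of I.\<close>

lemma locgen_uniform:
  assumes I: "closed I" and ev: "eventually_linear I \<gamma>" and g: "locgen I p g"
  shows "\<exists>u j. u \<in> gr j \<and> eval3 u p \<noteq> 0 \<and> u \<in> colon (princ g) I"
proof -
  note hid = closedD(1)[OF I]
  obtain n where gn: "g \<in> gr n" using g unfolding locgen_def by blast
  have hp: "hid (princ g)" by (rule hid_princ[OF gn])
  have step: "\<exists>u j. u \<in> gr j \<and> eval3 u p \<noteq> 0 \<and> (\<forall>t\<in>T. u * t \<in> princ g)"
    if "finite T" "\<forall>t\<in>T. t \<in> I \<and> (\<exists>k. t \<in> gr k)" for T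
    using that
  proof (induction T rule: finite_induct)
    case empty
    then show ?case using one_gr by (intro exI[of _ 1] exI[of _ 0]) auto
  next
    case (insert t T)
    then obtain u j where u: "u \<in> gr j" "eval3 u p \<noteq> 0" "\<forall>t\<in>T. u * t \<in> princ g" by auto
    obtain i b a where b: "b \<in> gr i" "eval3 b p \<noteq> 0" "b * t \<doteq> a * g"
      using insert.prems g unfolding locgen_def by blast
    have "b * t \<in> princ g" using b(3) unfolding princ_def by (auto simp: mult.commute)
    then have "u * (b * t) \<in> princ g" by (rule hidD(3)[OF hp])
    moreover have "b * (u * s) \<in> princ g" if "s \<in> T" for s
      by (rule hidD(3)[OF hp]) (use u(3) that in blast)
    ultimately have "\<forall>s\<in>insert t T. u * b * s \<in> princ g" by (auto simp: algebra_simps)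
    moreover have "u * b \<in> gr (j + i)" "eval3 (u * b) p \<noteq> 0"
      using gr_mult[OF u(1) b(1)] u(2) b(2) by (auto simp: eval3_mult)
    ultimately show ?case by blast
  qed
  obtain n1 where n1: "\<And>n f. n > n1 \<Longrightarrow> f \<in> I \<inter> gr n \<Longrightarrow>
      \<exists>u\<in>I \<inter> gr (n - 1). \<exists>v\<in>I \<inter> gr (n - 1). f \<doteq> x * u + y * v"
    using eventually_generated[OF I ev] by blast
  have "\<exists>T. finite T \<and> T \<subseteq> I \<inter> gr k \<and> I \<inter> gr k \<subseteq> lin3.span T" for k
  proof -
    obtain T where T: "T \<subseteq> I \<inter> gr k" "lin3.independent T" "I \<inter> gr k \<subseteq> lin3.span T"
      by (rule lin3.basis_exists[of "I \<inter> gr k"])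
    moreover have "finite T" by (rule lin3.fin_dim_basis[OF fin_dim_piece T(2,1)])
    ultimately show ?thesis by blast
  qed
  then have "\<forall>k. \<exists>T. finite T \<and> T \<subseteq> I \<inter> gr k \<and> I \<inter> gr k \<subseteq> lin3.span T" by blast
  then obtain T where "\<forall>k. finite (T k) \<and> T k \<subseteq> I \<inter> gr k \<and> I \<inter> gr k \<subseteq> lin3.span (T k)"
    by (elim choice[THEN exE])
  then have T: "\<And>k. finite (T k)" "\<And>k. T k \<subseteq> I \<inter> gr k" "\<And>k. I \<inter> gr k \<subseteq> lin3.span (T k)"
    by simp_all
  have "\<exists>u j. u \<in> gr j \<and> eval3 u p \<noteq> 0 \<and> (\<forall>t\<in>(\<Union>k\<in>{0..n1}. T k). u * t \<in> princ g)"
    by (rule step) (use T(1,2) in blast)+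
  then obtain u j where u: "u \<in> gr j" "eval3 u p \<noteq> 0" "\<And>k t. k \<in> {0..n1} \<Longrightarrow> t \<in> T k \<Longrightarrow> u * t \<in> princ g"
    by auto
  let ?S = "{f. u * f \<in> princ g}"
  have S: "hid ?S" by (rule hid_quot_princ[OF gn u(1)])
  have small: "I \<inter> gr k \<subseteq> ?S" if "k \<le> n1" for k
  proof (cases "k < 0")
    case True
    then show ?thesis using hidD(1)[OF S] by (auto simp: gr_neg)
  next
    case False
    have "lin3.span (T k) \<subseteq> ?S"
      by (rule lin3.span_minimal[OF _ hid_subspace[OF S]]) (use u(3)[of k] that False in auto)
    then show ?thesis using T(3) by blast
  qed
  have large: "I \<inter> gr k \<subseteq> ?S" if "k \<ge> n1" for k
    using that
  proof (induction k rule: int_ge_induct)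
    case base
    then show ?case using small by blast
  next
    case (step k)
    show ?case
    proof
      fix f assume "f \<in> I \<inter> gr (k + 1)"
      then obtain v w where vw: "v \<in> I \<inter> gr k" "w \<in> I \<inter> gr k" "f \<doteq> x * v + y * w"
        using n1[of "k + 1" f] step.hyps by auto
      have "x * v + y * w \<in> ?S" by (intro hidD(2)[OF S] hidD(3)[OF S]) (use vw step.IH in auto)
      then show "f \<in> ?S" using princ_cong[OF cong_mult_left[OF vw(3)]] by simp
    qed
  qed
  have "I \<subseteq> ?S"
  proof
    fix f assume f: "f \<in> I"
    show "f \<in> ?S"
    proof (rule hid_memI[OF S])
      fix k
      have "hcomp k f \<in> I \<inter> gr k" using hidD(5)[OF hid f] hcomp_gr by blast
      then show "hcomp k f \<in> ?S" using small[of k] large[of k] by (cases "k \<le> n1") auto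
    qed
  qed
  then show ?thesis using u(1,2) unfolding colon_def by blast
qed

lemma locgenI_of_uniform:
  assumes "g \<in> I" "g \<in> gr n" "u \<in> gr j" "eval3 u p \<noteq> 0" "\<And>b. b \<in> I \<Longrightarrow> u * b \<in> princ g"
  shows "locgen I p g"
  unfolding locgen_def
proof (intro conjI ballI allI impI)
  fix f k assume "f \<in> I"
  then obtain c where "u * f \<doteq> g * c" using assms(5) unfolding princ_def by blast
  then show "\<exists>j b a. b \<in> gr j \<and> eval3 b p \<noteq> 0 \<and> b * f \<doteq> a * g"
    using assms(3,4) by (intro exI[of _ j] exI[of _ u] exI[of _ c]) (simp add: mult.commute)
qed (use assms in auto)

subsection \<open>Linked ideals\<close>

text \<open>Here \<open>G = g g'\<close> locally at \<open>p\<close>.\<close>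

lemma linked_generator:
  assumes I: "closed I" and G: "G \<in> I" "G \<in> gr s" "\<not> F dvd G"
    and g: "g \<in> gr n" and u: "u \<in> gr j" "u \<in> colon (princ g) I"
  shows "\<exists>g'. u * G \<doteq> g * g' \<and> g' \<in> colon (princ G) I \<and> (\<exists>k. g' \<in> gr k) \<and>
    (\<forall>b\<in>colon (princ G) I. g \<in> I \<longrightarrow> u * b \<in> princ g')"
proof -
  obtain c where "u * G \<doteq> g * c" using u(2) G(1) unfolding colon_def princ_def by blast
  then have "hcomp (j + s) (u * G) \<doteq> hcomp (j + s) (g * c)" by (rule cong_hcomp)
  then have c: "u * G \<doteq> g * hcomp (j + s - n) c"
    using hcomp_of_gr[OF gr_mult[OF u(1) G(2)]] by (simp add: hcomp_mult_left[OF g])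
  define g' where "g' = hcomp (j + s - n) c"
  have ugg: "u * G \<doteq> g * g'" using c g'_def by simp
  show ?thesis
  \<comment> \<open>No point is fixed here, so u may be zero in S; then g' = 0 meets all the
    conditions.\<close>
  proof (cases "F dvd u")
    case True
    show ?thesis
    proof (rule exI[of _ 0], intro conjI ballI impI)
      show "u * G \<doteq> g * 0" using True by simp
      show "0 \<in> colon (princ G) I" unfolding colon_def by (auto intro: princ_dvd)
      show "\<exists>k. (0 :: 'k poly3) \<in> gr k" by simp
      fix b show "u * b \<in> princ 0" by (rule princ_dvd) (use True in simp)
    qed
  next
    case False
    have ng: "\<not> F dvd g" using cong_dvd[OF ugg] dvd_mult_iff False G(3) by blast
    have "g' \<in> colon (princ G) I"
      unfolding colon_def
    proof (intro CollectI ballI)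
      fix a assume "a \<in> I"
      then obtain e where e: "u * a \<doteq> g * e" using u(2) unfolding colon_def princ_def by blast
      have "u * (g' * a) = g' * (u * a)" by (simp add: algebra_simps)
      also have "\<dots> \<doteq> g' * (g * e)" by (rule cong_mult_left[OF e])
      also have "g' * (g * e) = (g * g') * e" by (simp add: algebra_simps)
      finally have 1: "u * (g' * a) \<doteq> (g * g') * e" .
      have "(g * g') * e \<doteq> (u * G) * e" by (rule cong_mult_right[OF cong_sym[OF ugg]])
      then have "u * (g' * a) \<doteq> u * (G * e)" using cong_trans[OF 1] by (simp add: mult.assoc)
      then have "g' * a \<doteq> G * e" using cong_cancel False by blast
      then show "g' * a \<in> princ G" unfolding princ_def by blast
    qed
    moreover have "u * b \<in> princ g'" if b: "b \<in> colon (princ G) I" "g \<in> I" for b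
    proof -
      obtain e where e: "b * g \<doteq> G * e" using b unfolding colon_def princ_def by blast
      have "g * (u * b) = u * (b * g)" by (simp add: algebra_simps)
      also have "\<dots> \<doteq> u * (G * e)" by (rule cong_mult_left[OF e])
      also have "u * (G * e) = (u * G) * e" by (simp add: algebra_simps)
      finally have 1: "g * (u * b) \<doteq> (u * G) * e" .
      have "(u * G) * e \<doteq> (g * g') * e" by (rule cong_mult_right[OF ugg])
      then have "g * (u * b) \<doteq> g * (g' * e)" using cong_trans[OF 1] by (simp add: mult.assoc)
      then have "u * b \<doteq> g' * e" using cong_cancel ng by blast
      then show ?thesis unfolding princ_def by blast
    qed
    ultimately show ?thesis using ugg g'_def hcomp_gr by blast
  qed
qed

text \<open>At a point where g generates I, the quotient g' of u G by g generates the linked ideal,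
  with the same denominator u.\<close>

lemma locally_principal_colon:
  assumes I: "closed I" and ev: "eventually_linear I \<gamma>" and lp: "locally_principal I"
    and G: "G \<in> I" "G \<in> gr s" "\<not> F dvd G"
  shows "locally_principal (colon (princ G) I)"
  unfolding locally_principal_def
proof
  fix p assume p: "p \<in> points F"
  then obtain g where g: "locgen I p g" using lp unfolding locally_principal_def by blast
  then obtain n where gn: "g \<in> gr n" "g \<in> I" unfolding locgen_def by blast
  obtain u j where u: "u \<in> gr j" "eval3 u p \<noteq> 0" "u \<in> colon (princ g) I"
    using locgen_uniform[OF I ev g] by blast
  obtain g' k where g': "g' \<in> colon (princ G) I" "g' \<in> gr k" "\<And>b. b \<in> colon (princ G) I \<Longrightarrow> u * b \<in> princ g'"
    using linked_generator[OF I G gn(1) u(1,3)] gn(2) by blast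
  show "\<exists>g. locgen (colon (princ G) I) p g"
    using locgenI_of_uniform[OF g'(1,2) u(1,2) g'(3)] by blast
qed

text \<open>Reflexivity of linkage is checked locally. If f multiplies the linked ideal into (F, G),
  then f g' = G e in S; together with u G = g g' this gives u f = g e, which is in I, and u does not
  vanish at p.\<close>

lemma colon_colon:
  assumes I: "closed I" and ev: "eventually_linear I \<gamma>" and lp: "locally_principal I"
    and G: "G \<in> I" "G \<in> gr s" "\<not> F dvd G"
  shows "colon (princ G) (colon (princ G) I) = I"
proof
  have cG: "closed (princ G)" by (rule closed_princ[OF G(2,3)])
  have cJ: "closed (colon (princ G) I)" by (rule closed_colon[OF cG closedD(1)[OF I]])
  have cI: "closed (colon (princ G) (colon (princ G) I))"
    by (rule closed_colon[OF cG closedD(1)[OF cJ]])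
  show "I \<subseteq> colon (princ G) (colon (princ G) I)" by (auto simp: colon_def mult.commute)
  show "colon (princ G) (colon (princ G) I) \<subseteq> I"
  proof
    fix f assume f: "f \<in> colon (princ G) (colon (princ G) I)"
    show "f \<in> I"
    proof (rule hid_memI[OF closedD(1)[OF I]])
      fix m
      let ?f = "hcomp m f"
      have fm: "?f \<in> colon (princ G) (colon (princ G) I)" by (rule hidD(5)[OF closedD(1)[OF cI] f])
      show "?f \<in> I"
      proof (rule local_global[OF I hcomp_gr])
        fix p assume p: "p \<in> points F"
        obtain g where g: "locgen I p g" using lp p unfolding locally_principal_def by blast
        then obtain n where gn: "g \<in> gr n" "g \<in> I" unfolding locgen_def by blast
        obtain u j where u: "u \<in> gr j" "eval3 u p \<noteq> 0" "u \<in> colon (princ g) I"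
          using locgen_uniform[OF I ev g] by blast
        obtain g' where g': "u * G \<doteq> g * g'" "g' \<in> colon (princ G) I"
          using linked_generator[OF I G gn(1) u(1,3)] by blast
        obtain e where e: "?f * g' \<doteq> G * e" using fm g'(2) unfolding colon_def princ_def by blast
        have "G * (u * ?f) = ?f * (u * G)" by (simp add: algebra_simps)
        also have "\<dots> \<doteq> ?f * (g * g')" by (rule cong_mult_left[OF g'(1)])
        also have "?f * (g * g') = g * (?f * g')" by (simp add: algebra_simps)
        finally have 1: "G * (u * ?f) \<doteq> g * (?f * g')" .
        have "g * (?f * g') \<doteq> g * (G * e)" by (rule cong_mult_left[OF e])
        then have "G * (u * ?f) \<doteq> G * (g * e)" using cong_trans[OF 1] by (simp add: mult.left_commute)
        then have "u * ?f \<doteq> g * e" using cong_cancel G(3) by blast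
        then have "u * ?f \<in> I" using closed_cong[OF I] hidD(4)[OF closedD(1)[OF I] gn(2)] by blast
        then show "\<exists>q. eval3 q p \<noteq> 0 \<and> q * ?f \<in> I" using u(2) by blast
      qed
    qed
  qed
qed

subsection \<open>A section generating the ideal on its support\<close>

lemma locgen_mult:
  assumes "locgen I p g" "hid I" "l \<in> gr m" "eval3 l p \<noteq> 0"
  shows "locgen I p (l * g)"
  unfolding locgen_def
proof (intro conjI ballI allI impI)
  show "l * g \<in> I" using assms(1) hidD(3)[OF assms(2)] unfolding locgen_def by blast
  show "\<exists>n. l * g \<in> gr n" using assms(1,3) gr_mult unfolding locgen_def by blast
  fix f k assume "f \<in> I" "f \<in> gr k"
  then obtain j b a where b: "b \<in> gr j" "eval3 b p \<noteq> 0" "b * f \<doteq> a * g"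
    using assms(1) unfolding locgen_def by blast
  have "l * b * f \<doteq> a * (l * g)" using cong_mult_left[OF b(3), of l] by (simp add: algebra_simps)
  moreover have "l * b \<in> gr (m + j)" "eval3 (l * b) p \<noteq> 0"
    using gr_mult[OF assms(3) b(1)] assms(4) b(2) by (auto simp: eval3_mult)
  ultimately show "\<exists>j b a. b \<in> gr j \<and> eval3 b p \<noteq> 0 \<and> b * f \<doteq> a * (l * g)" by blast
qed

text \<open>The forms f whose quotient f / g = a / b vanishes at p. If g generates I at p, a form of
  I of the same degree outside this subspace generates I there as well.\<close>

definition badset :: "'k point \<Rightarrow> 'k poly3 \<Rightarrow> 'k poly3 set" where
  "badset p g = {f. \<exists>j b a. b \<in> gr j \<and> a \<in> gr j \<and> eval3 b p \<noteq> 0 \<and> eval3 a p = 0 \<and> b * f \<doteq> a * g}"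

lemma subspace_badset: "lin3.subspace (badset p g)"
  unfolding lin3.subspace_def
proof (intro conjI ballI allI)
  show "0 \<in> badset p g"
    unfolding badset_def using one_gr by (intro CollectI exI[of _ 0] exI[of _ 1]) auto
  fix f assume "f \<in> badset p g"
  then obtain j b a where b: "b \<in> gr j" "a \<in> gr j" "eval3 b p \<noteq> 0" "eval3 a p = 0" "b * f \<doteq> a * g"
    unfolding badset_def by blast
  show "sc c f \<in> badset p g" for c
    unfolding badset_def
  proof (intro CollectI exI conjI)
    show "b * sc c f \<doteq> sc c a * g" using cong_mult_left[OF b(5), of "const3 c"] by (simp add: sc_def algebra_simps)
  qed (use b sc_gr in auto)
  fix f' assume "f' \<in> badset p g"
  then obtain i b' a' where b': "b' \<in> gr i" "a' \<in> gr i" "eval3 b' p \<noteq> 0" "eval3 a' p = 0" "b' * f' \<doteq> a' * g"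
    unfolding badset_def by blast
  show "f + f' \<in> badset p g"
    unfolding badset_def
  proof (intro CollectI exI conjI)
    show "b * b' * (f + f') \<doteq> (a * b' + a' * b) * g"
      using cong_add[OF cong_mult_left[OF b(5), of b'] cong_mult_left[OF b'(5), of b]]
      by (simp add: algebra_simps)
    show "b * b' \<in> gr (j + i)" by (rule gr_mult[OF b(1) b'(1)])
    show "a * b' + a' * b \<in> gr (j + i)"
      by (rule gr_add[OF gr_mult[OF b(2) b'(1)] gr_mult_eq[OF b'(2) b(1)]]) simp
  qed (use b b' in \<open>auto simp: eval3_mult eval3_add\<close>)
qed

lemma locgen_of_not_bad:
  assumes g: "locgen I p g" "g \<in> gr m" and f: "f \<in> I" "f \<in> gr m" "f \<notin> badset p g"
  shows "locgen I p f"
  unfolding locgen_def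
proof (intro conjI ballI allI impI)
  show "f \<in> I" "\<exists>n. f \<in> gr n" using f by blast+
  obtain j b a where b: "b \<in> gr j" "eval3 b p \<noteq> 0" "b * f \<doteq> a * g"
    using g(1) f(1,2) unfolding locgen_def by blast
  have "hcomp (j + m) (b * f) \<doteq> hcomp (j + m) (a * g)" by (rule cong_hcomp[OF b(3)])
  then have b3: "b * f \<doteq> hcomp j a * g"
    using hcomp_of_gr[OF gr_mult[OF b(1) f(2)]] by (simp add: hcomp_mult[OF g(2)])
  then have nz: "eval3 (hcomp j a) p \<noteq> 0" using f(3) b(1,2) hcomp_gr unfolding badset_def by blast
  fix f' k assume f': "f' \<in> I" "f' \<in> gr k"
  obtain i b' a' where b': "b' \<in> gr i" "eval3 b' p \<noteq> 0" "b' * f' \<doteq> a' * g"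
    using g(1) f' unfolding locgen_def by blast
  have "hcomp j a * (b' * f') \<doteq> hcomp j a * (a' * g)" by (rule cong_mult_left[OF b'(3)])
  moreover have "hcomp j a * (a' * g) \<doteq> a' * (b * f)"
    using cong_mult_left[OF cong_sym[OF b3], of a'] by (simp add: algebra_simps)
  ultimately have "hcomp j a * (b' * f') \<doteq> a' * (b * f)" by (rule cong_trans)
  then have "hcomp j a * b' * f' \<doteq> a' * b * f" by (simp add: mult.assoc)
  moreover have "hcomp j a * b' \<in> gr (j + i)" by (rule gr_mult[OF hcomp_gr b'(1)])
  moreover have "eval3 (hcomp j a * b') p \<noteq> 0" using nz b'(2) by (simp add: eval3_mult)
  ultimately show "\<exists>j b a. b \<in> gr j \<and> eval3 b p \<noteq> 0 \<and> b * f' \<doteq> a * f" by blast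
qed

lemma eventually_linear_nonzero:
  assumes ev: "eventually_linear I \<gamma>"
  shows "\<exists>n1. \<forall>n\<ge>n1. \<exists>f\<in>I \<inter> gr n. \<not> F dvd f"
proof -
  obtain n0 where n0: "\<And>n. n \<ge> n0 \<Longrightarrow> H I n = int d * n + \<gamma>"
    using ev unfolding eventually_linear_def by blast
  have "\<exists>f\<in>I \<inter> gr n. \<not> F dvd f" if "n \<ge> max n0 (\<bar>\<gamma>\<bar> + 1)" for n
  proof (rule H_pos_imp)
    have "1 * n \<le> int d * n" by (rule mult_right_mono) (use that d_pos in linarith)+
    then show "0 < H I n" using n0[of n] that by linarith
  qed
  then show ?thesis by blast
qed

text \<open>I contains elements that are nonzero in S. A generator that is zero in S would make a
  denominator b divisible by F, hence zero at p.\<close>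

lemma locgen_ndvd:
  assumes I: "hid I" and ev: "eventually_linear I \<gamma>" and g: "locgen I p g" and p: "p \<in> points F"
  shows "\<not> F dvd g"
proof
  assume dg: "F dvd g"
  obtain n1 where "\<forall>n\<ge>n1. \<exists>f\<in>I \<inter> gr n. \<not> F dvd f" using eventually_linear_nonzero[OF ev] by blast
  then obtain f where f: "f \<in> I" "f \<in> gr n1" "\<not> F dvd f" by auto
  obtain j b a where b: "eval3 b p \<noteq> 0" "b * f \<doteq> a * g"
    using g f(1,2) unfolding locgen_def by blast
  have "F dvd b * f" using cong_dvd[OF b(2)] dg by simp
  then have "F dvd b" using dvd_mult_iff f(3) by blast
  then show False using b(1) p by (auto simp: points_def dvd_def eval3_mult)
qed

text \<open>Generators at the finitely many support points are brought to one degree m by powers of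
  linear forms not vanishing there. A general element of I of degree m avoids the multiples of F and
  all the subspaces \<open>badset p (g p)\<close>, so it generates I at each of these
  points.\<close>

lemma exists_generating_section:
  assumes I: "closed I" and ev: "eventually_linear I \<gamma>" and lp: "locally_principal I"
    and fin: "finite (support I)"
  shows "\<exists>h m. h \<in> I \<and> h \<in> gr m \<and> \<not> F dvd h \<and>
    (\<forall>p\<in>points F. (\<forall>f\<in>I. eval3 f p = 0) \<longrightarrow> (\<exists>u j. u \<in> gr j \<and> eval3 u p \<noteq> 0 \<and> u \<in> colon (princ h) I))"
proof -
  note hid = closedD(1)[OF I]
  \<comment> \<open>\<open>points F\<close> consists of coordinate vectors, infinitely many for each
    point of the support. One representative is fixed, and the result is carried to the others by
    homogeneity of u.\<close>
  define rep :: "'k point set \<Rightarrow> 'k point" where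
    "rep P = (SOME p. P = proj_point p \<and> p \<noteq> (0, 0, 0) \<and> (\<forall>f\<in>I. eval3 f p = 0))" for P
  have rep: "P = proj_point (rep P) \<and> rep P \<noteq> (0, 0, 0) \<and> (\<forall>f\<in>I. eval3 f (rep P) = 0)"
    if "P \<in> support I" for P
    unfolding rep_def by (rule someI_ex) (use that in \<open>auto simp: support_def\<close>)
  define S where "S = rep ` support I"
  have S: "finite S" "S \<subseteq> points F"
  proof -
    show "finite S" using fin by (simp add: S_def)
    show "S \<subseteq> points F"
    proof
      fix p assume "p \<in> S"
      then obtain P where P: "P \<in> support I" "p = rep P" unfolding S_def by blast
      show "p \<in> points F" using rep[OF P(1)] closedD(2)[OF I] unfolding P(2) points_def by blast
    qed
  qed
  have "\<exists>g. p \<in> S \<longrightarrow> locgen I p g" for p using lp S(2) unfolding locally_principal_def by blast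
  then obtain g0 where g0: "\<And>p. p \<in> S \<Longrightarrow> locgen I p (g0 p)" by metis
  then have "\<exists>n. p \<in> S \<longrightarrow> g0 p \<in> gr n" for p unfolding locgen_def by blast
  then obtain e where e: "\<And>p. p \<in> S \<Longrightarrow> g0 p \<in> gr (e p)" by metis
  obtain n1 where n1: "\<And>n. n \<ge> n1 \<Longrightarrow> \<exists>f\<in>I \<inter> gr n. \<not> F dvd f"
    using eventually_linear_nonzero[OF ev] by blast
  define m where "m = Max (insert n1 (e ` S))"
  have m: "n1 \<le> m" "\<And>p. p \<in> S \<Longrightarrow> e p \<le> m" using S(1) by (auto simp: m_def)
  have "\<exists>g. p \<in> S \<longrightarrow> locgen I p g \<and> g \<in> gr m" for p
  proof (cases "p \<in> S")
    case True
    then have "p \<noteq> (0, 0, 0)" using S(2) by (auto simp: points_def)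
    then obtain l where l: "l \<in> gr 1" "eval3 l p \<noteq> 0" using exists_form_nonzero_at by blast
    let ?k = "nat (m - e p)"
    have "locgen I p (l ^ ?k * g0 p)"
      by (rule locgen_mult[OF g0[OF True] hid gr_power_one[OF l(1)]]) (use l in \<open>simp add: eval3_power\<close>)
    moreover have "l ^ ?k * g0 p \<in> gr m"
      by (rule gr_mult_eq[OF gr_power_one[OF l(1)] e[OF True]]) (use m(2)[OF True] in simp)
    ultimately show ?thesis by blast
  qed auto
  then obtain g where g: "\<And>p. p \<in> S \<Longrightarrow> locgen I p (g p)" "\<And>p. p \<in> S \<Longrightarrow> g p \<in> gr m" by metis
  have "\<exists>h\<in>I \<inter> gr m. \<forall>B\<in>insert zeroF ((\<lambda>p. badset p (g p)) ` S). h \<notin> B"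
  proof (rule lin3.exists_avoiding_subspaces[OF infinite_UNIV_char_0 subspace_piece[OF hid]])
    show "finite (insert zeroF ((\<lambda>p. badset p (g p)) ` S))" using S(1) by simp
    show "lin3.subspace B" if "B \<in> insert zeroF ((\<lambda>p. badset p (g p)) ` S)" for B
      using that sub_zeroF subspace_badset by blast
    fix B assume "B \<in> insert zeroF ((\<lambda>p. badset p (g p)) ` S)"
    then consider "B = zeroF" | p where "p \<in> S" "B = badset p (g p)" by blast
    then show "\<not> I \<inter> gr m \<subseteq> B"
    proof cases
      case 1
      then show ?thesis using n1[OF m(1)] by blast
    next
      case 2
      have "g p \<notin> badset p (g p)"
      proof
        assume "g p \<in> badset p (g p)"
        then obtain b a where ba: "eval3 b p \<noteq> 0" "eval3 a p = 0" "b * g p \<doteq> a * g p"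
          unfolding badset_def by blast
        have "g p * b \<doteq> g p * a" using ba(3) by (simp add: mult.commute)
        then have "b \<doteq> a" using cong_cancel locgen_ndvd[OF hid ev g(1)] 2 S(2) by blast
        then have "eval3 (b - a) p = 0" using 2 S(2) by (auto simp: points_def dvd_def eval3_mult)
        then show False using ba by (simp add: eval3_diff)
      qed
      then show ?thesis using g[OF 2(1)] 2(2) unfolding locgen_def by blast
    qed
  qed
  then obtain h where h: "h \<in> I" "h \<in> gr m" "\<not> F dvd h" "\<And>p. p \<in> S \<Longrightarrow> h \<notin> badset p (g p)" by auto
  have "\<exists>u j. u \<in> gr j \<and> eval3 u p \<noteq> 0 \<and> u \<in> colon (princ h) I"
    if p: "p \<in> points F" "\<forall>f\<in>I. eval3 f p = 0" for p
  proof -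
    have p0: "p \<noteq> (0, 0, 0)" using p by (simp add: points_def)
    then have s: "proj_point p \<in> support I" using p(2) unfolding support_def by blast
    let ?q = "rep (proj_point p)"
    have q: "?q \<in> S" using s by (simp add: S_def)
    have "locgen I ?q h" by (rule locgen_of_not_bad[OF g(1)[OF q] g(2)[OF q] h(1,2) h(4)[OF q]])
    then obtain u j where u: "u \<in> gr j" "eval3 u ?q \<noteq> 0" "u \<in> colon (princ h) I"
      using locgen_uniform[OF I ev] by blast
    have "proj_point ?q = proj_point p" using rep[OF s] by simp
    then have "eval3 u p \<noteq> 0" using eval3_proj_point_cong[OF _ p0 u(1), of ?q] u(2) by blast
    then show ?thesis using u by blast
  qed
  then show ?thesis using h by blast
qed

text \<open>The Euler characteristic 1 - p of the structure sheaf, p = (d - 1)(d - 2)/2, which is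
  the constant term of the Hilbert polynomial of S.\<close>

definition euler :: int where "euler = int d * (3 - int d) div 2"

lemma two_euler: "2 * euler = 3 * int d - int d * int d"
proof -
  have "even (int d * (3 - int d))" by (cases "even (int d)") auto
  then show ?thesis unfolding euler_def by (simp add: algebra_simps)
qed

lemma H_UNIV_linear: "n \<ge> int d - 2 \<Longrightarrow> H UNIV n = int d * n + euler"
  using two_H_UNIV[of n] two_euler by simp

text \<open>For a generating h, the ideals I and J = (F, h) : I have no common zero, so I + J
  contains all forms of large degree and the intersection of I and J is (F, h). Counting dimensions
  gives the Hilbert polynomial of J, which \<open>riemann_roch\<close> takes as input.\<close>

lemma exists_hilbert_linked:
  assumes I: "closed I" and ev: "eventually_linear I \<gamma>" and lp: "locally_principal I"
    and fin: "finite (support I)"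
  shows "\<exists>h m. h \<in> I \<and> h \<in> gr m \<and> \<not> F dvd h \<and>
    (\<forall>i j. i + j = int d - 3 + m \<longrightarrow>
      H (colon (princ h) I) j = H I i + int d * j - int d * (int d - 3 + m) - \<gamma>)"
proof -
  note hid = closedD(1)[OF I]
  obtain n0 where n0: "\<And>n. n \<ge> n0 \<Longrightarrow> H I n = int d * n + \<gamma>"
    using ev unfolding eventually_linear_def by blast
  obtain h m where h: "h \<in> I" "h \<in> gr m" "\<not> F dvd h"
    and hu: "\<And>p. p \<in> points F \<Longrightarrow> (\<forall>f\<in>I. eval3 f p = 0) \<Longrightarrow>
      (\<exists>u j. u \<in> gr j \<and> eval3 u p \<noteq> 0 \<and> u \<in> colon (princ h) I)"
    using exists_generating_section[OF I ev lp fin] by blast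
  let ?J = "colon (princ h) I"
  have cp: "closed (princ h)" by (rule closed_princ[OF h(2,3)])
  note hp = closedD(1)[OF cp]
  have J: "closed ?J" by (rule closed_colon[OF cp hid])
  note hJ = closedD(1)[OF J]
  have hh: "h \<in> princ h" unfolding princ_def by (auto intro: exI[of _ 1])
  then have hinJ: "h \<in> ?J" unfolding colon_def using hidD(4)[OF hp] by blast
  have IJ: "a * b \<in> princ h" if "a \<in> I" "b \<in> ?J" for a b
    using that unfolding colon_def by (auto simp: mult.commute)
  let ?S = "{a + b |a b. a \<in> I \<and> b \<in> ?J}"
  have S: "hid ?S"
    unfolding hid_def
  proof (intro conjI ballI allI)
    show "0 \<in> ?S" using hidD(1)[OF hid] hidD(1)[OF hJ] by (intro CollectI exI[of _ 0]) simp
    fix s assume "s \<in> ?S"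
    then obtain a b where ab: "s = a + b" "a \<in> I" "b \<in> ?J" by blast
    show "r * s \<in> ?S" for r
      using hidD(3)[OF hid ab(2), of r] hidD(3)[OF hJ ab(3), of r] unfolding ab(1) distrib_left by blast
    show "hcomp n s \<in> ?S" for n
      using hidD(5)[OF hid ab(2), of n] hidD(5)[OF hJ ab(3), of n] unfolding ab(1) hcomp_add by blast
    fix s' assume "s' \<in> ?S"
    then obtain a' b' where ab': "s' = a' + b'" "a' \<in> I" "b' \<in> ?J" by blast
    have "s + s' = (a + a') + (b + b')" unfolding ab(1) ab'(1) by simp
    then show "s + s' \<in> ?S" using hidD(2)[OF hid ab(2) ab'(2)] hidD(2)[OF hJ ab(3) ab'(3)] by blast
  qed
  have "\<exists>N. gr (int N) \<subseteq> ?S"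
  proof (rule projective_nullstellensatz[OF S])
    fix p :: "'k point" assume p: "p \<noteq> (0, 0, 0)"
    have IS: "f \<in> ?S" if "f \<in> I" for f
      using that hidD(1)[OF hJ] by (intro CollectI exI[of _ f] exI[of _ 0]) simp
    have JS: "f \<in> ?S" if "f \<in> ?J" for f
      using that hidD(1)[OF hid] by (intro CollectI exI[of _ 0] exI[of _ f]) simp
    show "\<exists>f\<in>?S. eval3 f p \<noteq> 0"
    proof (cases "\<forall>f\<in>I. eval3 f p = 0")
      case True
      then have "p \<in> points F" using p closedD(2)[OF I] by (simp add: points_def)
      then show ?thesis using hu True JS by blast
    qed (use IS in blast)
  qed
  then obtain N where N: "gr (int N) \<subseteq> ?S" by blast
  \<comment> \<open>A form of large degree is u + v with u in I and v in J. Then a u and a v are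
    products of an element of I and one of J, hence in (F, h), and saturation of (F, h)
    finishes.\<close>
  have int: "a \<in> princ h" if a: "a \<in> I" "a \<in> ?J" for a
  proof (rule closedD(3)[OF cp])
    fix g :: "'k poly3" assume "g \<in> gr (int N)"
    then obtain u v where uv: "g = u + v" "u \<in> I" "v \<in> ?J" using N by blast
    have "a * u \<in> princ h" using IJ[OF uv(2) a(2)] by (simp add: mult.commute)
    moreover have "a * v \<in> princ h" by (rule IJ[OF a(1) uv(3)])
    ultimately show "a * g \<in> princ h" unfolding uv(1) distrib_left by (rule hidD(2)[OF hp])
  qed
  define \<delta> where "\<delta> = - int d * (int d - 3 + m) - \<gamma>"
  define n1 where "n1 = max (max n0 (int N)) (max (int d - 2) (int d - 2 + m))"
  have HJ: "H ?J n = int d * n + \<delta>" if n: "n \<ge> n1" for n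
  proof -
    have n': "n \<ge> n0" "n \<ge> int N" "n \<ge> int d - 2" "n - m \<ge> int d - 2" using n by (auto simp: n1_def)
    let ?A = "I \<inter> gr n" and ?B = "?J \<inter> gr n" and ?C = "(*) h ` gr (n - m)"
    have "lin3.qdim zeroF {a + b |a b. a \<in> ?A \<and> b \<in> ?B} + lin3.qdim zeroF ?C = lin3.qdim zeroF ?A + lin3.qdim zeroF ?B"
    proof (rule lin3.qdim_sums[OF sub_zeroF subspace_piece[OF hid] fin_dim_piece subspace_piece[OF hJ] fin_dim_piece])
      fix a b assume ab: "a \<in> ?A" "b \<in> ?B" "a - b \<in> zeroF"
      then have "a \<doteq> b" by simp
      then have "a \<in> ?J" using closed_cong[OF J, of a b] ab by blast
      then obtain c where "a \<doteq> h * c" using int ab unfolding princ_def by blast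
      then have "hcomp n a \<doteq> hcomp n (h * c)" by (rule cong_hcomp)
      then have "a \<doteq> h * hcomp (n - m) c" using ab hcomp_of_gr[of a n n] by (simp add: hcomp_mult_left[OF h(2)])
      then show "\<exists>c\<in>?C. a - c \<in> zeroF" using hcomp_gr by blast
    next
      fix c assume "c \<in> ?C"
      then have "c \<in> ?A" "c \<in> ?B"
        using hidD(4)[OF hid h(1)] hidD(4)[OF hJ hinJ] gr_mult_eq[OF h(2), of _ "n - m" n] by auto
      then show "\<exists>a\<in>?A. c - a \<in> zeroF" "\<exists>b\<in>?B. c - b \<in> zeroF"
        by (intro bexI[of _ c]; simp)+
    qed
    moreover have "{a + b |a b. a \<in> ?A \<and> b \<in> ?B} = gr n"
    proof
      show "{a + b |a b. a \<in> ?A \<and> b \<in> ?B} \<subseteq> gr n" by (auto intro: gr_add)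
      show "gr n \<subseteq> {a + b |a b. a \<in> ?A \<and> b \<in> ?B}"
      proof
        fix f :: "'k poly3" assume f: "f \<in> gr n"
        then have "f \<in> ?S" using hid_gr_mono[OF S N _ n'(2)] by auto
        then obtain a b where ab: "f = a + b" "a \<in> I" "b \<in> ?J" by blast
        have "f = hcomp n a + hcomp n b" using hcomp_of_gr[OF f, of n] ab(1) by simp
        then show "f \<in> {a + b |a b. a \<in> ?A \<and> b \<in> ?B}"
          using hidD(5)[OF hid ab(2)] hidD(5)[OF hJ ab(3)] hcomp_gr by blast
      qed
    qed
    ultimately have "rd (gr n) + rd ?C = H I n + H ?J n" unfolding H_def rd_def by simp
    moreover have "rd ?C = H UNIV (n - m)"
      unfolding H_UNIV by (rule rd_mult[OF h(3) subspace_gr fin_dim_gr])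
    ultimately have "H UNIV n + H UNIV (n - m) = H I n + H ?J n" unfolding H_UNIV by simp
    then have "2 * H ?J n = 2 * (int d * n + \<delta>)"
      unfolding H_UNIV_linear[OF n'(3)] H_UNIV_linear[OF n'(4)] n0[OF n'(1)] \<delta>_def
      using two_euler by (simp add: algebra_simps)
    then show ?thesis by simp
  qed
  have "H ?J j = H I i + int d * j + \<delta>" if "i + j = int d - 3 + m" for i j
    by (rule riemann_roch[OF I J h(2,3,1) hinJ IJ n0 HJ _ that]) (simp_all add: \<delta>_def)
  then show ?thesis using h unfolding \<delta>_def by (intro exI[of _ h] exI[of _ m]) simp
qed

text \<open>In S, h times (F, G) : I equals G times (F, h) : I, with degrees shifted by m - s on the
  linked ideals; so the formula for one special h passes to every G in I that is nonzero in
  S.\<close>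

lemma hilbert_linked:
  assumes I: "closed I" and ev: "eventually_linear I \<gamma>" and lp: "locally_principal I"
    and fin: "finite (support I)" and G: "G \<in> I" "G \<in> gr s" "\<not> F dvd G" and ij: "i + j = int d - 3 + s"
  shows "H (colon (princ G) I) j = H I i + int d * j - int d * (int d - 3 + s) - \<gamma>"
proof -
  note hid = closedD(1)[OF I]
  obtain h m where h: "h \<in> I" "h \<in> gr m" "\<not> F dvd h"
    and H: "\<And>i j. i + j = int d - 3 + m \<Longrightarrow>
      H (colon (princ h) I) j = H I i + int d * j - int d * (int d - 3 + m) - \<gamma>"
    using exists_hilbert_linked[OF I ev lp fin] by blast
  have trans: "\<exists>f'\<in>colon (princ h) I \<inter> gr (n - s + m). h * f \<doteq> G * f'"
    if h: "h \<in> I" "h \<in> gr m" "\<not> F dvd h" and G: "G \<in> I" "G \<in> gr s" "\<not> F dvd G"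
      and f: "f \<in> colon (princ G) I" "f \<in> gr n" for f n h G m s
  proof -
    obtain c where "f * h \<doteq> G * c" using f h unfolding colon_def princ_def by blast
    then have "hcomp (n + m) (f * h) \<doteq> hcomp (n + m) (G * c)" by (rule cong_hcomp)
    then have c: "f * h \<doteq> G * hcomp (n - s + m) c"
      using hcomp_of_gr[OF gr_mult[OF f(2) h(2)]] by (simp add: hcomp_mult_left[OF G(2)] algebra_simps)
    let ?c = "hcomp (n - s + m) c"
    have "?c \<in> colon (princ h) I"
      unfolding colon_def
    proof (intro CollectI ballI)
      fix a assume "a \<in> I"
      then obtain e where e: "f * a \<doteq> G * e" using f unfolding colon_def princ_def by blast
      have 1: "(G * ?c) * a \<doteq> (f * h) * a" by (rule cong_mult_right[OF cong_sym[OF c]])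
      have 2: "h * (f * a) \<doteq> h * (G * e)" by (rule cong_mult_left[OF e])
      have "G * (?c * a) \<doteq> G * (h * e)" using cong_trans[of "G * (?c * a)" "h * (f * a)"] 1 2
        by (simp add: algebra_simps)
      then have "?c * a \<doteq> h * e" using cong_cancel G(3) by blast
      then show "?c * a \<in> princ h" unfolding princ_def by blast
    qed
    then show ?thesis using c hcomp_gr by (auto simp: mult.commute)
  qed
  let ?JG = "colon (princ G) I" and ?Jh = "colon (princ h) I"
  have hJ: "hid ?JG" "hid ?Jh"
    by (rule closedD(1)[OF closed_colon[OF closed_princ hid]]; use G h in blast)+
  let ?n = "j - s + m"
  have "H ?JG j = rd ((*) h ` (?JG \<inter> gr j))"
    unfolding H_def by (rule rd_mult[symmetric, OF h(3) subspace_piece[OF hJ(1)] fin_dim_piece])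
  also have "\<dots> = rd ((*) G ` (?Jh \<inter> gr ?n))"
  proof (rule rd_cong)
    fix v assume "v \<in> (*) h ` (?JG \<inter> gr j)"
    then obtain f where f: "f \<in> ?JG" "f \<in> gr j" "v = h * f" by blast
    obtain f' where "f' \<in> ?Jh \<inter> gr ?n" "h * f \<doteq> G * f'" using trans[OF h G f(1,2)] by blast
    then show "\<exists>w\<in>(*) G ` (?Jh \<inter> gr ?n). v \<doteq> w" unfolding f(3) by blast
  next
    fix v assume "v \<in> (*) G ` (?Jh \<inter> gr ?n)"
    then obtain f where f: "f \<in> ?Jh" "f \<in> gr ?n" "v = G * f" by blast
    obtain f' where "f' \<in> ?JG \<inter> gr (?n - m + s)" "G * f \<doteq> h * f'" using trans[OF G h f(1,2)] by blast
    then show "\<exists>w\<in>(*) h ` (?JG \<inter> gr j). v \<doteq> w" unfolding f(3) by (auto simp: algebra_simps)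
  qed
  also have "\<dots> = H ?Jh ?n"
    unfolding H_def by (rule rd_mult[OF G(3) subspace_piece[OF hJ(2)] fin_dim_piece])
  also have "\<dots> = H I i + int d * ?n - int d * (int d - 3 + m) - \<gamma>" by (rule H) (use ij in simp)
  finally show ?thesis by (simp add: algebra_simps)
qed

end

section \<open>The numerical argument\<close>

locale hilbert_numerics =
  fixes h :: "int \<Rightarrow> int" and d s r \<alpha> :: int
  assumes neg: "\<And>n. n < 0 \<Longrightarrow> h n = 0" and nonneg: "\<And>n. 0 \<le> h n"
    and convex: "\<And>n. h n - h (n - 1) \<le> h (n + 1) - h n"
    and gap: "\<And>n. 0 < h (n - 1) \<Longrightarrow> h n - h (n - 1) = h (n - 1) - h (n - 2) \<Longrightarrow> d \<le> h (n - 1) - h (n - 2)"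
    and large: "\<exists>n0. \<forall>n\<ge>n0. 2 * h n = 2 * d * n + 3 * d - d * d - 2 * \<alpha>"
    and s: "0 \<le> s" "s \<le> d - 3" and \<alpha>: "\<alpha> = s * d - r"
begin

text \<open>From degree d - 2 on the differences are at least d - s, d - s + 1, and so on; they
  reach d after s steps and stay there by convexity. Their sum is limited by the eventual values of
  h, which bounds h (d - 3). In case of equality, the partial sum up to degree d - 4 + s is large
  enough to leave a section of degree 1 - s.\<close>

lemma case_large:
  assumes j: "d - s \<le> h (d - 2) - h (d - 3)"
  shows "2 * h (d - 3) - d * d + 3 * d + 2 * \<alpha> \<le> s * (s + 1)"
    and "1 \<le> s \<Longrightarrow> 2 * h (d - 3) - d * d + 3 * d + 2 * \<alpha> = s * (s + 1) \<Longrightarrow>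
      2 \<le> 2 * h (d - 4 + s) + 2 * d * (1 - s) - d * d + 3 * d + 2 * \<alpha>"
proof -
  have step: "0 < h (d - 2 + int t) \<and> d - s + int t \<le> h (d - 2 + int t) - h (d - 3 + int t)" if "int t \<le> s" for t
    using that
  proof (induction t)
    case 0
    then show ?case using j nonneg[of "d - 3"] s by simp
  next
    case (Suc t)
    let ?n = "d - 1 + int t"
    have IH: "0 < h (?n - 1)" "d - s + int t \<le> h (?n - 1) - h (?n - 2)" using Suc by (simp_all add: algebra_simps)
    have e: "?n - 1 + 1 = ?n" "?n - 1 - 1 = ?n - 2" by simp_all
    have cv: "h (?n - 1) - h (?n - 2) \<le> h ?n - h (?n - 1)" using convex[of "?n - 1"] unfolding e .
    have "d - s + int t + 1 \<le> h ?n - h (?n - 1)"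
    proof (cases "h ?n - h (?n - 1) = h (?n - 1) - h (?n - 2)")
      case True
      then have "d \<le> h (?n - 1) - h (?n - 2)" using gap IH by blast
      then show ?thesis using cv Suc.prems by simp
    qed (use IH cv in linarith)
    moreover have e: "d - 2 + int (Suc t) = ?n" "d - 3 + int (Suc t) = ?n - 1" by simp_all
    moreover have "d - s + int (Suc t) = d - s + int t + 1" by simp
    ultimately show ?case unfolding e using IH(1) Suc.prems s by (intro conjI) linarith+
  qed
  have sum: "2 * h (d - 3 + int t) \<ge> 2 * h (d - 3) + 2 * int t * (d - s) + int t * (int t - 1)" if "int t \<le> s" for t
    using that
  proof (induction t)
    case (Suc t)
    have "d - s + int t \<le> h (d - 2 + int t) - h (d - 3 + int t)" using step[of t] Suc.prems by simp
    moreover have "d - 3 + int (Suc t) = d - 2 + int t" by simp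
    ultimately show ?case using Suc by (simp add: algebra_simps)
  qed simp
  have top: "d \<le> h (d - 2 + s + int u) - h (d - 3 + s + int u)" for u
  proof (induction u)
    case 0
    then show ?case using step[of "nat s"] s by simp
  next
    case (Suc u)
    have e: "d - 2 + s + int (Suc u) = (d - 2 + s + int u) + 1" "d - 3 + s + int (Suc u) = d - 2 + s + int u"
      "d - 3 + s + int u = (d - 2 + s + int u) - 1" by simp_all
    show ?case unfolding e(1,2) using Suc[unfolded e(3)] convex[of "d - 2 + s + int u"] by linarith
  qed
  have sum2: "h (d - 3 + s + int u) \<ge> h (d - 3 + s) + d * int u" for u
  proof (induction u)
    case (Suc u)
    have "d - 3 + s + int (Suc u) = d - 2 + s + int u" by simp
    then show ?case using Suc top[of u] by (simp add: algebra_simps)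
  qed simp
  obtain n0 where n0: "\<And>n. n \<ge> n0 \<Longrightarrow> 2 * h n = 2 * d * n + 3 * d - d * d - 2 * \<alpha>" using large by blast
  define u where "u = nat \<bar>n0 - (d - 3 + s)\<bar>"
  have "d - 3 + s + int u \<ge> n0" by (simp add: u_def)
  then have "2 * h (d - 3 + s + int u) = 2 * d * (d - 3 + s + int u) + 3 * d - d * d - 2 * \<alpha>" by (rule n0)
  moreover have "2 * h (d - 3 + s) \<ge> 2 * h (d - 3) + 2 * s * (d - s) + s * (s - 1)"
    using sum[of "nat s"] s by simp
  ultimately show "2 * h (d - 3) - d * d + 3 * d + 2 * \<alpha> \<le> s * (s + 1)"
    using sum2[of u] by (simp add: algebra_simps)
  assume s1: "1 \<le> s" and eq: "2 * h (d - 3) - d * d + 3 * d + 2 * \<alpha> = s * (s + 1)"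
  have "2 * h (d - 3 + int (nat (s - 1))) \<ge> 2 * h (d - 3) + 2 * int (nat (s - 1)) * (d - s)
      + int (nat (s - 1)) * (int (nat (s - 1)) - 1)"
    by (rule sum) (use s1 in simp)
  moreover have "int (nat (s - 1)) = s - 1" using s1 by simp
  ultimately have "2 * h (d - 3 + (s - 1)) \<ge> 2 * h (d - 3) + 2 * (s - 1) * (d - s) + (s - 1) * (s - 1 - 1)" by simp
  moreover have "d - 3 + (s - 1) = d - 4 + s" by simp
  ultimately show "2 \<le> 2 * h (d - 4 + s) + 2 * d * (1 - s) - d * d + 3 * d + 2 * \<alpha>"
    using eq by (simp add: algebra_simps)
qed

text \<open>Read downwards from degree d - 2, the differences fall by at least one per step while
  they are positive, so the one at degree n is at most max 0 (n - s + 1). Hence h (s - 1) = 0, h s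
  <= 1, and h (d - 3) is at most h s plus 2 + ... + (d - 2 - s); equality in the bound needs h s =
  1.\<close>

lemma case_small:
  assumes j: "h (d - 2) - h (d - 3) \<le> d - s - 1"
  shows "2 * h (d - 3) - d * d + 3 * d + 2 * \<alpha> \<le> (s + 1) * (s + 2) - 2 * r"
    and "2 * h (d - 3) - d * d + 3 * d + 2 * \<alpha> = (s + 1) * (s + 2) - 2 * r \<Longrightarrow> 0 < h s"
proof -
  have down: "h (d - 2 - int i) - h (d - 3 - int i) \<le> max 0 (d - s - 1 - int i)" for i
  proof (induction i)
    case 0
    then show ?case using j by simp
  next
    case (Suc i)
    let ?n = "d - 2 - int i"
    have IH: "h ?n - h (?n - 1) \<le> max 0 (d - s - 1 - int i)" using Suc by (simp add: algebra_simps)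
    have e: "?n - 1 + 1 = ?n" "?n - 1 - 1 = ?n - 2" by simp_all
    have cv: "h (?n - 1) - h (?n - 2) \<le> h ?n - h (?n - 1)" using convex[of "?n - 1"] unfolding e .
    have "h (?n - 1) - h (?n - 2) \<le> max 0 (d - s - 1 - int (Suc i))"
    proof (cases "0 < h (?n - 1)")
      case True
      show ?thesis
      proof (cases "h ?n - h (?n - 1) = h (?n - 1) - h (?n - 2)")
        case True
        then have "d \<le> h (?n - 1) - h (?n - 2)" using gap[of ?n] \<open>0 < h (?n - 1)\<close> by blast
        then show ?thesis using IH True s by simp
      qed (use IH cv in auto)
    next
      \<comment> \<open>Once h has dropped to 0 at n - 1, the next difference is - h (n - 2), which
        is not positive.\<close>
      case False
      then show ?thesis using nonneg[of "?n - 2"] by simp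
    qed
    moreover have "d - 2 - int (Suc i) = ?n - 1" "d - 3 - int (Suc i) = ?n - 2" by simp_all
    ultimately show ?case by simp
  qed
  have step: "h (s + int i) - h (s + int i - 1) \<le> int i + 1" if "int i \<le> d - 2 - s" for i
  proof -
    have "d - 2 - int (nat (d - 2 - s - int i)) = s + int i" "d - 3 - int (nat (d - 2 - s - int i)) = s + int i - 1"
      using that by simp_all
    then show ?thesis using down[of "nat (d - 2 - s - int i)"] that by simp
  qed
  have "h (s - 1) \<le> 0"
  proof -
    have le0: "h (s - 1 - int i) - h (s - 2 - int i) \<le> 0" for i
    proof (induction i)
      case 0
      have "d - 2 - int (nat (d - 1 - s)) = s - 1" "d - 3 - int (nat (d - 1 - s)) = s - 2" using s by simp_all
      then show ?case using down[of "nat (d - 1 - s)"] s by simp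
    next
      case (Suc i)
      have e: "s - 1 - int i = (s - 2 - int i) + 1" "s - 1 - int (Suc i) = s - 2 - int i"
        "s - 2 - int (Suc i) = s - 2 - int i - 1" by simp_all
      show ?case using Suc convex[of "s - 2 - int i"] unfolding e by simp
    qed
    have "h (s - 1) \<le> h (s - 1 - int k)" for k
    proof (induction k)
      case (Suc k)
      have e: "s - 1 - int (Suc k) = s - 2 - int k" by simp
      show ?case unfolding e using Suc le0[of k] by linarith
    qed simp
    from this[of "nat s"] show ?thesis using neg[of "- 1"] s by simp
  qed
  then have hs: "h s \<le> 1" using step[of 0] s by simp
  have sum: "2 * h (s + int i) \<le> 2 * h s + (int i + 1) * (int i + 2) - 2" if "int i \<le> d - 2 - s" for i
    using that
  proof (induction i)
    case (Suc i)
    have "h (s + int (Suc i)) - h (s + int (Suc i) - 1) \<le> int (Suc i) + 1" by (rule step[OF Suc.prems])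
    moreover have "s + int (Suc i) - 1 = s + int i" by simp
    ultimately show ?case using Suc by (simp add: algebra_simps)
  qed simp
  have "int (nat (d - 3 - s)) = d - 3 - s" using s by simp
  then have "2 * h (d - 3) \<le> 2 * h s + (d - 3 - s + 1) * (d - 3 - s + 2) - 2"
    using sum[of "nat (d - 3 - s)"] by simp
  then have main: "2 * h (d - 3) - d * d + 3 * d + 2 * \<alpha> \<le> 2 * h s + (s + 1) * (s + 2) - 2 * r - 2"
    unfolding \<alpha> by (simp add: algebra_simps)
  then show "2 * h (d - 3) - d * d + 3 * d + 2 * \<alpha> \<le> (s + 1) * (s + 2) - 2 * r" using hs by simp
  show "2 * h (d - 3) - d * d + 3 * d + 2 * \<alpha> = (s + 1) * (s + 2) - 2 * r \<Longrightarrow> 0 < h s"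
    using main by simp
qed

end

section \<open>Dimensions in the sense of \<open>HOL-Algebra\<close>\<close>

context lin_space
begin

text \<open>The span of B stands for the quotient: it meets P only in 0 and fills V modulo P. A
  linear map on V that vanishes exactly on P is then injective on this span, with the same image as
  on V.\<close>

lemma exists_lifted_basis:
  assumes P: "subspace P" and V: "subspace V" "fin_dim V"
  shows "\<exists>B. finite B \<and> B \<subseteq> V \<and> independent B \<and> card B = qdim P V \<and> span B \<inter> P = {0} \<and>
    (\<forall>v\<in>V. \<exists>w\<in>span B. v - w \<in> P)"
proof -
  interpret l: Vector_Spaces.linear scale scale "proj P" by (rule linear_proj[OF P])
  interpret vp: vector_space_pair scale scale by unfold_locales
  obtain C where C: "C \<subseteq> proj P ` V" "independent C" "proj P ` V \<subseteq> span C" "card C = dim (proj P ` V)"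
    using basis_exists by blast
  have finC: "finite C" using fin_dim_basis[OF fin_dim_image[OF linear_proj[OF P] V(2)] C(2,1)] .
  obtain B where B: "B \<subseteq> V" "inj_on (proj P) B" "proj P ` B = C"
    using C(1) subset_image_inj[of C "proj P" V] by blast
  have finB: "finite B" using B(2,3) finC finite_imageD by blast
  have card: "card B = qdim P V" unfolding qdim_def using B(2,3) C(4) card_image by metis
  have zero: "x = 0" if "x \<in> span B" "x \<in> P" for x
  proof (rule vp.linear_indep_image_lemma[OF linear_proj[OF P] finB _ B(2) that(1)])
    show "independent (proj P ` B)" using B(3) C(2) by simp
    show "proj P x = 0" using proj_eq_iff[OF P, of x 0] that(2) l.zero by simp
  qed
  have ind: "independent B"
  proof
    assume "dependent B"
    then obtain a where a: "a \<in> B" "a \<in> span (B - {a})" unfolding dependent_def by blast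
    have "proj P a \<in> span (proj P ` (B - {a}))" using a(2) l.span_image by blast
    also have "proj P ` (B - {a}) = C - {proj P a}"
      using inj_on_image_set_diff[OF B(2), of B "{a}"] a(1) B(3) by auto
    finally show False using C(2) a(1) B(3) unfolding dependent_def by blast
  qed
  have "\<exists>w\<in>span B. v - w \<in> P" if "v \<in> V" for v
  proof -
    have "proj P v \<in> proj P ` span B" using that C(3) B(3) l.span_image[of B] by auto
    then show ?thesis using proj_eq_iff[OF P] by blast
  qed
  moreover have "span B \<inter> P = {0}" using zero span_zero subspace_0[OF P] by blast
  ultimately show ?thesis using finB B(1) ind card by blast
qed

end

text \<open>\<open>dimension\<close> is built from successive line extensions, so the basis is added
  one vector at a time; \<kappa> carries the scalars into the subfield. Additivity is asked on V
  only, because for the map g to g / h it is available for forms of the degree of h.\<close>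

lemma dimension_image:
  fixes A (structure) and \<phi> :: "'k::field poly3 \<Rightarrow> 'a" and \<kappa> :: "'k \<Rightarrow> 'a"
  assumes A: "ring A" and B: "finite B" "lin3.independent B" and V: "lin3.span B \<subseteq> V"
    and car: "\<And>v. v \<in> V \<Longrightarrow> \<phi> v \<in> carrier A" and inj: "inj_on \<phi> (lin3.span B)"
    and phi0: "\<phi> 0 = \<zero>"
    and add: "\<And>u v. u \<in> V \<Longrightarrow> v \<in> V \<Longrightarrow> \<phi> (u + v) = \<phi> u \<oplus> \<phi> v"
    and sc: "\<And>c v. v \<in> V \<Longrightarrow> \<phi> (sc c v) = \<kappa> c \<otimes> \<phi> v"
  shows "ring.dimension A (card B) (range \<kappa>) (\<phi> ` lin3.span B)"
  using B V inj
proof (induction B rule: finite_induct)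
  interpret ring A by (rule A)
  case empty
  then show ?case using zero_dim phi0 by simp
next
  interpret ring A by (rule A)
  case (insert b B)
  have sub: "lin3.span B \<subseteq> lin3.span (insert b B)" by (rule lin3.span_mono) auto
  have ind: "lin3.independent B" "b \<notin> lin3.span B"
    using insert.prems(1) insert.hyps(2) lin3.independent_insert[of b B] by auto
  have IH: "dimension (card B) (range \<kappa>) (\<phi> ` lin3.span B)"
    by (rule insert.IH[OF ind(1)]) (use sub insert.prems inj_on_subset in blast)+
  have b: "b \<in> lin3.span (insert b B)" by (rule lin3.span_base) simp
  have bn: "\<phi> b \<notin> \<phi> ` lin3.span B"
    using insert.prems(3) b sub ind(2) unfolding inj_on_def by blast
  have eq: "\<phi> (sc k b + v) = \<kappa> k \<otimes> \<phi> b \<oplus> \<phi> v" if "v \<in> lin3.span B" for k v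
  proof -
    have "sc k b \<in> V" "v \<in> V" "b \<in> V" using insert.prems(2) b sub that lin3.span_scale by blast+
    then show ?thesis by (simp add: add sc)
  qed
  have "\<phi> ` lin3.span (insert b B) = line_extension (range \<kappa>) (\<phi> b) (\<phi> ` lin3.span B)"
  proof (intro equalityI subsetI)
    fix z assume "z \<in> \<phi> ` lin3.span (insert b B)"
    then obtain v where v: "v \<in> lin3.span (insert b B)" "z = \<phi> v" by blast
    obtain k where k: "v - sc k b \<in> lin3.span B"
      using v(1) lin3.span_breakdown_eq by blast
    then have "z = \<kappa> k \<otimes> \<phi> b \<oplus> \<phi> (v - sc k b)" using eq[OF k, of k] v(2) by simp
    then show "z \<in> line_extension (range \<kappa>) (\<phi> b) (\<phi> ` lin3.span B)"
      using k unfolding line_extension_mem_iff by blast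
  next
    fix z assume "z \<in> line_extension (range \<kappa>) (\<phi> b) (\<phi> ` lin3.span B)"
    then obtain k v where v: "v \<in> lin3.span B" "z = \<kappa> k \<otimes> \<phi> b \<oplus> \<phi> v"
      unfolding line_extension_mem_iff by blast
    have "sc k b + v \<in> lin3.span (insert b B)"
      using b sub v(1) by (blast intro: lin3.span_add lin3.span_scale)
    then show "z \<in> \<phi> ` lin3.span (insert b B)" using eq[OF v(1), of k] v(2) by (metis imageI)
  qed
  then show ?case using Suc_dim[OF _ bn IH] car insert.prems(2) b insert.hyps by auto
qed

subsection \<open>The polynomial ring\<close>

lemma type_ring_simps [simp]:
  "carrier ring_of_type_algebra = UNIV" "monoid.mult ring_of_type_algebra = (*)"
  "monoid.one ring_of_type_algebra = 1" "ring.zero ring_of_type_algebra = 0" "ring.add ring_of_type_algebra = (+)"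
  by (simp_all add: ring_of_type_algebra_def)

lemma type_ring_cring: "cring (ring_of_type_algebra :: 'a::comm_ring_1 ring)"
  by (rule cring_from_type_algebra)

lemma type_ring_minus: "a_inv (ring_of_type_algebra :: 'a::comm_ring_1 ring) a = - a"
proof -
  interpret cring "ring_of_type_algebra :: 'a ring" by (rule type_ring_cring)
  show ?thesis by (rule minus_equality) simp_all
qed

lemma ideal_type_ring_iff:
  "ideal I (ring_of_type_algebra :: 'a::comm_ring_1 ring) \<longleftrightarrow>
     0 \<in> I \<and> (\<forall>a\<in>I. \<forall>b\<in>I. a + b \<in> I) \<and> (\<forall>r. \<forall>a\<in>I. r * a \<in> I)"
proof
  assume "ideal I (ring_of_type_algebra :: 'a ring)"
  then interpret ideal I "ring_of_type_algebra :: 'a ring" .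
  show "0 \<in> I \<and> (\<forall>a\<in>I. \<forall>b\<in>I. a + b \<in> I) \<and> (\<forall>r. \<forall>a\<in>I. r * a \<in> I)"
    using additive_subgroup.zero_closed[OF additive_subgroup_axioms]
      additive_subgroup.a_closed[OF additive_subgroup_axioms] I_l_closed by simp
next
  assume I: "0 \<in> I \<and> (\<forall>a\<in>I. \<forall>b\<in>I. a + b \<in> I) \<and> (\<forall>r. \<forall>a\<in>I. r * a \<in> I)"
  interpret cring "ring_of_type_algebra :: 'a ring" by (rule type_ring_cring)
  show "ideal I (ring_of_type_algebra :: 'a ring)"
  proof (rule idealI)
    show "ring (ring_of_type_algebra :: 'a ring)" by (rule ring_axioms)
    have neg: "- a \<in> I" if "a \<in> I" for a
    proof -
      have "(- 1) * a \<in> I" using I that by blast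
      then show ?thesis by simp
    qed
    show "subgroup I (add_monoid (ring_of_type_algebra :: 'a ring))"
    proof (rule add.subgroupI)
      show "I \<noteq> {}" using I by blast
      show "a_inv ring_of_type_algebra a \<in> I" if "a \<in> I" for a
        using neg[OF that] by (simp add: type_ring_minus)
    qed (use I in auto)
    fix a x assume a: "a \<in> I"
    show "x \<otimes>\<^bsub>ring_of_type_algebra\<^esub> a \<in> I" using I a by simp
    then show "a \<otimes>\<^bsub>ring_of_type_algebra\<^esub> x \<in> I" by (simp add: mult.commute)
  qed
qed

text \<open>If I is generated by forms, the elements all of whose components lie in I form an ideal
  containing the generators, hence all of I. Conversely every element is the sum of its
  components.\<close>

lemma homogeneous_ideal_iff: "homogeneous_ideal I \<longleftrightarrow> hid (I :: 'k::field poly3 set)"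
proof
  interpret cring "poly3_ring :: 'k poly3 ring" by (rule type_ring_cring)
  let ?S = "{f \<in> I. \<exists>n. form n f}"
  {
    assume "homogeneous_ideal I"
    then have id: "ideal I poly3_ring" and eq: "I = Idl\<^bsub>poly3_ring\<^esub> ?S"
      unfolding homogeneous_ideal_def by blast+
    have I: "0 \<in> I" "\<And>a b. a \<in> I \<Longrightarrow> b \<in> I \<Longrightarrow> a + b \<in> I" "\<And>r a. a \<in> I \<Longrightarrow> r * a \<in> I"
      using id unfolding ideal_type_ring_iff by blast+
    let ?T = "{f. \<forall>n. hcomp n f \<in> I}"
    have sumI: "sum f A \<in> I" if "finite A" "\<And>a. a \<in> A \<Longrightarrow> f a \<in> I" for f :: "nat \<Rightarrow> 'k poly3" and A
      using that by (induction A rule: finite_induct) (auto intro: I)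
    have "ideal ?T poly3_ring"
      unfolding ideal_type_ring_iff
    proof (intro conjI ballI allI)
      show "0 \<in> ?T" using I by simp
      fix a assume a: "a \<in> ?T"
      show "a + b \<in> ?T" if "b \<in> ?T" for b using a that I by simp
      fix r :: "'k poly3"
      obtain D where D: "r = (\<Sum>k<D. hcomp (int k) r)" using exists_sum_hcomp by blast
      have "hcomp n (r * a) \<in> I" for n
      proof -
        have "hcomp n (r * a) = hcomp n (\<Sum>k<D. hcomp (int k) r * a)"
          by (subst D) (simp add: sum_distrib_right)
        also have "\<dots> = (\<Sum>k<D. hcomp (int k) r * hcomp (n - int k) a)"
          unfolding hcomp_sum by (intro sum.cong refl hcomp_mult_left[OF hcomp_gr])
        also have "\<dots> \<in> I" by (rule sumI) (use a I in auto)
        finally show ?thesis .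
      qed
      then show "r * a \<in> ?T" by simp
    qed
    moreover have "?S \<subseteq> ?T"
    proof
      fix f assume "f \<in> ?S"
      then obtain n where f: "f \<in> I" "f \<in> gr (int n)" by (auto simp: form_iff_gr)
      then show "f \<in> ?T" using I(1) by (simp add: hcomp_of_gr[OF f(2)])
    qed
    ultimately have "I \<subseteq> ?T" using genideal_minimal eq by blast
    then show "hid I" unfolding hid_def using I by blast
  }
  {
    assume hid: "hid I"
    then have id: "ideal I poly3_ring" unfolding ideal_type_ring_iff hid_def by blast
    let ?J = "Idl\<^bsub>poly3_ring\<^esub> ?S"
    have J: "ideal ?J poly3_ring" by (rule genideal_ideal) simp
    then have Jadd: "0 \<in> ?J" "\<And>a b. a \<in> ?J \<Longrightarrow> b \<in> ?J \<Longrightarrow> a + b \<in> ?J"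
      unfolding ideal_type_ring_iff by blast+
    have sumJ: "sum f A \<in> ?J" if "finite A" "\<And>a. a \<in> A \<Longrightarrow> f a \<in> ?J" for f :: "nat \<Rightarrow> 'k poly3" and A
      using that by (induction A rule: finite_induct) (auto intro: Jadd)
    have "I = ?J"
    proof
      show "?J \<subseteq> I" by (rule genideal_minimal[OF id]) blast
      show "I \<subseteq> ?J"
      proof
        fix f assume f: "f \<in> I"
        obtain D where D: "f = (\<Sum>k<D. hcomp (int k) f)" using exists_sum_hcomp by blast
        have "(\<Sum>k<D. hcomp (int k) f) \<in> ?J"
        proof (rule sumJ)
          fix k
          have "form k (hcomp (int k) f)" unfolding form_iff_gr by (rule hcomp_gr)
          then have "hcomp (int k) f \<in> ?S" using hidD(5)[OF hid f] by blast
          moreover have "?S \<subseteq> ?J" by (rule genideal_self) simp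
          ultimately show "hcomp (int k) f \<in> ?J" by blast
        qed simp
        then show "f \<in> ?J" using D by metis
      qed
    qed
    then show "homogeneous_ideal I" unfolding homogeneous_ideal_def using id by blast
  }
qed

lemma ring_hom_const3: "const3 \<in> ring_hom (ring_of_type_algebra :: 'k::field ring) poly3_ring"
  using is_homD[OF is_hom_const3] by (intro ring_hom_memI) simp_all

lemma subfield_const3: "subfield (range (const3 :: 'k::field \<Rightarrow> _)) poly3_ring"
proof -
  interpret k: Ring.field "ring_of_type_algebra :: 'k ring" by (rule field_from_type_algebra)
  interpret R: cring "poly3_ring :: 'k poly3 ring" by (rule type_ring_cring)
  interpret ring_hom_ring "ring_of_type_algebra :: 'k ring" poly3_ring const3
    by (rule ring_hom_ringI2[OF k.ring_axioms R.ring_axioms ring_hom_const3])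
  have "subfield (const3 ` carrier (ring_of_type_algebra :: 'k ring)) poly3_ring"
    by (rule img_is_subfield(2)[OF k.carrier_is_subfield]) simp
  then show ?thesis by simp
qed

lemma ring_dim_eq:
  assumes V: "lin3.subspace V" "lin3.fin_dim (V :: 'k::field poly3 set)"
  shows "ring.dim poly3_ring (range const3) V = lin3.dim V"
proof -
  interpret R: cring "poly3_ring :: 'k poly3 ring" by (rule type_ring_cring)
  obtain B where B: "B \<subseteq> V" "lin3.independent B" "V \<subseteq> lin3.span B" "card B = lin3.dim V"
    using lin3.basis_exists by blast
  have fin: "finite B" by (rule lin3.fin_dim_basis[OF V(2) B(2,1)])
  have sp: "lin3.span B = V" using B V(1) lin3.span_minimal by blast
  have "R.dimension (card B) (range const3) ((\<lambda>v. v) ` lin3.span B)"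
    by (rule dimension_image[OF R.ring_axioms fin B(2) subset_refl]) (auto simp: sc_def)
  then have "R.dimension (lin3.dim V) (range const3) V" using B(4) sp by simp
  then show ?thesis using R.dimI[OF subfield_const3] by (simp add: over_def)
qed

lemma hilbert_function_eq:
  assumes "hid (I :: 'k::field poly3 set)"
  shows "hilbert_function I n = int (lin3.dim (gr (int n) :: 'k::field poly3 set)) - int (lin3.dim (I \<inter> gr (int n)))"
proof -
  have 1: "{f :: 'k poly3. form n f} = gr (int n)" by (auto simp: form_iff_gr)
  have 2: "{f \<in> I. form n f} = I \<inter> gr (int n)" by (auto simp: form_iff_gr)
  have fin: "lin3.fin_dim (I \<inter> gr (int n))" by (rule lin3.fin_dim_subset[OF fin_dim_gr]) auto
  have sub: "lin3.subspace (I \<inter> gr (int n))" by (intro lin3.subspace_inter hid_subspace assms subspace_gr)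
  show ?thesis unfolding hilbert_function_def 1 2
    by (simp add: ring_dim_eq[OF subspace_gr fin_dim_gr] ring_dim_eq[OF sub fin])
qed

context plane_curve
begin

section \<open>The function field\<close>

definition val :: "int \<Rightarrow> 'k poly3 \<Rightarrow> 'k poly3 \<Rightarrow> bool" where
  "val n g h \<longleftrightarrow> g \<in> gr n \<and> h \<in> gr n \<and> \<not> F dvd h"

text \<open>A negative degree would force h = 0, which F divides; so integer and natural degrees
  give the same fractions.\<close>

lemma val_iff_form: "(\<exists>n. form n g \<and> form n h \<and> \<not> F dvd h) \<longleftrightarrow> (\<exists>n. val n g h)"
proof
  show "\<exists>n. form n g \<and> form n h \<and> \<not> F dvd h \<Longrightarrow> \<exists>n. val n g h"
    unfolding val_def form_iff_gr by blast
  assume "\<exists>n. val n g h"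
  then obtain n where n: "g \<in> gr n" "h \<in> gr n" "\<not> F dvd h" unfolding val_def by blast
  have "\<not> n < 0"
  proof
    assume "n < 0"
    then have "h = 0" using n(2) gr_neg[of n, where 'a = 'k] by simp
    then show False using n(3) by simp
  qed
  then have "n = int (nat n)" by simp
  then show "\<exists>n. form n g \<and> form n h \<and> \<not> F dvd h" unfolding form_iff_gr using n by metis
qed

lemma val_nz: "val n g h \<Longrightarrow> h \<noteq> 0"
  unfolding val_def by auto

lemma val_add:
  assumes "val n g h" "val m g' h'"
  shows "val (n + m) (g * h' + g' * h) (h * h')"
proof -
  have v: "g \<in> gr n" "h \<in> gr n" "\<not> F dvd h" "g' \<in> gr m" "h' \<in> gr m" "\<not> F dvd h'"
    using assms unfolding val_def by blast+
  have "g' * h \<in> gr (n + m)" by (rule gr_mult_eq[OF v(4,2)]) simp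
  then show ?thesis unfolding val_def dvd_mult_iff
    using gr_add[OF gr_mult[OF v(1,5)]] gr_mult[OF v(2,5)] v(3,6) by blast
qed

lemma val_mult: "val n g h \<Longrightarrow> val m g' h' \<Longrightarrow> val (n + m) (g * g') (h * h')"
  unfolding val_def using dvd_mult_iff by (auto intro!: gr_mult)

lemma val_const: "val 0 (const3 c) 1"
  unfolding val_def using const3_gr one_gr F_prime by (auto simp: prime_elem_def)

lemma val_zero: "val 0 0 1" and val_one: "val 0 1 1"
  using val_const[of 0] val_const[of 1] is_homD(1,2)[OF is_hom_const3] by metis+

lemma carrier_generic: "carrier (generic_ring F) = {Fract g h |g h n. val n g h}"
  unfolding generic_ring_def using val_iff_form by auto

lemma generic_simps [simp]:
  "monoid.mult (generic_ring F) = (*)" "monoid.one (generic_ring F) = 1"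
  "ring.zero (generic_ring F) = 0" "ring.add (generic_ring F) = (+)"
  by (simp_all add: generic_ring_def)

lemma Fract_mem: "val n g h \<Longrightarrow> Fract g h \<in> carrier (generic_ring F)"
  unfolding carrier_generic by blast

lemma generic_cring: "cring (generic_ring F)"
proof (rule cringI)
  note c = carrier_generic
  show "abelian_group (generic_ring F)"
  proof (rule abelian_groupI)
    fix a b assume "a \<in> carrier (generic_ring F)" "b \<in> carrier (generic_ring F)"
    then obtain g h n g' h' m where v: "val n g h" "a = Fract g h" "val m g' h'" "b = Fract g' h'"
      unfolding c by blast
    then have "a + b = Fract (g * h' + g' * h) (h * h')" using val_nz by simp
    then show "a \<oplus>\<^bsub>generic_ring F\<^esub> b \<in> carrier (generic_ring F)"
      using Fract_mem[OF val_add[OF v(1,3)]] by simp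
  next
    show "\<zero>\<^bsub>generic_ring F\<^esub> \<in> carrier (generic_ring F)"
      using Fract_mem[OF val_zero] by (simp add: Zero_fract_def)
  next
    fix a assume "a \<in> carrier (generic_ring F)"
    then obtain g h n where v: "val n g h" "a = Fract g h" unfolding c by blast
    have "val n (- g) h" using v(1) gr_uminus unfolding val_def by blast
    then show "\<exists>b\<in>carrier (generic_ring F). b \<oplus>\<^bsub>generic_ring F\<^esub> a = \<zero>\<^bsub>generic_ring F\<^esub>"
      using v(2) by (intro bexI[of _ "Fract (- g) h"] Fract_mem) (simp_all flip: minus_fract)
  qed (simp_all add: algebra_simps)
  show "comm_monoid (generic_ring F)"
  proof (rule comm_monoidI)
    fix a b assume "a \<in> carrier (generic_ring F)" "b \<in> carrier (generic_ring F)"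
    then obtain g h n g' h' m where v: "val n g h" "a = Fract g h" "val m g' h'" "b = Fract g' h'"
      unfolding c by blast
    then show "a \<otimes>\<^bsub>generic_ring F\<^esub> b \<in> carrier (generic_ring F)"
      using Fract_mem[OF val_mult[OF v(1,3)]] by simp
  next
    show "\<one>\<^bsub>generic_ring F\<^esub> \<in> carrier (generic_ring F)"
      using Fract_mem[OF val_one] by (simp add: One_fract_def)
  qed (simp_all add: algebra_simps)
qed (simp add: algebra_simps)

lemma generic_minus: "a \<in> carrier (generic_ring F) \<Longrightarrow> a_inv (generic_ring F) a = - a"
proof -
  interpret cring "generic_ring F" by (rule generic_cring)
  assume a: "a \<in> carrier (generic_ring F)"
  then obtain g h n where v: "val n g h" "a = Fract g h" unfolding carrier_generic by blast
  have "val n (- g) h" using v(1) gr_uminus unfolding val_def by blast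
  moreover have "- a = Fract (- g) h" using v(2) by simp
  ultimately have "- a \<in> carrier (generic_ring F)" using Fract_mem by simp
  then show ?thesis using minus_equality[of "- a" a] a by simp
qed

lemma maximal_alt: "generic_maximal_ideal F = {Fract g h |g h n. val n g h \<and> F dvd g}"
  unfolding generic_maximal_ideal_def using val_iff_form by blast

lemma Fract_mem_maximal: "val n g h \<Longrightarrow> Fract g h \<in> generic_maximal_ideal F \<longleftrightarrow> F dvd g"
proof
  assume v: "val n g h" and "Fract g h \<in> generic_maximal_ideal F"
  then obtain g' h' m where v': "Fract g h = Fract g' h'" "val m g' h'" "F dvd g'"
    unfolding maximal_alt by blast
  then have "g * h' = g' * h" using val_nz[OF v] val_nz[OF v'(2)] by (simp add: eq_fract)
  then have "F dvd g * h'" using v'(3) by simp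
  then show "F dvd g" using dvd_mult_iff v'(2) unfolding val_def by blast
qed (auto simp: maximal_alt)

lemma generic_ideal: "ideal (generic_maximal_ideal F) (generic_ring F)"
proof -
  interpret cring "generic_ring F" by (rule generic_cring)
  show ?thesis
  proof (rule idealI)
    show "ring (generic_ring F)" by (rule ring_axioms)
    have sub: "generic_maximal_ideal F \<subseteq> carrier (generic_ring F)"
      unfolding maximal_alt carrier_generic by blast
    show "subgroup (generic_maximal_ideal F) (add_monoid (generic_ring F))"
    proof (rule add.subgroupI)
      show "generic_maximal_ideal F \<subseteq> carrier (generic_ring F)" by (rule sub)
      show "generic_maximal_ideal F \<noteq> {}" using val_zero unfolding maximal_alt by auto
      fix a assume a: "a \<in> generic_maximal_ideal F"
      then obtain g h n where v: "val n g h" "a = Fract g h" "F dvd g" unfolding maximal_alt by blast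
      have "val n (- g) h" using v(1) gr_uminus unfolding val_def by blast
      then show "\<ominus>\<^bsub>generic_ring F\<^esub> a \<in> generic_maximal_ideal F"
        using v generic_minus[of a] sub a Fract_mem_maximal[of n "- g" h] by (auto simp flip: minus_fract)
      fix b assume "b \<in> generic_maximal_ideal F"
      then obtain g' h' m where v': "val m g' h'" "b = Fract g' h'" "F dvd g'" unfolding maximal_alt by blast
      have "a + b = Fract (g * h' + g' * h) (h * h')" using v v' val_nz by simp
      then show "a \<oplus>\<^bsub>generic_ring F\<^esub> b \<in> generic_maximal_ideal F"
        using Fract_mem_maximal[OF val_add[OF v(1) v'(1)]] v(3) v'(3) by simp
    qed
    fix a b assume "a \<in> generic_maximal_ideal F" "b \<in> carrier (generic_ring F)"
    then obtain g h n g' h' m where v: "val n g h" "a = Fract g h" "F dvd g" "val m g' h'" "b = Fract g' h'"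
      unfolding maximal_alt carrier_generic by blast
    then have "b * a = Fract (g' * g) (h' * h)" "F dvd g' * g" by simp_all
    then show "b \<otimes>\<^bsub>generic_ring F\<^esub> a \<in> generic_maximal_ideal F"
      using Fract_mem_maximal[OF val_mult[OF v(4,1)]] by simp
    then show "a \<otimes>\<^bsub>generic_ring F\<^esub> b \<in> generic_maximal_ideal F" by (simp add: mult.commute)
  qed
qed

abbreviation K where "K \<equiv> function_field F"
abbreviation R where "R \<equiv> rat_fun F"

lemma K_cring: "cring K"
  unfolding function_field_def by (rule ideal.quotient_is_cring[OF generic_ideal generic_cring])

lemma R_eq_iff:
  assumes v: "val n g h" "val m g' h'"
  shows "R g h = R g' h' \<longleftrightarrow> g * h' \<doteq> g' * h"
proof -
  interpret cring "generic_ring F" by (rule generic_cring)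
  interpret I: ideal "generic_maximal_ideal F" "generic_ring F" by (rule generic_ideal)
  have c: "Fract g h \<in> carrier (generic_ring F)" "Fract g' h' \<in> carrier (generic_ring F)"
    using Fract_mem v by blast+
  have "R g h = R g' h' \<longleftrightarrow> Fract g h \<in> generic_maximal_ideal F +>\<^bsub>generic_ring F\<^esub> Fract g' h'"
    unfolding rat_fun_def using I.a_rcos_self[OF c(1)] I.a_repr_independence'[OF _ c(2)] by metis
  also have "\<dots> \<longleftrightarrow> Fract g h - Fract g' h' \<in> generic_maximal_ideal F"
  proof -
    have "Fract g h \<in> generic_maximal_ideal F +>\<^bsub>generic_ring F\<^esub> Fract g' h' \<longleftrightarrow>
      (\<exists>a\<in>generic_maximal_ideal F. Fract g h = a + Fract g' h')"
      by (auto simp: a_r_coset_def')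
    also have "\<dots> \<longleftrightarrow> Fract g h - Fract g' h' \<in> generic_maximal_ideal F"
      by (metis add_diff_cancel_right' diff_add_cancel)
    finally show ?thesis .
  qed
  also have "Fract g h - Fract g' h' = Fract (g * h' - g' * h) (h * h')"
    using val_nz[OF v(1)] val_nz[OF v(2)] by simp
  also have "\<dots> \<in> generic_maximal_ideal F \<longleftrightarrow> g * h' \<doteq> g' * h"
  proof (rule Fract_mem_maximal)
    show "val (n + m) (g * h' - g' * h) (h * h')"
      using val_add[OF v(1), of m "- g'" h'] v(2) gr_uminus[of g' m] unfolding val_def by simp
  qed
  finally show ?thesis .
qed

lemma carrier_K: "carrier K = {R g h |g h n. val n g h}"
  unfolding function_field_def FactRing_def rat_fun_def by (auto simp: A_RCOSETS_def' carrier_generic)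

lemma R_mem: "val n g h \<Longrightarrow> R g h \<in> carrier K"
  unfolding carrier_K by blast

lemma R_mult: "val n g h \<Longrightarrow> val m g' h' \<Longrightarrow> R g h \<otimes>\<^bsub>K\<^esub> R g' h' = R (g * g') (h * h')"
  unfolding rat_fun_def function_field_def
  using ideal.rcoset_mult_add[OF generic_ideal Fract_mem Fract_mem, of n g h m g' h']
  by (simp add: FactRing_def)

lemma R_add: "val n g h \<Longrightarrow> val m g' h' \<Longrightarrow> R g h \<oplus>\<^bsub>K\<^esub> R g' h' = R (g * h' + g' * h) (h * h')"
proof -
  interpret I: ideal "generic_maximal_ideal F" "generic_ring F" by (rule generic_ideal)
  assume v: "val n g h" "val m g' h'"
  then show ?thesis
    unfolding rat_fun_def function_field_def
    using I.a_rcos_sum[OF Fract_mem Fract_mem, of n g h m g' h'] val_nz[OF v(1)] val_nz[OF v(2)]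
    by (simp add: FactRing_def)
qed

lemma R_one: "R 1 1 = \<one>\<^bsub>K\<^esub>"
  unfolding rat_fun_def function_field_def by (simp add: FactRing_def One_fract_def)

lemma R_zero: "R 0 1 = \<zero>\<^bsub>K\<^esub>"
proof -
  interpret I: ideal "generic_maximal_ideal F" "generic_ring F" by (rule generic_ideal)
  have "generic_maximal_ideal F +>\<^bsub>generic_ring F\<^esub> \<zero>\<^bsub>generic_ring F\<^esub> = generic_maximal_ideal F"
    by (rule I.a_coset_add_zero[OF I.a_subset])
  then show ?thesis
    unfolding rat_fun_def function_field_def by (simp add: FactRing_def Zero_fract_def)
qed

lemma R_eq_zero_iff: "val n g h \<Longrightarrow> R g h = \<zero>\<^bsub>K\<^esub> \<longleftrightarrow> F dvd g"
  using R_eq_iff[OF _ val_zero, of n g h] R_zero by simp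

lemma R_minus: "val n g h \<Longrightarrow> \<ominus>\<^bsub>K\<^esub> R g h = R (- g) h"
proof -
  interpret cring K by (rule K_cring)
  assume v: "val n g h"
  have v': "val n (- g) h" using v gr_uminus unfolding val_def by blast
  have "R (- g) h \<oplus>\<^bsub>K\<^esub> R g h = \<zero>\<^bsub>K\<^esub>"
    unfolding R_add[OF v' v] R_eq_zero_iff[OF val_add[OF v' v]] by (simp add: algebra_simps)
  then show ?thesis using minus_equality R_mem v v' by blast
qed

lemma K_field: "Ring.field K"
proof -
  interpret cring K by (rule K_cring)
  show ?thesis
  proof (rule cring_fieldI2)
    show "\<zero>\<^bsub>K\<^esub> \<noteq> \<one>\<^bsub>K\<^esub>"
      using R_eq_zero_iff[OF val_one] R_one val_one unfolding val_def by metis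
    fix a assume a: "a \<in> carrier K" "a \<noteq> \<zero>\<^bsub>K\<^esub>"
    then obtain g h n where v: "val n g h" "a = R g h" unfolding carrier_K by blast
    then have v': "val n h g" using a(2) R_eq_zero_iff unfolding val_def by blast
    have "R g h \<otimes>\<^bsub>K\<^esub> R h g = R 1 1"
      unfolding R_mult[OF v(1) v'] R_eq_iff[OF val_mult[OF v(1) v'] val_one] by (simp add: mult.commute)
    then show "\<exists>b\<in>carrier K. a \<otimes>\<^bsub>K\<^esub> b = \<one>\<^bsub>K\<^esub>" using v(2) R_mem[OF v'] R_one by auto
  qed
qed

lemma subfield_constants: "subfield (constants F) K"
proof -
  interpret k: Ring.field "ring_of_type_algebra :: 'k ring" by (rule field_from_type_algebra)
  interpret K: Ring.field K by (rule K_field)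
  have hom: "(\<lambda>c. R (const3 c) 1) \<in> ring_hom (ring_of_type_algebra :: 'k ring) K"
  proof (rule ring_hom_memI)
    fix a b :: 'k
    show "R (const3 a) 1 \<in> carrier K" by (rule R_mem[OF val_const])
    show "R (const3 (a \<otimes>\<^bsub>ring_of_type_algebra\<^esub> b)) 1 = R (const3 a) 1 \<otimes>\<^bsub>K\<^esub> R (const3 b) 1"
      using R_mult[OF val_const val_const] by (simp add: is_homD(4)[OF is_hom_const3])
    show "R (const3 (a \<oplus>\<^bsub>ring_of_type_algebra\<^esub> b)) 1 = R (const3 a) 1 \<oplus>\<^bsub>K\<^esub> R (const3 b) 1"
      using R_add[OF val_const val_const] by (simp add: is_homD(3)[OF is_hom_const3])
  qed (simp add: is_homD(2)[OF is_hom_const3] R_one)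
  interpret ring_hom_ring "ring_of_type_algebra :: 'k ring" K "\<lambda>c. R (const3 c) 1"
    by (rule ring_hom_ringI2[OF k.ring_axioms K.ring_axioms hom])
  have "subfield ((\<lambda>c. R (const3 c) 1) ` carrier (ring_of_type_algebra :: 'k ring)) K"
    by (rule img_is_subfield(2)[OF k.carrier_is_subfield]) simp
  then show ?thesis unfolding constants_def by simp
qed

lemma R_sc: "val n g h \<Longrightarrow> R (sc c g) h = R (const3 c) 1 \<otimes>\<^bsub>K\<^esub> R g h"
  using R_mult[OF val_const, of n g h c] by (simp add: sc_def)

lemma R_add_same:
  assumes "val n g h" "val n g' h"
  shows "R (g + g') h = R g h \<oplus>\<^bsub>K\<^esub> R g' h"
proof -
  have "val n (g + g') h" using assms gr_add unfolding val_def by blast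
  then show ?thesis
    unfolding R_add[OF assms] using R_eq_iff[OF _ val_add[OF assms]] by (simp add: algebra_simps)
qed

text \<open>With h fixed, g / h is zero in the function field exactly when F divides g, so V counts
  through its image in S; a lifted basis of that image makes the map injective.\<close>

lemma dimension_R:
  assumes h: "h \<in> gr m" "\<not> F dvd h" and V: "lin3.subspace V" "V \<subseteq> gr m"
  shows "ring.dimension K (nat (rd V)) (constants F) ((\<lambda>g. R g h) ` V)"
proof -
  interpret K: Ring.field K by (rule K_field)
  have fin: "lin3.fin_dim V" by (rule lin3.fin_dim_subset[OF fin_dim_gr V(2)])
  obtain B where B: "finite B" "B \<subseteq> V" "lin3.independent B" "card B = lin3.qdim zeroF V"
    "lin3.span B \<inter> zeroF = {0}" "\<forall>v\<in>V. \<exists>w\<in>lin3.span B. v - w \<in> zeroF"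
    using lin3.exists_lifted_basis[OF sub_zeroF V(1) fin] by blast
  have sp: "lin3.span B \<subseteq> V" by (rule lin3.span_minimal[OF B(2) V(1)])
  have v: "val m g h" if "g \<in> V" for g using that V(2) h unfolding val_def by blast
  have eq: "R g h = R g' h \<longleftrightarrow> g \<doteq> g'" if "g \<in> V" "g' \<in> V" for g g'
  proof -
    have "R g h = R g' h \<longleftrightarrow> g * h \<doteq> g' * h" by (rule R_eq_iff[OF v[OF that(1)] v[OF that(2)]])
    also have "\<dots> \<longleftrightarrow> g \<doteq> g'"
      using dvd_mult_iff[of "g - g'" h] h(2) by (simp add: algebra_simps)
    finally show ?thesis .
  qed
  have "K.dimension (card B) (range (\<lambda>c. R (const3 c) 1)) ((\<lambda>g. R g h) ` lin3.span B)"
  proof (rule dimension_image[OF K.ring_axioms B(1,3) sp])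
    show "R g h \<in> carrier K" if "g \<in> V" for g by (rule R_mem[OF v[OF that]])
    show "inj_on (\<lambda>g. R g h) (lin3.span B)"
    proof (rule inj_onI)
      fix g g' assume g: "g \<in> lin3.span B" "g' \<in> lin3.span B" "R g h = R g' h"
      then have "g - g' \<in> zeroF" using eq sp by blast
      then have "g - g' = 0" using B(5) lin3.span_diff[OF g(1,2)] by blast
      then show "g = g'" by simp
    qed
    have "0 \<in> V" by (rule lin3.subspace_0[OF V(1)])
    then show "R 0 h = \<zero>\<^bsub>K\<^esub>" using R_eq_zero_iff[OF v] by simp
    show "R (g + g') h = R g h \<oplus>\<^bsub>K\<^esub> R g' h" if "g \<in> V" "g' \<in> V" for g g'
      by (rule R_add_same[OF v[OF that(1)] v[OF that(2)]])
    show "R (sc c g) h = R (const3 c) 1 \<otimes>\<^bsub>K\<^esub> R g h" if "g \<in> V" for c g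
      by (rule R_sc[OF v[OF that]])
  qed
  moreover have "(\<lambda>g. R g h) ` lin3.span B = (\<lambda>g. R g h) ` V"
  proof
    show "(\<lambda>g. R g h) ` lin3.span B \<subseteq> (\<lambda>g. R g h) ` V" using sp by blast
    show "(\<lambda>g. R g h) ` V \<subseteq> (\<lambda>g. R g h) ` lin3.span B"
    proof
      fix z assume "z \<in> (\<lambda>g. R g h) ` V"
      then obtain g where g: "g \<in> V" "z = R g h" by blast
      obtain w where w: "w \<in> lin3.span B" "g \<doteq> w" using B(6) g(1) by blast
      then show "z \<in> (\<lambda>g. R g h) ` lin3.span B" using eq[of g w] g sp by blast
    qed
  qed
  ultimately show ?thesis unfolding constants_def rd_def using B(4) by simp
qed

section \<open>Groups of points\<close>

lemma saturation_eq: "saturation I = {f. \<exists>n. \<forall>g\<in>gr (int n). f * g \<in> I}"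
  unfolding saturation_def form_iff_gr by blast

lemma closed_iff: "closed I \<longleftrightarrow> closed_subscheme I \<and> F \<in> I"
proof
  assume c: "closed I"
  have "saturation I = I"
  proof
    show "saturation I \<subseteq> I" unfolding saturation_eq using closedD(3)[OF c] by blast
    show "I \<subseteq> saturation I" unfolding saturation_eq using hidD(4)[OF closedD(1)[OF c]] by blast
  qed
  then show "closed_subscheme I \<and> F \<in> I"
    unfolding closed_subscheme_def homogeneous_ideal_iff using closedD(1,2)[OF c] by blast
next
  assume "closed_subscheme I \<and> F \<in> I"
  then have "hid I" "saturation I = I" "F \<in> I" unfolding closed_subscheme_def homogeneous_ideal_iff by blast+
  then show "closed I" unfolding closed_def saturation_eq by blast
qed

text \<open>The ideal (F, G) is saturated by \<open>closed_princ\<close>, so forming the saturation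
  changes nothing.\<close>

lemma curve_intersection_eq:
  assumes G: "G \<in> gr s" "\<not> F dvd G"
  shows "curve_intersection F G = princ G"
proof -
  interpret cring "poly3_ring :: 'k poly3 ring" by (rule type_ring_cring)
  have cl: "closed (princ G)" by (rule closed_princ[OF G])
  have id: "ideal (princ G) poly3_ring"
    using closedD(1)[OF cl] unfolding ideal_type_ring_iff hid_def by blast
  have "Idl\<^bsub>poly3_ring\<^esub> {F, G} = princ G"
  proof
    have "G \<in> princ G" unfolding princ_def by (auto intro: exI[of _ 1])
    then show "Idl\<^bsub>poly3_ring\<^esub> {F, G} \<subseteq> princ G"
      using closedD(2)[OF cl] by (intro genideal_minimal[OF id]) blast
    have J: "ideal (Idl\<^bsub>poly3_ring\<^esub> {F, G}) poly3_ring" by (rule genideal_ideal) simp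
    have "{F, G} \<subseteq> Idl\<^bsub>poly3_ring\<^esub> {F, G}" by (rule genideal_self) simp
    then have FG: "F \<in> Idl\<^bsub>poly3_ring\<^esub> {F, G}" "G \<in> Idl\<^bsub>poly3_ring\<^esub> {F, G}" by blast+
    show "princ G \<subseteq> Idl\<^bsub>poly3_ring\<^esub> {F, G}"
    proof
      fix f assume "f \<in> princ G"
      then obtain c k where "f - G * c = F * k" unfolding princ_def by (auto simp: dvd_def)
      then have "f = c * G + k * F" by (simp add: algebra_simps)
      then show "f \<in> Idl\<^bsub>poly3_ring\<^esub> {F, G}" using J FG unfolding ideal_type_ring_iff by blast
    qed
  qed
  then show ?thesis
    unfolding curve_intersection_def using cl unfolding closed_iff closed_subscheme_def by simp
qed

lemma ndvd_of_eval: "p \<in> points F \<Longrightarrow> eval3 h p \<noteq> 0 \<Longrightarrow> \<not> F dvd h"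
  by (auto simp: points_def dvd_def eval3_mult)

lemma stalk_iff:
  "z \<in> ideal_stalk F Y p \<longleftrightarrow> (\<exists>g h n. z = R g h \<and> g \<in> Y \<and> g \<in> gr n \<and> h \<in> gr n \<and> eval3 h p \<noteq> 0)"
proof
  show "z \<in> ideal_stalk F Y p \<Longrightarrow> \<exists>g h n. z = R g h \<and> g \<in> Y \<and> g \<in> gr n \<and> h \<in> gr n \<and> eval3 h p \<noteq> 0"
    unfolding ideal_stalk_def form_iff_gr by blast
  assume "\<exists>g h n. z = R g h \<and> g \<in> Y \<and> g \<in> gr n \<and> h \<in> gr n \<and> eval3 h p \<noteq> 0"
  then obtain g h n where z: "z = R g h" "g \<in> Y" "g \<in> gr n" "h \<in> gr n" "eval3 h p \<noteq> 0" by blast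
  have "\<not> n < 0"
  proof
    assume "n < 0"
    then have "h = 0" using z(4) gr_neg[of n, where 'a = 'k] by simp
    then show False using z(5) by simp
  qed
  then have "n = int (nat n)" by simp
  then show "z \<in> ideal_stalk F Y p" unfolding ideal_stalk_def form_iff_gr using z by (metis (mono_tags, lifting) mem_Collect_eq)
qed

lemma val_of_eval: "p \<in> points F \<Longrightarrow> g \<in> gr n \<Longrightarrow> h \<in> gr n \<Longrightarrow> eval3 h p \<noteq> 0 \<Longrightarrow> val n g h"
  unfolding val_def using ndvd_of_eval by blast

text \<open>A power of a linear form not vanishing at p serves as a denominator of degree n; the
  nonzero f of degree n ensures that n is not negative.\<close>

lemma exists_unit_form:
  assumes "p \<in> points F" "(f :: 'k poly3) \<in> gr n" "f \<noteq> 0"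
  shows "\<exists>l\<in>gr n. eval3 l p \<noteq> 0"
proof -
  obtain l where l: "l \<in> gr 1" "eval3 l p \<noteq> 0"
    using exists_form_nonzero_at[of p] assms(1) by (auto simp: points_def)
  have "\<not> n < 0" using assms(2,3) gr_neg[of n, where 'a = 'k] by auto
  then have "l ^ nat n \<in> gr n" using gr_power_one[OF l(1), of "nat n"] by simp
  then show ?thesis using l(2) by (intro bexI[of _ "l ^ nat n"]) (simp_all add: eval3_power)
qed

lemma stalk_sub_K: "p \<in> points F \<Longrightarrow> ideal_stalk F Y p \<subseteq> carrier K"
proof
  fix z assume p: "p \<in> points F" and "z \<in> ideal_stalk F Y p"
  then obtain g h n where z: "z = R g h" "g \<in> gr n" "h \<in> gr n" "eval3 h p \<noteq> 0" unfolding stalk_iff by blast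
  show "z \<in> carrier K" unfolding z(1) by (rule R_mem[OF val_of_eval[OF p z(2-4)]])
qed

lemma stalk_add:
  assumes p: "p \<in> points F" and Y: "hid Y" and z: "z \<in> ideal_stalk F Y p" "w \<in> ideal_stalk F Y p"
  shows "z \<oplus>\<^bsub>K\<^esub> w \<in> ideal_stalk F Y p"
proof -
  obtain g h n where z: "z = R g h" "g \<in> Y" "g \<in> gr n" "h \<in> gr n" "eval3 h p \<noteq> 0" using z(1) unfolding stalk_iff by blast
  obtain g' h' m where w: "w = R g' h'" "g' \<in> Y" "g' \<in> gr m" "h' \<in> gr m" "eval3 h' p \<noteq> 0" using assms(4) unfolding stalk_iff by blast
  have v: "val n g h" "val m g' h'" using val_of_eval[OF p] z w by blast+
  have "g * h' + g' * h \<in> Y" using z(2) w(2) by (intro hidD(2)[OF Y] hidD(4)[OF Y])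
  then show ?thesis
    using val_add[OF v] z(5) w(5) unfolding stalk_iff z(1) w(1) R_add[OF v] val_def
    by (intro exI[of _ "g * h' + g' * h"] exI[of _ "h * h'"] exI[of _ "n + m"]) (simp add: eval3_mult)
qed

lemma stalk_mult:
  assumes p: "p \<in> points F" and Y: "hid Y" and z: "z \<in> ideal_stalk F UNIV p" and w: "w \<in> ideal_stalk F Y p"
  shows "z \<otimes>\<^bsub>K\<^esub> w \<in> ideal_stalk F Y p"
proof -
  obtain g h n where z: "z = R g h" "g \<in> gr n" "h \<in> gr n" "eval3 h p \<noteq> 0" using z unfolding stalk_iff by blast
  obtain g' h' m where w: "w = R g' h'" "g' \<in> Y" "g' \<in> gr m" "h' \<in> gr m" "eval3 h' p \<noteq> 0" using w unfolding stalk_iff by blast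
  have v: "val n g h" "val m g' h'" using val_of_eval[OF p] z w by blast+
  have "g * g' \<in> Y" by (rule hidD(3)[OF Y w(2)])
  then show ?thesis
    using val_mult[OF v] z(4) w(5) unfolding stalk_iff z(1) w(1) R_mult[OF v] val_def
    by (intro exI[of _ "g * g'"] exI[of _ "h * h'"] exI[of _ "n + m"]) (simp add: eval3_mult)
qed

lemma stalk_minus:
  assumes p: "p \<in> points F" and Y: "hid Y" and z: "z \<in> ideal_stalk F Y p"
  shows "\<ominus>\<^bsub>K\<^esub> z \<in> ideal_stalk F Y p"
proof -
  obtain g h n where z: "z = R g h" "g \<in> Y" "g \<in> gr n" "h \<in> gr n" "eval3 h p \<noteq> 0" using z unfolding stalk_iff by blast
  have v: "val n g h" using val_of_eval[OF p] z by blast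
  have "- g \<in> Y" by (rule hidD(6)[OF Y z(2)])
  then show ?thesis unfolding z(1) R_minus[OF v] stalk_iff using z gr_uminus by blast
qed

lemma local_ring_cring: "p \<in> points F \<Longrightarrow> cring (local_ring F p)"
proof -
  assume p: "p \<in> points F"
  interpret cring K by (rule K_cring)
  have "subring (ideal_stalk F UNIV p) K"
  proof (rule subringI)
    show "\<one>\<^bsub>K\<^esub> \<in> ideal_stalk F UNIV p"
      unfolding R_one[symmetric] stalk_iff using one_gr by (intro exI[of _ 1] exI[of _ 0]) auto
  qed (use stalk_sub_K stalk_minus stalk_mult stalk_add p hid_UNIV in blast)+
  then show ?thesis
    unfolding local_ring_def using subcring_iff[OF stalk_sub_K[OF p]] subcringI' by blast
qed

lemma local_ring_simps [simp]:
  "carrier (local_ring F p) = ideal_stalk F UNIV p" "monoid.mult (local_ring F p) = monoid.mult K"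
  "ring.add (local_ring F p) = ring.add K" "ring.zero (local_ring F p) = ring.zero K" "monoid.one (local_ring F p) = monoid.one K"
  by (simp_all add: local_ring_def)

text \<open>If g0 / h0 generates the stalk, the numerator g0 is a local generator: a form f of Y
  becomes an element of the stalk over a denominator l nonzero at p, and cross-multiplication clears
  all denominators.\<close>

lemma principal_imp_locgen:
  assumes p: "p \<in> points F" and pr: "principalideal (ideal_stalk F Y p) (local_ring F p)"
  shows "\<exists>g. locgen Y p g"
proof -
  interpret L: cring "local_ring F p" by (rule local_ring_cring[OF p])
  obtain i where i: "i \<in> ideal_stalk F UNIV p" "ideal_stalk F Y p = Idl\<^bsub>local_ring F p\<^esub> {i}"
    using principalideal.generate[OF pr] by auto
  have "PIdl\<^bsub>local_ring F p\<^esub> i = Idl\<^bsub>local_ring F p\<^esub> {i}" by (rule L.cgenideal_eq_genideal) (use i in simp)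
  then have eq: "ideal_stalk F Y p = {x \<otimes>\<^bsub>K\<^esub> i |x. x \<in> ideal_stalk F UNIV p}"
    unfolding i(2) cgenideal_def by auto
  have "\<one>\<^bsub>local_ring F p\<^esub> \<otimes>\<^bsub>local_ring F p\<^esub> i = i" by (rule L.l_one) (use i in simp)
  then have "i \<in> ideal_stalk F Y p" using L.one_closed unfolding eq by force
  then obtain g0 h0 n where g0: "i = R g0 h0" "g0 \<in> Y" "g0 \<in> gr n" "h0 \<in> gr n" "eval3 h0 p \<noteq> 0"
    unfolding stalk_iff by blast
  have v0: "val n g0 h0" by (rule val_of_eval[OF p g0(3-5)])
  have "\<exists>j b a. b \<in> gr j \<and> eval3 b p \<noteq> 0 \<and> b * f \<doteq> a * g0" if f: "f \<in> Y" "f \<in> gr k" for f k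
  proof (cases "f = 0")
    case True
    then show ?thesis using one_gr by (intro exI[of _ 0] exI[of _ 1]) auto
  next
    case False
    obtain l where l: "l \<in> gr k" "eval3 l p \<noteq> 0" using exists_unit_form[OF p f(2) False] by blast
    have "R f l \<in> ideal_stalk F Y p" unfolding stalk_iff using f l by blast
    then obtain z where z: "z \<in> ideal_stalk F UNIV p" "R f l = z \<otimes>\<^bsub>K\<^esub> i" unfolding eq by blast
    then obtain a b m where ab: "z = R a b" "a \<in> gr m" "b \<in> gr m" "eval3 b p \<noteq> 0" unfolding stalk_iff by blast
    have v: "val m a b" "val k f l" using val_of_eval[OF p] ab f l by blast+
    have "R f l = R (a * g0) (b * h0)" using z(2) R_mult[OF v(1) v0] ab(1) g0(1) by simp
    then have "f * (b * h0) \<doteq> a * g0 * l" using R_eq_iff[OF v(2) val_mult[OF v(1) v0]] by simp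
    then have "(b * h0) * f \<doteq> (a * l) * g0" by (simp add: algebra_simps)
    moreover have "b * h0 \<in> gr (m + n)" by (rule gr_mult[OF ab(3) g0(4)])
    moreover have "eval3 (b * h0) p \<noteq> 0" using ab(4) g0(5) by (simp add: eval3_mult)
    ultimately show ?thesis by blast
  qed
  then show ?thesis unfolding locgen_def using g0 by blast
qed

lemma locgen_imp_principal:
  assumes p: "p \<in> points F" and Y: "hid Y" and g: "locgen Y p g"
  shows "principalideal (ideal_stalk F Y p) (local_ring F p)"
proof -
  interpret L: cring "local_ring F p" by (rule local_ring_cring[OF p])
  obtain n where gn: "g \<in> gr n" "g \<in> Y" using g unfolding locgen_def by blast
  have "\<exists>l n. l \<in> gr n \<and> g \<in> gr n \<and> eval3 l p \<noteq> 0"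
  proof (cases "g = 0")
    case True
    then show ?thesis using one_gr by (intro exI[of _ 1] exI[of _ 0]) auto
  qed (use exists_unit_form[OF p gn(1)] gn in blast)
  then obtain l n where l: "l \<in> gr n" "g \<in> gr n" "eval3 l p \<noteq> 0" by blast
  have v0: "val n g l" by (rule val_of_eval[OF p l(2,1,3)])
  have i: "R g l \<in> carrier (local_ring F p)" using l by (auto simp: stalk_iff)
  have "ideal_stalk F Y p = PIdl\<^bsub>local_ring F p\<^esub> (R g l)"
  proof (intro equalityI subsetI)
    fix z assume "z \<in> ideal_stalk F Y p"
    then obtain f h k where z: "z = R f h" "f \<in> Y" "f \<in> gr k" "h \<in> gr k" "eval3 h p \<noteq> 0" unfolding stalk_iff by blast
    obtain j b a where b: "b \<in> gr j" "eval3 b p \<noteq> 0" "b * f \<doteq> a * g"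
      using g z(2,3) unfolding locgen_def by blast
    have "hcomp (j + k) (b * f) \<doteq> hcomp (j + k) (a * g)" by (rule cong_hcomp[OF b(3)])
    then have b3: "b * f \<doteq> hcomp (j + k - n) a * g"
      using hcomp_of_gr[OF gr_mult[OF b(1) z(3)]] by (simp add: hcomp_mult[OF l(2)])
    let ?A = "hcomp (j + k - n) a * l" and ?B = "b * h"
    have "?A \<in> gr (j + k)" by (rule gr_mult_eq[OF hcomp_gr l(1)]) simp
    then have AB: "?A \<in> gr (j + k)" "?B \<in> gr (j + k)" "eval3 ?B p \<noteq> 0"
      using gr_mult[OF b(1) z(4)] b(2) z(5) by (auto simp: eval3_mult)
    have v: "val k f h" "val (j + k) ?A ?B" using val_of_eval[OF p] z AB by blast+
    have "(h * l) * (b * f) \<doteq> (h * l) * (hcomp (j + k - n) a * g)" by (rule cong_mult_left[OF b3])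
    then have "f * (?B * l) \<doteq> (?A * g) * h" by (simp add: algebra_simps)
    then have "z = R ?A ?B \<otimes>\<^bsub>K\<^esub> R g l"
      unfolding z(1) R_mult[OF v(2) v0] using R_eq_iff[OF v(1) val_mult[OF v(2) v0]] by simp
    moreover have "R ?A ?B \<in> ideal_stalk F UNIV p" unfolding stalk_iff using AB by blast
    ultimately show "z \<in> PIdl\<^bsub>local_ring F p\<^esub> (R g l)" unfolding cgenideal_def by auto
  next
    fix z assume "z \<in> PIdl\<^bsub>local_ring F p\<^esub> (R g l)"
    then obtain w where w: "w \<in> ideal_stalk F UNIV p" "z = w \<otimes>\<^bsub>K\<^esub> R g l" unfolding cgenideal_def by auto
    have "R g l \<in> ideal_stalk F Y p" unfolding stalk_iff using l gn by blast
    then show "z \<in> ideal_stalk F Y p" unfolding w(2) by (rule stalk_mult[OF p Y w(1)])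
  qed
  then show ?thesis using L.cgenideal_is_principalideal[OF i] by simp
qed

lemma group_of_points_iff:
  "group_of_points F Y \<longleftrightarrow> closed Y \<and> finite (support Y) \<and> locally_principal Y"
  unfolding group_of_points_def closed_iff locally_principal_def
  using principal_imp_locgen locgen_imp_principal closedD(1) closed_iff by blast

lemma has_degree_imp:
  assumes Y: "closed Y" and deg: "has_degree Y \<alpha>"
  shows "eventually_linear Y (euler - int \<alpha>)"
proof -
  obtain n0 where n0: "\<And>n. n \<ge> n0 \<Longrightarrow> hilbert_function Y n = int \<alpha>"
    using deg unfolding has_degree_def eventually_sequentially by blast
  have "H Y n = int d * n + (euler - int \<alpha>)" if n: "n \<ge> int (n0 + d)" for n
  proof -
    have n': "int (nat n) = n" "nat n \<ge> n0" "n \<ge> int d - 2" using n by auto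
    have "hilbert_function Y (nat n) = int \<alpha>" by (rule n0[OF n'(2)])
    then have "int (lin3.dim (gr n :: 'k poly3 set)) - int (lin3.dim (Y \<inter> gr n)) = int \<alpha>"
      unfolding hilbert_function_eq[OF closedD(1)[OF Y]] n'(1) .
    moreover have "int (lin3.dim (gr n :: 'k poly3 set)) = H UNIV n + int (lin3.dim (gr (n - int d) :: 'k poly3 set))"
      using H_dim[OF hid_UNIV UNIV_I, where n = n] by simp
    ultimately show ?thesis
      using H_dim[OF closedD(1,2)[OF Y], of n] H_UNIV_linear[OF n'(3)] by simp
  qed
  then show ?thesis unfolding eventually_linear_def by blast
qed

lemma has_degree_of:
  assumes Y: "closed Y" and ev: "eventually_linear Y (euler - int \<alpha>)"
  shows "has_degree Y \<alpha>"
proof -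
  obtain n0 where n0: "\<And>n. n \<ge> n0 \<Longrightarrow> H Y n = int d * n + (euler - int \<alpha>)"
    using ev unfolding eventually_linear_def by blast
  have "hilbert_function Y n = int \<alpha>" if n: "n \<ge> nat \<bar>n0\<bar> + d" for n
  proof -
    have n': "int n \<ge> n0" "int n \<ge> int d - 2" using n by auto
    have "int (lin3.dim (gr (int n) :: 'k poly3 set)) = H UNIV (int n) + int (lin3.dim (gr (int n - int d) :: 'k poly3 set))"
      using H_dim[OF hid_UNIV UNIV_I, where n = "int n"] by simp
    then show ?thesis
      unfolding hilbert_function_eq[OF closedD(1)[OF Y]]
      using H_dim[OF closedD(1,2)[OF Y], of "int n"] H_UNIV_linear[OF n'(2)] n0[OF n'(1)] by simp
  qed
  then show ?thesis unfolding has_degree_def eventually_sequentially by blast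
qed

text \<open>The Hilbert function of the quotient of the polynomial ring by Y is eventually the
  constant \<open>euler - \<gamma>\<close>, hence bounded.\<close>

lemma finite_support_of_linear:
  assumes Y: "closed Y" and ev: "eventually_linear Y \<gamma>"
  shows "finite (support Y)"
proof -
  obtain n0 where n0: "\<And>n. n \<ge> n0 \<Longrightarrow> H Y n = int d * n + \<gamma>"
    using ev unfolding eventually_linear_def by blast
  have sub: "lin3.subspace Y" by (rule hid_subspace[OF closedD(1)[OF Y]])
  have "lin3.qdim Y (gr (int n)) \<le> nat (euler - \<gamma>)" if n: "n \<ge> nat \<bar>n0\<bar> + d" for n
  proof -
    have n': "int n \<ge> n0" "int n \<ge> int d - 2" using n by auto
    have "lin3.dim (gr (int n) :: 'k poly3 set) = lin3.qdim Y (gr (int n)) + lin3.dim (gr (int n) \<inter> Y)"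
      by (rule lin3.dim_eq_qdim[OF sub subspace_gr fin_dim_gr])
    moreover have "gr (int n) \<inter> Y = Y \<inter> gr (int n)" by blast
    moreover have "int (lin3.dim (gr (int n) :: 'k poly3 set)) = H UNIV (int n) + int (lin3.dim (gr (int n - int d) :: 'k poly3 set))"
      using H_dim[OF hid_UNIV UNIV_I, where n = "int n"] by simp
    ultimately show ?thesis
      using H_dim[OF closedD(1,2)[OF Y], of "int n"] H_UNIV_linear[OF n'(2)] n0[OF n'(1)] by simp
  qed
  then show ?thesis by (rule finite_support_of_bounded[OF closedD(1)[OF Y]])
qed

subsection \<open>Global sections and linear equivalence\<close>

lemma local_global_princ:
  assumes h: "h \<in> gr m" "\<not> F dvd h" and f: "f \<in> gr n"
    and loc: "\<And>p. p \<in> points F \<Longrightarrow> \<exists>q. eval3 q p \<noteq> 0 \<and> q * f \<in> princ h"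
  shows "\<exists>c\<in>gr (n - m). f \<doteq> h * c"
proof -
  have "f \<in> princ h" by (rule local_global[OF closed_princ[OF h] f loc])
  then obtain c where "f \<doteq> h * c" unfolding princ_def by blast
  then have "hcomp n f \<doteq> hcomp n (h * c)" by (rule cong_hcomp)
  then have "f \<doteq> h * hcomp (n - m) c" using hcomp_of_gr[OF f, of n] by (simp add: hcomp_mult_left[OF h(1)])
  then show ?thesis using hcomp_gr by blast
qed

lemma colonI_forms:
  assumes Y: "hid Y" and h: "h \<in> gr m" and g: "g \<in> gr n"
    and a: "\<And>a k. a \<in> Y \<Longrightarrow> a \<in> gr k \<Longrightarrow> g * a \<in> princ h"
  shows "g \<in> colon (princ h) Y"
  unfolding colon_def
proof (intro CollectI ballI)
  fix a assume "a \<in> Y"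
  then have "hcomp k a \<in> {a. g * a \<in> princ h}" for k using a hidD(5)[OF Y] hcomp_gr by blast
  then have "a \<in> {a. g * a \<in> princ h}" by (rule hid_memI[OF hid_quot_princ[OF h g]])
  then show "g * a \<in> princ h" by simp
qed

text \<open>A section g0 / h0 multiplies every stalk of Y into the local ring. The local quotients
  of g0 a by h0, for a form a of Y, therefore come from one form of the degree of a; taking a = h
  rewrites the section as g / h, with g in (F, h) : Y.\<close>

lemma global_sections_eq:
  assumes Y: "closed Y" and h: "h \<in> Y" "h \<in> gr m" "\<not> F dvd h"
  shows "global_sections F Y = (\<lambda>g. R g h) ` (colon (princ h) Y \<inter> gr m)"
proof (intro equalityI subsetI)
  fix f assume f: "f \<in> global_sections F Y"
  then obtain g0 h0 n0 where v0: "val n0 g0 h0" "f = R g0 h0" unfolding global_sections_def carrier_K by blast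
  have h0: "h0 \<in> gr n0" "\<not> F dvd h0" "g0 \<in> gr n0" using v0(1) unfolding val_def by blast+
  have key: "\<exists>c\<in>gr k. g0 * a \<doteq> h0 * c" if a: "a \<in> Y" "a \<in> gr k" for a k
  proof (cases "a = 0")
    case True
    then show ?thesis by (intro bexI[of _ 0]) auto
  next
    case False
    have "\<exists>c\<in>gr (n0 + k - n0). g0 * a \<doteq> h0 * c"
    proof (rule local_global_princ[OF h0(1,2) gr_mult[OF h0(3) a(2)]])
      fix p assume p: "p \<in> points F"
      obtain l where l: "l \<in> gr k" "eval3 l p \<noteq> 0" using exists_unit_form[OF p a(2) False] by blast
      have "R a l \<in> ideal_stalk F Y p" unfolding stalk_iff using a l by blast
      then have "f \<otimes>\<^bsub>K\<^esub> R a l \<in> f <#\<^bsub>K\<^esub> ideal_stalk F Y p" unfolding l_coset_def by blast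
      then have "f \<otimes>\<^bsub>K\<^esub> R a l \<in> ideal_stalk F UNIV p" using f p unfolding global_sections_def by auto
      then obtain c b j where c: "f \<otimes>\<^bsub>K\<^esub> R a l = R c b" "c \<in> gr j" "b \<in> gr j" "eval3 b p \<noteq> 0"
        unfolding stalk_iff by blast
      have v: "val k a l" "val j c b" using val_of_eval[OF p] a l c by blast+
      have "R (g0 * a) (h0 * l) = R c b" using c(1) R_mult[OF v0(1) v(1)] v0(2) by simp
      then have "g0 * a * b \<doteq> c * (h0 * l)" using R_eq_iff[OF val_mult[OF v0(1) v(1)] v(2)] by simp
      then have "b * (g0 * a) \<doteq> h0 * (c * l)" by (simp add: algebra_simps)
      then show "\<exists>q. eval3 q p \<noteq> 0 \<and> q * (g0 * a) \<in> princ h0" using c(4) unfolding princ_def by blast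
    qed
    then show ?thesis by simp
  qed
  obtain g where g: "g \<in> gr m" "g0 * h \<doteq> h0 * g" using key[OF h(1,2)] by blast
  have "g \<in> colon (princ h) Y"
  proof (rule colonI_forms[OF closedD(1)[OF Y] h(2) g(1)])
    fix a k assume a: "a \<in> Y" "a \<in> gr k"
    obtain c where c: "g0 * a \<doteq> h0 * c" using key[OF a] by blast
    have 1: "a * (h0 * g) \<doteq> a * (g0 * h)" by (rule cong_mult_left[OF cong_sym[OF g(2)]])
    have "h * (g0 * a) \<doteq> h * (h0 * c)" by (rule cong_mult_left[OF c])
    then have "a * (h0 * g) \<doteq> h * (h0 * c)" using cong_trans[OF 1] by (simp add: algebra_simps)
    then have "h0 * (g * a) \<doteq> h0 * (h * c)" by (simp add: algebra_simps)
    then have "g * a \<doteq> h * c" using cong_cancel h0(2) by blast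
    then show "g * a \<in> princ h" unfolding princ_def by blast
  qed
  moreover have "f = R g h"
  proof -
    have v: "val m g h" using g(1) h(2,3) unfolding val_def by blast
    show ?thesis unfolding v0(2) using R_eq_iff[OF v0(1) v] g(2) by (simp add: mult.commute)
  qed
  ultimately show "f \<in> (\<lambda>g. R g h) ` (colon (princ h) Y \<inter> gr m)" using g(1) by blast
next
  fix f assume "f \<in> (\<lambda>g. R g h) ` (colon (princ h) Y \<inter> gr m)"
  then obtain g where g: "g \<in> colon (princ h) Y" "g \<in> gr m" "f = R g h" by blast
  have v: "val m g h" using g(2) h(2,3) unfolding val_def by blast
  have "f <#\<^bsub>K\<^esub> ideal_stalk F Y p \<subseteq> carrier (local_ring F p)" if p: "p \<in> points F" for p
  proof
    fix z assume "z \<in> f <#\<^bsub>K\<^esub> ideal_stalk F Y p"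
    then obtain a b k where ab: "z = f \<otimes>\<^bsub>K\<^esub> R a b" "a \<in> Y" "a \<in> gr k" "b \<in> gr k" "eval3 b p \<noteq> 0"
      unfolding l_coset_def by (auto simp: stalk_iff)
    have v': "val k a b" by (rule val_of_eval[OF p ab(3-5)])
    obtain c where "g * a \<doteq> h * c" using g(1) ab(2) unfolding colon_def princ_def by blast
    then have "hcomp (m + k) (g * a) \<doteq> hcomp (m + k) (h * c)" by (rule cong_hcomp)
    then have c: "g * a \<doteq> h * hcomp k c"
      using hcomp_of_gr[OF gr_mult[OF g(2) ab(3)]] by (simp add: hcomp_mult_left[OF h(2)])
    have v'': "val k (hcomp k c) b" using v' unfolding val_def by simp
    have "z = R (g * a) (h * b)" unfolding ab(1) g(3) by (rule R_mult[OF v v'])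
    also have "\<dots> = R (hcomp k c) b"
      unfolding R_eq_iff[OF val_mult[OF v v'] v'']
      using cong_mult_right[OF c, of b] by (simp add: algebra_simps)
    finally have "z = R (hcomp k c) b" .
    then show "z \<in> carrier (local_ring F p)" unfolding local_ring_simps stalk_iff using ab(4,5) hcomp_gr by blast
  qed
  then show "f \<in> global_sections F Y" unfolding global_sections_def using R_mem[OF v] g(3) by blast
qed

lemma transfer_local:
  assumes Y': "closed Y'" and v: "val n g h" and a: "a \<in> gr k"
    and loc: "\<And>p. p \<in> points F \<Longrightarrow> \<exists>b c. eval3 b p \<noteq> 0 \<and> c \<in> Y' \<and> b * (g * a) \<doteq> c * h"
  shows "\<exists>c\<in>Y' \<inter> gr k. g * a \<doteq> h * c"
proof -
  have gh: "g \<in> gr n" "h \<in> gr n" "\<not> F dvd h" using v unfolding val_def by blast+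
  have "\<exists>c\<in>gr (n + k - n). g * a \<doteq> h * c"
  proof (rule local_global_princ[OF gh(2,3) gr_mult[OF gh(1) a]])
    fix p assume "p \<in> points F"
    then obtain b c where bc: "eval3 b p \<noteq> 0" "b * (g * a) \<doteq> c * h" using loc by blast
    then have "b * (g * a) \<doteq> h * c" by (simp add: mult.commute)
    then show "\<exists>q. eval3 q p \<noteq> 0 \<and> q * (g * a) \<in> princ h" using bc(1) unfolding princ_def by blast
  qed
  then obtain c where c: "c \<in> gr k" "g * a \<doteq> h * c" by auto
  have "c \<in> Y'"
  proof (rule local_global[OF Y' c(1)])
    fix p assume "p \<in> points F"
    then obtain b e where b: "eval3 b p \<noteq> 0" "e \<in> Y'" "b * (g * a) \<doteq> e * h" using loc by blast
    have "h * (b * c) \<doteq> b * (g * a)" using cong_sym[OF cong_mult_left[OF c(2), of b]] by (simp add: algebra_simps)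
    then have "h * (b * c) \<doteq> h * e" using cong_trans[OF _ b(3)] by (simp add: mult.commute)
    then have "b * c \<doteq> e" using cong_cancel gh(3) by blast
    then have "b * c \<in> Y'" using closed_cong[OF Y'] b(2) by blast
    then show "\<exists>q. eval3 q p \<noteq> 0 \<and> q * c \<in> Y'" using b(1) by blast
  qed
  then show ?thesis using c by blast
qed

text \<open>Equality of all stalks globalises: multiplication by g / h carries each graded part of Y
  onto that of Y', the inverse fraction carries it back, and so the two Hilbert functions
  agree.\<close>

lemma differ_by_div_imp:
  assumes Y: "closed Y" "closed Y'" and v: "val n g h" "\<not> F dvd g" and df: "differ_by_div F Y (R g h) Y'"
  shows "\<And>a k. a \<in> Y \<inter> gr k \<Longrightarrow> \<exists>c\<in>Y' \<inter> gr k. g * a \<doteq> h * c"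
    and "\<And>c k. c \<in> Y' \<inter> gr k \<Longrightarrow> \<exists>a\<in>Y \<inter> gr k. h * c \<doteq> g * a"
proof -
  fix a k assume a: "a \<in> Y \<inter> gr k"
  show "\<exists>c\<in>Y' \<inter> gr k. g * a \<doteq> h * c"
  proof (rule transfer_local[OF Y(2) v(1)])
    show "a \<in> gr k" using a by blast
    fix p assume p: "p \<in> points F"
    show "\<exists>b c. eval3 b p \<noteq> 0 \<and> c \<in> Y' \<and> b * (g * a) \<doteq> c * h"
    proof (cases "a = 0")
      case True
      then show ?thesis using hidD(1)[OF closedD(1)[OF Y(2)]] by (intro exI[of _ 1] exI[of _ 0]) simp
    next
      case False
      obtain l where l: "l \<in> gr k" "eval3 l p \<noteq> 0" using exists_unit_form[OF p _ False] a by blast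
      have "R a l \<in> ideal_stalk F Y p" unfolding stalk_iff using a l by blast
      then have "R g h \<otimes>\<^bsub>K\<^esub> R a l \<in> ideal_stalk F Y' p"
        using df p unfolding differ_by_div_def l_coset_def by blast
      then obtain c b j where c: "R g h \<otimes>\<^bsub>K\<^esub> R a l = R c b" "c \<in> Y'" "c \<in> gr j" "b \<in> gr j" "eval3 b p \<noteq> 0"
        unfolding stalk_iff by blast
      have v': "val k a l" "val j c b" using val_of_eval[OF p] a l c by blast+
      have "g * a * b \<doteq> c * (h * l)" using c(1) R_mult[OF v(1) v'(1)] R_eq_iff[OF val_mult[OF v(1) v'(1)] v'(2)] by simp
      then have "b * (g * a) \<doteq> (c * l) * h" by (simp add: algebra_simps)
      moreover have "c * l \<in> Y'" by (rule hidD(4)[OF closedD(1)[OF Y(2)] c(2)])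
      ultimately show ?thesis using c(5) by blast
    qed
  qed
next
  fix c k assume c: "c \<in> Y' \<inter> gr k"
  have vi: "val n h g" using v unfolding val_def by blast
  show "\<exists>a\<in>Y \<inter> gr k. h * c \<doteq> g * a"
  proof (rule transfer_local[OF Y(1) vi])
    show "c \<in> gr k" using c by blast
    fix p assume p: "p \<in> points F"
    show "\<exists>b a. eval3 b p \<noteq> 0 \<and> a \<in> Y \<and> b * (h * c) \<doteq> a * g"
    proof (cases "c = 0")
      case True
      then show ?thesis using hidD(1)[OF closedD(1)[OF Y(1)]] by (intro exI[of _ 1] exI[of _ 0]) simp
    next
      case False
      obtain l where l: "l \<in> gr k" "eval3 l p \<noteq> 0" using exists_unit_form[OF p _ False] c by blast
      have "R c l \<in> ideal_stalk F Y' p" unfolding stalk_iff using c l by blast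
      then have "R c l \<in> R g h <#\<^bsub>K\<^esub> ideal_stalk F Y p" using df p unfolding differ_by_div_def by blast
      then obtain a b j where a: "R c l = R g h \<otimes>\<^bsub>K\<^esub> R a b" "a \<in> Y" "a \<in> gr j" "b \<in> gr j" "eval3 b p \<noteq> 0"
        unfolding l_coset_def by (auto simp: stalk_iff)
      have v': "val k c l" "val j a b" using val_of_eval[OF p] a l c by blast+
      have "c * (h * b) \<doteq> g * a * l" using a(1) R_mult[OF v(1) v'(2)] R_eq_iff[OF v'(1) val_mult[OF v(1) v'(2)]] by simp
      then have "b * (h * c) \<doteq> (a * l) * g" by (simp add: algebra_simps)
      moreover have "a * l \<in> Y" by (rule hidD(4)[OF closedD(1)[OF Y(1)] a(2)])
      ultimately show ?thesis using a(5) by blast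
    qed
  qed
qed

lemma H_differ:
  assumes Y: "closed Y" "closed Y'" and v: "val n g h" "\<not> F dvd g" and df: "differ_by_div F Y (R g h) Y'"
  shows "H Y' k = H Y k"
proof -
  note t = differ_by_div_imp[OF assms]
  have h: "\<not> F dvd h" using v(1) unfolding val_def by blast
  have "H Y k = rd ((*) g ` (Y \<inter> gr k))"
    unfolding H_def by (rule rd_mult[symmetric, OF v(2) subspace_piece[OF closedD(1)[OF Y(1)]] fin_dim_piece])
  also have "\<dots> = rd ((*) h ` (Y' \<inter> gr k))"
    by (rule rd_cong) (use t in blast)+
  also have "\<dots> = H Y' k"
    unfolding H_def by (rule rd_mult[OF h subspace_piece[OF closedD(1)[OF Y(2)]] fin_dim_piece])
  finally show ?thesis by simp
qed

end

section \<open>Noether's theorem\<close>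

lemma plane_curve_of_irreducible:
  fixes F :: "'k::{alg_closed_field,field_char_0} poly3"
  assumes "irreducible_plane_curve d F"
  shows "plane_curve F d"
proof -
  have F: "F \<noteq> 0" "F \<in> gr (int d)" and pr: "primeideal (PIdl\<^bsub>poly3_ring\<^esub> F) poly3_ring"
    using assms unfolding irreducible_plane_curve_def form_iff_gr by blast+
  have mem: "a \<in> PIdl\<^bsub>poly3_ring\<^esub> F \<longleftrightarrow> F dvd a" for a
    unfolding cgenideal_def by (auto simp: dvd_def mult.commute)
  have "prime_elem F"
  proof (rule prime_elemI)
    show "\<not> F dvd 1"
    proof
      assume "F dvd 1"
      then have "PIdl\<^bsub>poly3_ring\<^esub> F = UNIV" using mem dvd_trans[OF _ one_dvd] by blast
      then show False using primeideal.I_notcarr[OF pr] by simp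
    qed
    show "F dvd a \<or> F dvd b" if "F dvd a * b" for a b
      using primeideal.I_prime[OF pr, of a b] that mem by simp
  qed (rule F(1))
  moreover have "0 < d"
  proof (rule ccontr)
    assume "\<not> 0 < d"
    then obtain u where u: "F = const3 u" using F(2) gr_zero_const by auto
    then have "u \<noteq> 0" using F(1) by (auto simp: const3_def)
    then have "F * const3 (1 / u) = 1" unfolding u by (simp add: const3_def one_pCons)
    then have "F dvd 1" by (metis dvd_triv_left)
    then show False using \<open>prime_elem F\<close> unfolding prime_elem_def by blast
  qed
  ultimately show ?thesis using F by unfold_locales
qed

context plane_curve
begin

text \<open>For k = 0 the last clause is Riemann-Roch; general k is the same for O(Y) twisted by k,
  and k = 1 - s produces the fixed section in the extremal case. Doubling avoids the division in
  \<open>euler\<close>.\<close>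

lemma linked_sections:
  assumes Y: "group_of_points F Y" "has_degree Y \<alpha>"
  shows "\<exists>h m. h \<in> Y \<and> h \<in> gr m \<and> \<not> F dvd h \<and>
    global_sections F Y = (\<lambda>g. R g h) ` (colon (princ h) Y \<inter> gr m) \<and>
    (\<forall>k. 2 * H (colon (princ h) Y) (m + k) =
       2 * H Y (int d - 3 - k) + 2 * int d * k - int d * int d + 3 * int d + 2 * int \<alpha>)"
proof -
  have gp: "closed Y" "finite (support Y)" "locally_principal Y" using Y(1) group_of_points_iff by blast+
  have ev: "eventually_linear Y (euler - int \<alpha>)" by (rule has_degree_imp[OF gp(1) Y(2)])
  obtain m h where h: "h \<in> Y" "h \<in> gr m" "\<not> F dvd h"
    using eventually_linear_nonzero[OF ev] by (meson IntD1 IntD2 order_refl)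
  have "2 * H (colon (princ h) Y) (m + k) =
       2 * H Y (int d - 3 - k) + 2 * int d * k - int d * int d + 3 * int d + 2 * int \<alpha>" for k
  proof -
    have ij: "(int d - 3 - k) + (m + k) = int d - 3 + m" by simp
    have "H (colon (princ h) Y) (m + k) =
        H Y (int d - 3 - k) + int d * (m + k) - int d * (int d - 3 + m) - (euler - int \<alpha>)"
      by (rule hilbert_linked[OF gp(1) ev gp(3,2) h ij])
    then show ?thesis using two_euler by (simp add: algebra_simps)
  qed
  then show ?thesis using h global_sections_eq[OF gp(1) h] by blast
qed

text \<open>If g in Y of degree a were nonzero in S, Y would contain all multiples of g, and
  comparing Hilbert polynomials would give \<alpha> <= d a, an inequality of Bezout type.\<close>

lemma H_eq_0_of_large_degree:
  assumes Y: "closed Y" and ev: "eventually_linear Y (euler - \<alpha>)" and \<alpha>: "\<alpha> > int d * a"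
  shows "H Y a = 0"
proof (rule ccontr)
  assume "H Y a \<noteq> 0"
  then have "H Y a > 0" using H_nonneg[of Y a] by linarith
  then obtain g where g: "g \<in> Y" "g \<in> gr a" "\<not> F dvd g" using H_pos_imp by blast
  obtain n0 where n0: "\<And>n. n \<ge> n0 \<Longrightarrow> H Y n = int d * n + (euler - \<alpha>)"
    using ev unfolding eventually_linear_def by blast
  define n where "n = max n0 (int d - 2 + a)"
  have n: "n \<ge> n0" "n - a \<ge> int d - 2" by (auto simp: n_def)
  have "H UNIV (n - a) = rd ((*) g ` gr (n - a))"
    unfolding H_UNIV by (rule rd_mult[symmetric, OF g(3) subspace_gr fin_dim_gr])
  also have "\<dots> \<le> H Y n"
    unfolding H_def
  proof (rule rd_mono[OF fin_dim_piece])
    fix v assume "v \<in> (*) g ` gr (n - a)"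
    then have "v \<in> Y \<inter> gr n"
      using hidD(4)[OF closedD(1)[OF Y] g(1)] gr_mult_eq[OF g(2), of _ "n - a" n] by auto
    then show "\<exists>w\<in>Y \<inter> gr n. v \<doteq> w" by (intro bexI[of _ v]) auto
  qed
  finally show False
    using n0[OF n(1)] H_UNIV_linear[OF n(2)] \<alpha> by (simp add: algebra_simps)
qed

lemma two_genus: "2 * ((int d - 1) * (int d - 2) div 2) = (int d - 1) * (int d - 2)"
proof -
  have "even ((int d - 1) * (int d - 2))" by (cases "even (int d)") auto
  then show ?thesis by simp
qed

lemma complete_system_dim:
  assumes s: "int s \<ge> int d - 2" and r: "r < d" and \<alpha>: "int \<alpha> = int s * int d - int r"
    and V: "complete_linear_system_of_degree F \<alpha> V L"
  shows "linear_system_dim F V (int \<alpha> - (int d - 1) * (int d - 2) div 2)"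
proof -
  obtain Y where Y: "group_of_points F Y" "has_degree Y \<alpha>" "V = global_sections F Y"
    using V unfolding complete_linear_system_of_degree_def by blast
  have cl: "closed Y" using Y(1) group_of_points_iff by blast
  obtain h m where h: "h \<in> Y" "h \<in> gr m" "\<not> F dvd h"
    and gs: "global_sections F Y = (\<lambda>g. R g h) ` (colon (princ h) Y \<inter> gr m)"
    and H: "\<forall>k. 2 * H (colon (princ h) Y) (m + k) =
       2 * H Y (int d - 3 - k) + 2 * int d * k - int d * int d + 3 * int d + 2 * int \<alpha>"
    using linked_sections[OF Y(1,2)] by blast
  \<comment> \<open>Since s >= d - 2 and r < d, the degree exceeds d (d - 3); so no form of degree d
    - 3 nonzero in S lies in Y, and the correction term of Riemann-Roch vanishes.\<close>
  have "int d * (int d - 2) \<le> int d * int s" by (rule mult_left_mono) (use s in simp_all)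
  then have "int \<alpha> > int d * (int d - 3)" using \<alpha> r by (simp add: algebra_simps)
  then have "H Y (int d - 3) = 0"
    by (rule H_eq_0_of_large_degree[OF cl has_degree_imp[OF cl Y(2)]])
  then have D: "H (colon (princ h) Y) m = int \<alpha> - (int d - 1) * (int d - 2) div 2 + 1"
    using H[rule_format, of 0] two_genus by (simp add: algebra_simps)
  have hid: "hid (colon (princ h) Y)"
    by (rule closedD(1)[OF closed_colon[OF closed_princ[OF h(2,3)] closedD(1)[OF cl]]])
  have "ring.dimension K (nat (H (colon (princ h) Y) m)) (constants F) V"
    unfolding Y(3) gs H_def by (rule dimension_R[OF h(2,3) subspace_piece[OF hid]]) simp
  then show ?thesis
    unfolding linear_system_dim_def
    using D H_nonneg[of "colon (princ h) Y" m] by (intro exI[of _ "nat (H (colon (princ h) Y) m)"]) simp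
qed

lemma hilbert_numerics_H:
  assumes cl: "closed Y" and ev: "eventually_linear Y (euler - int \<alpha>)"
    and s: "int s \<le> int d - 3" and \<alpha>: "int \<alpha> = int s * int d - int r"
  shows "hilbert_numerics (H Y) (int d) (int s) (int r) (int \<alpha>)"
proof
  show "H Y n = 0" if "n < 0" for n by (rule H_neg[OF that])
  show "H Y n - H Y (n - 1) \<le> H Y (n + 1) - H Y n" for n
    using second_difference[OF cl, of n 1] by simp
  show "int d \<le> H Y (n - 1) - H Y (n - 2)"
    if "0 < H Y (n - 1)" "H Y n - H Y (n - 1) = H Y (n - 1) - H Y (n - 2)" for n
    by (rule gap[OF cl _ that(1)]) (use that(2) in simp)
  obtain n0 where n0: "\<And>n. n \<ge> n0 \<Longrightarrow> H Y n = int d * n + (euler - int \<alpha>)"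
    using ev unfolding eventually_linear_def by blast
  show "\<exists>n0. \<forall>n\<ge>n0. 2 * H Y n = 2 * int d * n + 3 * int d - int d * int d - 2 * int \<alpha>"
  proof (intro exI[of _ n0] allI impI)
    fix n assume "n \<ge> n0"
    then show "2 * H Y n = 2 * int d * n + 3 * int d - int d * int d - 2 * int \<alpha>"
      using two_euler n0[of n] by (simp add: algebra_simps)
  qed
qed (use s \<alpha> in simp_all)

lemma subsystem_pullback:
  assumes J: "hid J" and h: "h \<in> gr m" "\<not> F dvd h"
    and V: "subalgebra (constants F) V K" "V \<subseteq> (\<lambda>g. R g h) ` (J \<inter> gr m)"
  obtains W where "lin3.subspace W" "W \<subseteq> J \<inter> gr m" "V = (\<lambda>g. R g h) ` W"
    "ring.dimension K (nat (rd W)) (constants F) V"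
proof -
  interpret V: subalgebra "constants F" V K by (rule V(1))
  let ?W = "{g \<in> J \<inter> gr m. R g h \<in> V}"
  have v: "val m g h" if "g \<in> gr m" for g using that h unfolding val_def by blast
  have "lin3.subspace ?W"
    unfolding lin3.subspace_def
  proof (intro conjI ballI allI)
    have "R 0 h = \<zero>\<^bsub>K\<^esub>" using R_eq_zero_iff[OF v] by simp
    moreover have "\<zero>\<^bsub>K\<^esub> \<in> V" using V.one_closed by simp
    ultimately show "0 \<in> ?W" using hidD(1)[OF J] by simp
    fix g assume g: "g \<in> ?W"
    show "sc c g \<in> ?W" for c
    proof -
      have "R (const3 c) 1 \<otimes>\<^bsub>K\<^esub> R g h \<in> V"
        by (rule V.smult_closed) (use g in \<open>auto simp: constants_def\<close>)
      then show ?thesis using g hidD(8)[OF J] sc_gr R_sc[OF v, of g c] by auto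
    qed
    fix g' assume g': "g' \<in> ?W"
    have "R g h \<oplus>\<^bsub>K\<^esub> R g' h \<in> V" using V.m_closed[of "R g h" "R g' h"] g g' by simp
    then show "g + g' \<in> ?W"
      using g g' hidD(2)[OF J] gr_add R_add_same[OF v v, of g g'] by auto
  qed
  moreover have "V = (\<lambda>g. R g h) ` ?W" using V(2) by blast
  moreover have "ring.dimension K (nat (rd ?W)) (constants F) ((\<lambda>g. R g h) ` ?W)"
    by (rule dimension_R[OF h \<open>lin3.subspace ?W\<close>]) blast
  ultimately show ?thesis using that[of ?W] by auto
qed

lemma two_max_dim:
  "2 * (max_dim s r + 1) = (if r \<le> s + 1 then (int s + 1) * (int s + 2) - 2 * int r else int s * (int s + 1))"
proof -
  have "even (int s * (int s + 3))" "even ((int s - 1) * (int s + 2))" by (cases "even (int s)"; auto)+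
  then have "2 * (int s * (int s + 3) div 2) = int s * (int s + 3)"
    "2 * ((int s - 1) * (int s + 2) div 2) = (int s - 1) * (int s + 2)" by simp_all
  then show ?thesis unfolding max_dim_def by (simp add: algebra_simps)
qed

text \<open>The counts (s + 1)(s + 2)/2 - r and s(s + 1)/2 differ by s + 1 - r, so
  \<open>max_dim s r + 1\<close> is their maximum and covers both cases.\<close>

lemma sections_bound:
  assumes N: "hilbert_numerics (H Y) (int d) (int s) (int r) (int \<alpha>)"
    and D: "2 * D = 2 * H Y (int d - 3) - int d * int d + 3 * int d + 2 * int \<alpha>"
  shows "D \<le> max_dim s r + 1"
proof -
  interpret hilbert_numerics "H Y" "int d" "int s" "int r" "int \<alpha>" by (rule N)
  have "2 * D \<le> 2 * (max_dim s r + 1)"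
  proof (cases "int d - int s \<le> H Y (int d - 2) - H Y (int d - 3)")
    case True
    then show ?thesis using case_large(1)[OF True] D unfolding two_max_dim by (simp add: algebra_simps)
  next
    case False
    then have "H Y (int d - 2) - H Y (int d - 3) \<le> int d - int s - 1" by simp
    from case_small(1)[OF this] show ?thesis using D unfolding two_max_dim by (auto simp: algebra_simps)
  qed
  then show ?thesis by simp
qed

text \<open>A form G of degree s in Y, nonzero in S, links Y to J = (F, G) : Y. By
  \<open>hilbert_linked\<close> J has degree s d - \<alpha> = r; it is again a group of points, and
  \<open>colon_colon\<close> recovers Y from it.\<close>

lemma residual_in_section_of_section:
  assumes Y: "group_of_points F Y" "has_degree Y \<alpha>" and \<alpha>: "int \<alpha> = int s * int d - int r"
    and pos: "0 < H Y (int s)"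
  shows "residual_in_section F s r Y"
proof -
  have gp: "closed Y" "finite (support Y)" "locally_principal Y" using Y(1) group_of_points_iff by blast+
  have ev: "eventually_linear Y (euler - int \<alpha>)" by (rule has_degree_imp[OF gp(1) Y(2)])
  obtain G where G: "G \<in> Y" "G \<in> gr (int s)" "\<not> F dvd G" using H_pos_imp[OF pos] by blast
  let ?J = "colon (princ G) Y"
  have cG: "closed (princ G)" by (rule closed_princ[OF G(2,3)])
  have J: "closed ?J" by (rule closed_colon[OF cG closedD(1)[OF gp(1)]])
  have evJ: "eventually_linear ?J (euler - int r)"
    unfolding eventually_linear_def
  proof (intro exI[of _ "int d + int s"] allI impI)
    fix n assume n: "n \<ge> int d + int s"
    have ij: "(int d - 3 + int s - n) + n = int d - 3 + int s" by simp
    have "H ?J n = H Y (int d - 3 + int s - n) + int d * n - int d * (int d - 3 + int s) - (euler - int \<alpha>)"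
      by (rule hilbert_linked[OF gp(1) ev gp(3,2) G ij])
    also have "H Y (int d - 3 + int s - n) = 0" by (rule H_neg) (use n in simp)
    finally show "H ?J n = int d * n + (euler - int r)"
      using \<alpha> two_euler by (simp add: algebra_simps)
  qed
  have gJ: "group_of_points F ?J"
    unfolding group_of_points_iff
    using J finite_support_of_linear[OF J evJ] locally_principal_colon[OF gp(1) ev gp(3) G] by blast
  have ZY: "princ G \<subseteq> Y"
    using closed_cong[OF gp(1)] hidD(4)[OF closedD(1)[OF gp(1)] G(1)] unfolding princ_def by blast
  have ZJ: "princ G \<subseteq> ?J" using hidD(4)[OF closedD(1)[OF cG]] unfolding colon_def by blast
  have "Y = {f. \<forall>g\<in>?J. f * g \<in> princ G}"
    using colon_colon[OF gp(1) ev gp(3) G] unfolding colon_def[of _ ?J] by simp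
  then have "residual Y ?J (curve_intersection F G)"
    unfolding residual_def curve_intersection_eq[OF G(2,3)] using ZY ZJ by blast
  moreover have "cutting_curve F s G" unfolding cutting_curve_def form_iff_gr using G by blast
  ultimately show ?thesis
    unfolding residual_in_section_def using gJ has_degree_of[OF J evJ] by blast
qed

text \<open>When the bound is attained with \<open>H (d - 2) - H (d - 3) \<ge> d - s\<close>, there is a rational function
  \<open>b / h\<close> such that all sections of \<open>O(Y)\<close> are the products of \<open>b / h\<close> with forms of degree \<open>s - 1\<close>.\<close>

lemma contains_section_of_divisible:
  assumes cl: "closed Y" "closed Y'" and s: "1 \<le> s" "int s \<le> int d - 3"
    and h: "h \<in> gr m" "\<not> F dvd h" and J: "J = colon (princ h) Y"
    and b: "0 < H J (m + 1 - int s)" and D: "2 * H J m = int s * (int s + 1)"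
    and g: "g \<in> J" "g \<in> gr m" "\<not> F dvd g" and df: "differ_by_div F Y (R g h) Y'"
  shows "contains_section F (s - 1) Y'"
proof -
  have hJ: "hid J" unfolding J by (rule closedD(1)[OF closed_colon[OF closed_princ[OF h] closedD(1)[OF cl(1)]]])
  obtain b where b: "b \<in> J" "b \<in> gr (m + 1 - int s)" "\<not> F dvd b" using H_pos_imp[OF b] by blast
  let ?W = "(*) b ` gr (int s - 1)"
  have sW: "lin3.subspace ?W" by (intro subspace_mult_image subspace_gr)
  have sub: "?W \<subseteq> J \<inter> gr m"
    using hidD(4)[OF hJ b(1)] gr_mult_eq[OF b(2), of _ "int s - 1" m] by auto
  \<comment> \<open>The products of b with forms of degree s - 1 already have dimension s(s + 1)/2
    in S, the dimension of J in degree m; so every section has a numerator of this shape.\<close>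
  have "rd ?W = H UNIV (int s - 1)"
    unfolding H_UNIV by (rule rd_mult[OF b(3) subspace_gr fin_dim_gr])
  moreover have "2 * H UNIV (int s - 1) = int s * (int s + 1)"
    using two_H_UNIV_small[of "int s - 1"] s by simp
  ultimately have "lin3.qdim zeroF (J \<inter> gr m) \<le> lin3.qdim zeroF ?W"
    using D unfolding H_def rd_def by linarith
  moreover have "\<exists>w\<in>J \<inter> gr m. v - w \<in> zeroF" if "v \<in> ?W" for v
    using sub that by (intro bexI[of _ v]) auto
  ultimately have "\<exists>v\<in>?W. g - v \<in> zeroF"
    using lin3.qdim_eq_imp[OF sub_zeroF sW fin_dim_piece, of J m g] g by blast
  then obtain G where G: "G \<in> gr (int s - 1)" "g \<doteq> b * G" by blast
  have nG: "\<not> F dvd G" using cong_dvd[OF G(2)] g(3) dvd_mult_iff by blast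
  have Gf: "G \<in> gr (int (s - 1))" using G(1) s(1) by (simp add: of_nat_diff)
  have v: "val m g h" using g h unfolding val_def by blast
  \<comment> \<open>In S, a component f of an element of Y' satisfies h f = g a with a in Y. From g
    = b G and b a = h e it follows that h f = h G e, hence f = G e.\<close>
  have "Y' \<subseteq> princ G"
  proof
    fix f assume f: "f \<in> Y'"
    show "f \<in> princ G"
    proof (rule hid_memI[OF hid_princ[OF Gf]])
      fix k
      have "hcomp k f \<in> Y' \<inter> gr k" using hidD(5)[OF closedD(1)[OF cl(2)] f] hcomp_gr by blast
      then obtain a where a: "a \<in> Y" "h * hcomp k f \<doteq> g * a"
        using differ_by_div_imp(2)[OF cl v g(3) df] by blast
      obtain e where e: "b * a \<doteq> h * e" using b(1) a(1) unfolding J colon_def princ_def by blast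
      have "h * hcomp k f \<doteq> (b * G) * a" using cong_trans[OF a(2) cong_mult_right[OF G(2)]] .
      moreover have "(b * G) * a \<doteq> h * (G * e)" using cong_mult_left[OF e, of G] by (simp add: algebra_simps)
      ultimately have "h * hcomp k f \<doteq> h * (G * e)" by (rule cong_trans)
      then have "hcomp k f \<doteq> G * e" using cong_cancel h(2) by blast
      then show "hcomp k f \<in> princ G" unfolding princ_def by blast
    qed
  qed
  moreover have "cutting_curve F (s - 1) G" unfolding cutting_curve_def form_iff_gr using Gf nG by blast
  ultimately show ?thesis
    unfolding contains_section_def using curve_intersection_eq[OF Gf nG] by blast
qed

text \<open>Which of the two counts applies depends only on the Hilbert function of Y0, and by
  \<open>H_differ\<close> every member Y of the system shares it; so a curve of degree s through Y
  is found from H Y0 alone.\<close>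

lemma linear_system_dim_bound:
  assumes s: "int s \<le> int d - 3" and \<alpha>: "int \<alpha> = int s * int d - int r"
    and VL: "linear_system F \<alpha> V L"
  shows "\<exists>n. linear_system_dim F V n \<and> n \<le> max_dim s r"
    and "linear_system_dim F V (max_dim s r) \<Longrightarrow> Y \<in> L \<Longrightarrow>
      (r \<le> s + 1 \<and> residual_in_section F s r Y) \<or> (s + 1 \<le> r \<and> contains_section F (s - 1) Y)"
proof -
  obtain Y0 where Y0: "group_of_points F Y0" "has_degree Y0 \<alpha>" "linear_subsystem F Y0 V L"
    using VL unfolding linear_system_def by blast
  have cl: "closed Y0" using Y0(1) group_of_points_iff by blast
  have V: "subalgebra (constants F) V K" "V \<subseteq> global_sections F Y0"
    and L: "L = {Y' \<in> complete_linear_system F Y0. \<exists>f \<in> V - {\<zero>\<^bsub>K\<^esub>}. differ_by_div F Y0 f Y'}"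
    using Y0(3) unfolding linear_subsystem_def by blast+
  obtain h m where h: "h \<in> Y0" "h \<in> gr m" "\<not> F dvd h"
    and gs: "global_sections F Y0 = (\<lambda>g. R g h) ` (colon (princ h) Y0 \<inter> gr m)"
    and H: "\<forall>k. 2 * H (colon (princ h) Y0) (m + k) =
       2 * H Y0 (int d - 3 - k) + 2 * int d * k - int d * int d + 3 * int d + 2 * int \<alpha>"
    using linked_sections[OF Y0(1,2)] by blast
  define J where "J = colon (princ h) Y0"
  have hJ: "hid J" unfolding J_def
    by (rule closedD(1)[OF closed_colon[OF closed_princ[OF h(2,3)] closedD(1)[OF cl]]])
  obtain W where W: "lin3.subspace W" "W \<subseteq> J \<inter> gr m" "V = (\<lambda>g. R g h) ` W"
      "ring.dimension K (nat (rd W)) (constants F) V"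
    using subsystem_pullback[OF hJ h(2,3) V(1)] V(2) unfolding gs J_def by blast
  have rdW: "rd W \<le> H J m"
    unfolding H_def by (rule rd_mono[OF fin_dim_piece]) (use W(2) in \<open>auto intro!: bexI\<close>)
  have N: "hilbert_numerics (H Y0) (int d) (int s) (int r) (int \<alpha>)"
    by (rule hilbert_numerics_H[OF cl has_degree_imp[OF cl Y0(2)] s \<alpha>])
  have D: "2 * H J m = 2 * H Y0 (int d - 3) - int d * int d + 3 * int d + 2 * int \<alpha>"
    using H[rule_format, of 0] unfolding J_def by simp
  have bound: "H J m \<le> max_dim s r + 1" by (rule sections_bound[OF N D])
  have "linear_system_dim F V (rd W - 1)"
    unfolding linear_system_dim_def using W(4) by (intro exI[of _ "nat (rd W)"]) simp
  then show "\<exists>n. linear_system_dim F V n \<and> n \<le> max_dim s r"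
    using rdW bound by (intro exI[of _ "rd W - 1"]) simp
  assume dim: "linear_system_dim F V (max_dim s r)" and YL: "Y \<in> L"
  interpret K: Ring.field K by (rule K_field)
  have "rd W = max_dim s r + 1"
  proof -
    obtain k where k: "K.dimension k (constants F) V" "max_dim s r = int k - 1"
      using dim unfolding linear_system_dim_def by blast
    have "k = nat (rd W)" by (rule K.dimension_is_inj[OF subfield_constants k(1) W(4)])
    then show ?thesis using k(2) rd_nonneg[of W] by simp
  qed
  \<comment> \<open>A system of maximal dimension fills the complete one, so the extremal conditions
    can be read off J.\<close>
  then have eq: "2 * H J m = 2 * (max_dim s r + 1)" using rdW bound by simp
  obtain f where f: "f \<in> V" "f \<noteq> \<zero>\<^bsub>K\<^esub>" "differ_by_div F Y0 f Y" and Y: "group_of_points F Y"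
    using YL unfolding L complete_linear_system_def by blast
  obtain g where g: "g \<in> W" "f = R g h" using f(1) W(3) by blast
  have gJ: "g \<in> J" "g \<in> gr m" using g(1) W(2) by blast+
  have v: "val m g h" using gJ h unfolding val_def by blast
  have ng: "\<not> F dvd g" using f(2) R_eq_zero_iff[OF v] g(2) by simp
  have clY: "closed Y" using Y group_of_points_iff by blast
  have df: "differ_by_div F Y0 (R g h) Y" using f(3) g(2) by simp
  have HY: "H Y k = H Y0 k" for k by (rule H_differ[OF cl clY v ng df])
  have evY: "eventually_linear Y (euler - int \<alpha>)"
    using has_degree_imp[OF cl Y0(2)] unfolding eventually_linear_def HY .
  have degY: "has_degree Y \<alpha>" by (rule has_degree_of[OF clY evY])
  interpret hilbert_numerics "H Y0" "int d" "int s" "int r" "int \<alpha>" by (rule N)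
  show "(r \<le> s + 1 \<and> residual_in_section F s r Y) \<or> (s + 1 \<le> r \<and> contains_section F (s - 1) Y)"
  proof (cases "int d - int s \<le> H Y0 (int d - 2) - H Y0 (int d - 3)")
    case True
    \<comment> \<open>In this case the bound is attained only if s(s + 1)/2 is the larger count,
      that is, if r >= s + 1.\<close>
    have "2 * (max_dim s r + 1) \<le> int s * (int s + 1)" using case_large(1)[OF True] D eq by simp
    then have rs: "s + 1 \<le> r" and eq': "2 * (max_dim s r + 1) = int s * (int s + 1)"
      unfolding two_max_dim by (auto simp: algebra_simps split: if_splits)
    \<comment> \<open>With s = 0 and r >= 1 the degree would be negative; so s - 1 is a genuine
      degree, and truncated subtraction does no harm.\<close>
    have s1: "1 \<le> s"
    proof (rule ccontr)
      assume "\<not> 1 \<le> s"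
      then have "s = 0" by simp
      then have "int \<alpha> < 0" using \<alpha> rs by simp
      then show False by simp
    qed
    have D': "2 * H J m = int s * (int s + 1)" using eq eq' by simp
    \<comment> \<open>Riemann-Roch in the twist 1 - s yields a nonzero section, whose numerator is
      the common factor b.\<close>
    have "2 \<le> 2 * H J (m + (1 - int s))"
    proof -
      have "2 \<le> 2 * H Y0 (int d - 4 + int s) + 2 * int d * (1 - int s) - int d * int d + 3 * int d + 2 * int \<alpha>"
        by (rule case_large(2)[OF True]) (use s1 D D' in simp_all)
      moreover have e: "int d - 3 - (1 - int s) = int d - 4 + int s" by simp
      ultimately show ?thesis using H[rule_format, of "1 - int s"] unfolding J_def e by linarith
    qed
    then have pos: "0 < H J (m + 1 - int s)" by (simp add: algebra_simps)
    have "contains_section F (s - 1) Y"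
      by (rule contains_section_of_divisible[OF cl clY s1 assms(1) h(2,3) J_def pos D' gJ ng df])
    then show ?thesis using rs by blast
  next
    case False
    then have j: "H Y0 (int d - 2) - H Y0 (int d - 3) \<le> int d - int s - 1" by simp
    have "2 * (max_dim s r + 1) \<le> (int s + 1) * (int s + 2) - 2 * int r"
      using case_small(1)[OF j] D eq by simp
    then have rs: "r \<le> s + 1" and eq': "2 * (max_dim s r + 1) = (int s + 1) * (int s + 2) - 2 * int r"
      unfolding two_max_dim by (auto simp: algebra_simps split: if_splits)
    have "0 < H Y0 (int s)" by (rule case_small(2)[OF j]) (use D eq eq' in simp)
    then have "residual_in_section F s r Y"
      using residual_in_section_of_section[OF Y degY \<alpha>] HY by simp
    then show ?thesis using rs by blast
  qed
qed

end

theorem mainTheorem13: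
  fixes F :: "'k::{alg_closed_field, field_char_0} poly3"
    and d s r \<alpha> :: nat
  assumes "irreducible_plane_curve d F"
    and "r < d"
    and "int \<alpha> = int s * int d - int r"
  shows "(int s \<ge> int d - 2 \<longrightarrow>
           (\<forall>V L. complete_linear_system_of_degree F \<alpha> V L \<longrightarrow>
              linear_system_dim F V (int \<alpha> - (int d - 1) * (int d - 2) div 2)))
       \<and> (int s \<le> int d - 3 \<longrightarrow>
           (\<forall>V L. linear_system F \<alpha> V L \<longrightarrow>
              (\<exists>n. linear_system_dim F V n \<and> n \<le> max_dim s r))
         \<and> (\<forall>V L Y. linear_system F \<alpha> V L \<and> linear_system_dim F V (max_dim s r) \<and> Y \<in> L \<longrightarrow>
              (r \<le> s \<longrightarrow> residual_in_section F s r Y)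
            \<and> (r \<ge> s + 2 \<longrightarrow> contains_section F (s - 1) Y)
            \<and> (r = s + 1 \<longrightarrow> residual_in_section F s r Y \<or> contains_section F (s - 1) Y)))"
proof -
  interpret plane_curve F d by (rule plane_curve_of_irreducible[OF assms(1)])
  have 1: "linear_system_dim F V (int \<alpha> - (int d - 1) * (int d - 2) div 2)"
    if "int s \<ge> int d - 2" "complete_linear_system_of_degree F \<alpha> V L" for V L
    by (rule complete_system_dim[OF that(1) assms(2,3) that(2)])
  have 2: "\<exists>n. linear_system_dim F V n \<and> n \<le> max_dim s r"
    if "int s \<le> int d - 3" "linear_system F \<alpha> V L" for V L
    by (rule linear_system_dim_bound(1)[OF that(1) assms(3) that(2)])
  have 3: "(r \<le> s + 1 \<and> residual_in_section F s r Y) \<or> (s + 1 \<le> r \<and> contains_section F (s - 1) Y)"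
    if "int s \<le> int d - 3" "linear_system F \<alpha> V L" "linear_system_dim F V (max_dim s r)" "Y \<in> L" for V L Y
    by (rule linear_system_dim_bound(2)[OF that(1) assms(3) that(2-4)])
  show ?thesis
  proof (intro conjI impI allI)
    fix V L assume "int d - 2 \<le> int s" "complete_linear_system_of_degree F \<alpha> V L"
    then show "linear_system_dim F V (int \<alpha> - (int d - 1) * (int d - 2) div 2)" by (rule 1)
  next
    fix V L assume "int s \<le> int d - 3" "linear_system F \<alpha> V L"
    then show "\<exists>n. linear_system_dim F V n \<and> n \<le> max_dim s r" by (rule 2)
  next
    fix V L Y
    assume s: "int s \<le> int d - 3"
      and Y: "linear_system F \<alpha> V L \<and> linear_system_dim F V (max_dim s r) \<and> Y \<in> L"
    then have *: "(r \<le> s + 1 \<and> residual_in_section F s r Y) \<or> (s + 1 \<le> r \<and> contains_section F (s - 1) Y)"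
      using 3 by blast
    show "residual_in_section F s r Y" if "r \<le> s" using * that by linarith
    show "contains_section F (s - 1) Y" if "s + 2 \<le> r" using * that by linarith
    show "residual_in_section F s r Y \<or> contains_section F (s - 1) Y" using * by blast
  qed
qed

end
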